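(* Let $\mathbf{k}$ be a field and let $Q$ be a connected, finite, acyclic quiver with vertex set $Q_0=\{1,\dots,r\}$. Assume that $Q$ is non-Dynkin, and let $v=(v_i)_{i\in Q_0}\in\mathbf{k}Q_0$ be any element. Let ${}^{v}\!\Lambda={}^{v}\!\Lambda(Q)$ be the corresponding central extension of the preprojective algebra, and let $C$ be the adjacency matrix of the double quiver $\overline{Q}$. Then the (matrix-valued) Hilbert series of ${}^{v}\!\Lambda$ is $$h_{{}^{v}\!\Lambda}(t)=\frac{1}{(1-Ct+t^{2})(1-t^{2})}$$ as an identity in the ring $M_r(\mathbb{Z})[[t]]$.
   Context: A quiver is Dynkin if its underlying graph is a Dynkin diagram of type $A_n$, $D_n$, $E_6$, $E_7$ or $E_8$; non-Dynkin means not Dynkin. The double quiver $\overline{Q}$ is obtained from $Q$ by adding an opposite arrow $\alpha^*:j\to i$ for each arrow $\alpha:i\to j$ of $Q$. For an arrow $\alpha: i\to j$ write $t(\alpha)=i$ and $h(\alpha)=j$; paths are composed from left to right, so $\alpha\alpha^*$ is a cycle at $t(\alpha)$. For $i\in Q_0$ the mesh relation at $i$ is $$\rho_i=\sum_{\alpha\in Q_1:\,t(\alpha)=i}\alpha\alpha^*-\sum_{\alpha\in Q_1:\,h(\alpha)=i}\alpha^*\alpha\in\mathbf{k}\overline{Q}.$$ Let $e_i$ be the idempotent at vertex $i$. For $v=(v_i)_{i\in Q_0}\in\mathbf{k}Q_0$ define $${}^{v}\!\Lambda(Q)=\frac{\mathbf{k}[z]\overline{Q}}{(\rho_i-v_ize_i\mid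 i\in Q_0)},$$ where $\mathbf{k}[z]\overline{Q}$ is the path algebra of $\overline{Q}$ over the polynomial ring $\mathbf{k}[z]$. It is graded by $\deg\alpha=\deg\alpha^*=1$ for $\alpha\in Q_1$ and $\deg z=2$. Let $A=\mathbf{k}Q_0=\prod_i\mathbf{k}e_i$. For a finite dimensional $A$-$A$-bimodule $M$, its dimension matrix is $[M]=(\dim_{\mathbf{k}}e_iMe_j)_{i,j}\in M_r(\mathbb{Z})$. The Hilbert series is $h_{{}^{v}\!\Lambda}(t)=\sum_{n\ge0}[{}^{v}\!\Lambda_n]t^n$. The adjacency matrix of $\overline{Q}$ is $C=[\mathbf{k}\overline{Q}_1]=[V]+[V]^{t}$, where $V=\mathbf{k}Q_1$. In the formula $1$ denotes the identity matrix and scalars are multiples of it; the fraction denotes the inverse in $M_r(\mathbb{Z})[[t]]$. *)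

theory Defs
  imports
    "HOL-Analysis.Cartesian_Space"
    "HOL-Algebra.Embedded_Algebras"
    "HOL-Library.Poly_Mapping"
    "HOL-Computational_Algebra.Polynomial"
    "HOL-Computational_Algebra.Formal_Power_Series"
    "Graph_Theory.Graph_Theory"
begin

section \<open>Square matrices as a ring\<close>

text \<open>
  The multiplication that \<^typ>\<open>'a ^ 'n ^ 'n\<close> inherits from its class instance is componentwise.
  The following copy of that type carries the matrix product, so that \<open>('a, 'n) sqmat fps\<close> is the
  ring of formal power series over the matrix ring.
\<close>

typedef ('a, 'n) sqmat = "UNIV :: ('a ^ 'n ^ 'n) set"
  morphisms of_sqmat to_sqmat ..

setup_lifting type_definition_sqmat

instantiation sqmat :: (ring_1, finite) ring_1
begin

lift_definition zero_sqmat :: "('a, 'b) sqmat" is 0 .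
lift_definition one_sqmat :: "('a, 'b) sqmat" is "mat 1" .
lift_definition plus_sqmat :: "('a, 'b) sqmat \<Rightarrow> ('a, 'b) sqmat \<Rightarrow> ('a, 'b) sqmat" is "(+)" .
lift_definition minus_sqmat :: "('a, 'b) sqmat \<Rightarrow> ('a, 'b) sqmat \<Rightarrow> ('a, 'b) sqmat" is "(-)" .
lift_definition uminus_sqmat :: "('a, 'b) sqmat \<Rightarrow> ('a, 'b) sqmat" is uminus .
lift_definition times_sqmat :: "('a, 'b) sqmat \<Rightarrow> ('a, 'b) sqmat \<Rightarrow> ('a, 'b) sqmat" is "(**)" .

instance
proof
  show "(0 :: ('a, 'b) sqmat) \<noteq> 1"
    by transfer (simp add: vec_eq_iff mat_def)
next
  fix A B C :: "('a, 'b) sqmat"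
  show "A * B * C = A * (B * C)"
    by transfer (simp add: matrix_mul_assoc)
  show "1 * A = A" "A * 1 = A"
    by (transfer; simp)+
  show "(A + B) * C = A * C + B * C"
    by transfer (simp add: matrix_matrix_mult_def vec_eq_iff sum.distrib distrib_right)
  show "A * (B + C) = A * B + A * C"
    by transfer (simp add: matrix_add_ldistrib)
qed (transfer; simp)+

end


section \<open>Quivers\<close>

text \<open>
  A quiver is a \<^typ>\<open>('v, 'a) pre_digraph\<close>; multiple arrows are allowed. The arrow \<open>Inl \<alpha>\<close> of the
  double quiver is \<open>\<alpha>\<close> and \<open>Inr \<alpha>\<close> is the opposite arrow \<open>\<alpha>\<^sup>*\<close>.
\<close>

definition acyclic_quiver :: "('v, 'a) pre_digraph \<Rightarrow> bool" where
  "acyclic_quiver Q \<longleftrightarrow> (\<nexists>p. pre_digraph.cycle Q p)"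

definition double_quiver :: "('v, 'a) pre_digraph \<Rightarrow> ('v, 'a + 'a) pre_digraph" where
  "double_quiver Q =
     \<lparr>verts = verts Q, arcs = arcs Q <+> arcs Q,
      tail = case_sum (tail Q) (head Q), head = case_sum (head Q) (tail Q)\<rparr>"

definition adjacency_matrix :: "('v::finite, 'a) pre_digraph \<Rightarrow> (int, 'v) sqmat" where
  "adjacency_matrix G =
     to_sqmat (\<chi> i j. int (card {\<alpha> \<in> arcs G. tail G \<alpha> = i \<and> head G \<alpha> = j}))"

lemma adjacency_matrix_double_quiver:
  assumes "finite (arcs Q)"
  shows "adjacency_matrix (double_quiver Q) =
    adjacency_matrix Q + to_sqmat (transpose (of_sqmat (adjacency_matrix Q)))"
proof -
  have "{\<alpha> \<in> arcs (double_quiver Q). tail (double_quiver Q) \<alpha> = i \<and> head (double_quiver Q) \<alpha> = j}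
      = {\<alpha> \<in> arcs Q. tail Q \<alpha> = i \<and> head Q \<alpha> = j} <+> {\<alpha> \<in> arcs Q. tail Q \<alpha> = j \<and> head Q \<alpha> = i}"
    for i j
    by (auto simp: double_quiver_def)
  then have "card {\<alpha> \<in> arcs (double_quiver Q).
        tail (double_quiver Q) \<alpha> = i \<and> head (double_quiver Q) \<alpha> = j} =
      card {\<alpha> \<in> arcs Q. tail Q \<alpha> = i \<and> head Q \<alpha> = j} +
      card {\<alpha> \<in> arcs Q. tail Q \<alpha> = j \<and> head Q \<alpha> = i}" for i j
    using assms by (simp add: card_Plus)
  then show ?thesis
    unfolding adjacency_matrix_def to_sqmat_inverse[OF UNIV_I] plus_sqmat.abs_eq
    by (intro arg_cong[where f = to_sqmat]) (simp add: vec_eq_iff transpose_def)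
qed

text \<open>
  The underlying graph of \<open>Q\<close> is isomorphic to the simple graph with vertex set \<open>{1..n}\<close> and edge
  set \<open>E\<close>. Injectivity on arrows excludes multiple edges.
\<close>

definition underlying_graph_iso ::
  "('v, 'a) pre_digraph \<Rightarrow> nat \<Rightarrow> nat set set \<Rightarrow> bool" where
  "underlying_graph_iso Q n E \<longleftrightarrow>
     (\<exists>f. bij_betw f (verts Q) {1..n} \<and>
          bij_betw (\<lambda>\<alpha>. {f (tail Q \<alpha>), f (head Q \<alpha>)}) (arcs Q) E)"

definition path_edges :: "nat \<Rightarrow> nat set set" where
  "path_edges n = {{i, i + 1} | i. 1 \<le> i \<and> i < n}"

text \<open>
  \<open>D\<^sub>n\<close> and \<open>E\<^sub>n\<close> are the path \<open>1 - 2 - \<dots> - (n - 1)\<close> with the extra vertex \<open>n\<close> attached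
  to \<open>n - 2\<close> and to \<open>3\<close>, respectively.
\<close>

definition dynkin :: "('v, 'a) pre_digraph \<Rightarrow> bool" where
  "dynkin Q \<longleftrightarrow>
     (\<exists>n\<ge>1. underlying_graph_iso Q n (path_edges n)) \<or>
     (\<exists>n\<ge>4. underlying_graph_iso Q n (insert {n - 2, n} (path_edges (n - 1)))) \<or>
     (\<exists>n\<in>{6, 7, 8}. underlying_graph_iso Q n (insert {3, n} (path_edges (n - 1))))"


section \<open>Path algebras\<close>

text \<open>
  A path is a pair of its starting vertex and its list of arrows, read from left to right; the
  trivial path at \<open>i\<close> is \<open>(i, [])\<close>. Elements of the path algebra are finitely supported functions
  from paths to the coefficient ring. The product of two basis paths is their concatenation if the
  first one ends where the second one starts, and \<open>0\<close> otherwise.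
\<close>

type_synonym ('v, 'a) path = "'v \<times> 'a list"

definition path_end :: "('v, 'a) pre_digraph \<Rightarrow> ('v, 'a) path \<Rightarrow> 'v" where
  "path_end G x = pre_digraph.awlast G (fst x) (snd x)"

definition paths :: "('v, 'a) pre_digraph \<Rightarrow> ('v, 'a) path set" where
  "paths G = {x. pre_digraph.awalk G (fst x) (snd x) (path_end G x)}"

definition path_mult ::
  "('v, 'a) pre_digraph \<Rightarrow> (('v, 'a) path \<Rightarrow>\<^sub>0 'r::comm_ring_1) \<Rightarrow> (('v, 'a) path \<Rightarrow>\<^sub>0 'r)
     \<Rightarrow> (('v, 'a) path \<Rightarrow>\<^sub>0 'r)" where
  "path_mult G f g =
     (\<Sum>x\<in>Poly_Mapping.keys f. \<Sum>y\<in>Poly_Mapping.keys g.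
        if path_end G x = fst y
        then Poly_Mapping.single (fst x, snd x @ snd y)
               (Poly_Mapping.lookup f x * Poly_Mapping.lookup g y)
        else 0)"

definition scalar :: "('v, 'a) pre_digraph \<Rightarrow> 'r::comm_ring_1 \<Rightarrow> ('v, 'a) path \<Rightarrow>\<^sub>0 'r" where
  "scalar G c = (\<Sum>i\<in>verts G. Poly_Mapping.single (i, []) c)"

definition path_algebra ::
  "('v, 'a) pre_digraph \<Rightarrow> (('v, 'a) path \<Rightarrow>\<^sub>0 'r::comm_ring_1) ring" where
  "path_algebra G =
     \<lparr>carrier = {f. Poly_Mapping.keys f \<subseteq> paths G}, monoid.mult = path_mult G,
      one = scalar G 1, zero = 0, add = (+)\<rparr>"


subsection \<open>The path algebra is a ring\<close>

lemma path_end_Nil [simp]: "path_end G (i, []) = i"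
  by (simp add: path_end_def pre_digraph.awalk_verts.simps)

lemma path_end_append: "path_end G (u, p @ q) = path_end G (path_end G (u, p), q)"
proof (induction p arbitrary: u)
  case (Cons a p)
  have ne: "pre_digraph.awalk_verts G w r \<noteq> []" for w r
    by (cases r) (simp_all add: pre_digraph.awalk_verts.simps)
  have "path_end G (u, a # r) = path_end G (head G a, r)" for r
    by (simp add: path_end_def pre_digraph.awalk_verts.simps ne)
  then show ?case using Cons by simp
qed simp

lemma paths_append:
  assumes "(u, p) \<in> paths G" "(path_end G (u, p), q) \<in> paths G"
  shows "(u, p @ q) \<in> paths G"
proof -
  have "pre_digraph.cas G u (p @ q) w"
    if "pre_digraph.cas G u p v" "pre_digraph.cas G v q w" for v w
    using that by (induction p arbitrary: u) (auto simp: pre_digraph.cas.simps)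
  then show ?thesis
    using assms by (auto simp: paths_def pre_digraph.awalk_def path_end_append)
qed

lemma trivial_path_in_paths: "i \<in> verts G \<Longrightarrow> (i, []) \<in> paths G"
  by (simp add: paths_def pre_digraph.awalk_def pre_digraph.cas.simps)

lemma path_mult_superset:
  assumes "finite A" "finite B" "Poly_Mapping.keys f \<subseteq> A" "Poly_Mapping.keys g \<subseteq> B"
  shows "path_mult G f g =
     (\<Sum>x\<in>A. \<Sum>y\<in>B. if path_end G x = fst y
        then Poly_Mapping.single (fst x, snd x @ snd y)
               (Poly_Mapping.lookup f x * Poly_Mapping.lookup g y)
        else 0)"
  unfolding path_mult_def using assms
  by (intro sum.mono_neutral_cong_left)
     (auto simp: in_keys_iff intro!: sum.mono_neutral_cong_left sum.neutral)

lemma path_mult_0 [simp]: "path_mult G 0 g = 0" "path_mult G f 0 = 0"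
  by (simp_all add: path_mult_def)

lemma path_mult_add_left: "path_mult G (f + f') g = path_mult G f g + path_mult G f' g"
proof -
  let ?A = "Poly_Mapping.keys f \<union> Poly_Mapping.keys f'"
  have "Poly_Mapping.keys (f + f') \<subseteq> ?A" by (rule Poly_Mapping.keys_add)
  then show ?thesis
    by (subst (1 2 3) path_mult_superset[where A = ?A and B = "Poly_Mapping.keys g"])
       (auto simp: lookup_add distrib_right single_add simp flip: sum.distrib intro!: sum.cong)
qed

lemma path_mult_add_right: "path_mult G g (f + f') = path_mult G g f + path_mult G g f'"
proof -
  let ?A = "Poly_Mapping.keys f \<union> Poly_Mapping.keys f'"
  have "Poly_Mapping.keys (f + f') \<subseteq> ?A" by (rule Poly_Mapping.keys_add)
  then show ?thesis
    by (subst (1 2 3) path_mult_superset[where B = ?A and A = "Poly_Mapping.keys g"])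
       (auto simp: lookup_add distrib_left single_add simp flip: sum.distrib intro!: sum.cong)
qed

lemma path_mult_single:
  "path_mult G (Poly_Mapping.single x a) (Poly_Mapping.single y b) =
     (if path_end G x = fst y then Poly_Mapping.single (fst x, snd x @ snd y) (a * b) else 0)"
  by (subst path_mult_superset[where A = "{x}" and B = "{y}"]) auto

lemma poly_mapping_single_induct:
  fixes f :: "'x \<Rightarrow>\<^sub>0 'r::comm_ring_1"
  assumes "P 0" "\<And>x c. P (Poly_Mapping.single x c)" "\<And>f g. P f \<Longrightarrow> P g \<Longrightarrow> P (f + g)"
  shows "P f"
proof -
  have "P (\<Sum>x\<in>A. Poly_Mapping.single x (Poly_Mapping.lookup f x))" if "finite A" for A
    using that by induction (auto intro: assms)
  moreover have "(\<Sum>x\<in>Poly_Mapping.keys f. Poly_Mapping.single x (Poly_Mapping.lookup f x)) = f"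
    by (rule poly_mapping_eqI)
       (auto simp: lookup_sum lookup_single when_def in_keys_iff if_distrib sum.delta' cong: if_cong)
  ultimately show ?thesis by (metis finite_keys)
qed

lemma path_mult_assoc: "path_mult G (path_mult G f g) h = path_mult G f (path_mult G g h)"
proof (induction f rule: poly_mapping_single_induct)
  case (2 x a)
  show ?case
  proof (induction g rule: poly_mapping_single_induct)
    case (2 y b)
    show ?case
      by (induction h rule: poly_mapping_single_induct)
         (cases x; cases y;
          auto simp: path_mult_single path_mult_add_right path_end_append mult.assoc)+
  qed (auto simp: path_mult_add_left path_mult_add_right)
qed (auto simp: path_mult_add_left)

lemma path_mult_sum_left: "path_mult G (\<Sum>i\<in>A. f i) g = (\<Sum>i\<in>A. path_mult G (f i) g)"
  by (induction A rule: infinite_finite_induct) (auto simp: path_mult_add_left)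

lemma path_mult_sum_right: "path_mult G g (\<Sum>i\<in>A. f i) = (\<Sum>i\<in>A. path_mult G g (f i))"
  by (induction A rule: infinite_finite_induct) (auto simp: path_mult_add_right)

lemma keys_path_mult:
  assumes "Poly_Mapping.keys f \<subseteq> paths G" "Poly_Mapping.keys g \<subseteq> paths G"
  shows "Poly_Mapping.keys (path_mult G f g) \<subseteq> paths G"
proof -
  have "Poly_Mapping.keys (if path_end G x = fst y
        then Poly_Mapping.single (fst x, snd x @ snd y)
               (Poly_Mapping.lookup f x * Poly_Mapping.lookup g y)
        else 0) \<subseteq> paths G"
    if "x \<in> Poly_Mapping.keys f" "y \<in> Poly_Mapping.keys g" for x y
  proof (cases "path_end G x = fst y")
    case True
    have "(fst x, snd x) \<in> paths G" "(path_end G (fst x, snd x), snd y) \<in> paths G"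
      using that assms True by auto
    from paths_append[OF this] show ?thesis using True by auto
  qed simp
  then show ?thesis
    unfolding path_mult_def
    by (intro order_trans[OF keys_sum] UN_least)
qed

lemma (in fin_digraph) scalar_one_mult:
  assumes "Poly_Mapping.keys f \<subseteq> paths G"
  shows "path_mult G (scalar G 1) f = f" "path_mult G f (scalar G 1) = f"
proof -
  let ?s = "\<lambda>f. \<Sum>x\<in>Poly_Mapping.keys f. Poly_Mapping.single x (Poly_Mapping.lookup f x)"
  have f: "f = ?s f"
    by (rule poly_mapping_eqI)
       (auto simp: lookup_sum lookup_single when_def in_keys_iff if_distrib sum.delta' cong: if_cong)
  have v: "fst x \<in> verts G" "path_end G x \<in> verts G" if "x \<in> Poly_Mapping.keys f" for x
    using that assms awalk_last_in_verts[of "fst x" "snd x" "path_end G x"]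
    by (auto simp: paths_def awalk_def)
  have "path_mult G (scalar G 1) (Poly_Mapping.single x c) = Poly_Mapping.single x c"
    "path_mult G (Poly_Mapping.single x c) (scalar G 1) = Poly_Mapping.single x c"
    if "x \<in> Poly_Mapping.keys f" for x c
    using v[OF that]
    by (simp_all add: scalar_def path_mult_sum_left path_mult_sum_right path_mult_single
        sum.delta sum.delta')
  then have "path_mult G (scalar G 1) (?s f) = ?s f" "path_mult G (?s f) (scalar G 1) = ?s f"
    unfolding path_mult_sum_left path_mult_sum_right by (auto intro!: sum.cong)
  then show "path_mult G (scalar G 1) f = f" "path_mult G f (scalar G 1) = f"
    unfolding f[symmetric] .
qed

theorem (in fin_digraph) ring_path_algebra:
  "ring (path_algebra G :: (('a, 'b) path \<Rightarrow>\<^sub>0 'r::comm_ring_1) ring)"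
proof (rule ringI)
  let ?R = "path_algebra G :: (('a, 'b) path \<Rightarrow>\<^sub>0 'r) ring"
  show "abelian_group ?R"
  proof (rule abelian_groupI)
    fix f assume "f \<in> carrier ?R"
    then show "\<exists>g\<in>carrier ?R. g \<oplus>\<^bsub>?R\<^esub> f = \<zero>\<^bsub>?R\<^esub>"
      by (intro bexI[of _ "- f"]) (auto simp: path_algebra_def)
  qed (use Poly_Mapping.keys_add in \<open>fastforce simp: path_algebra_def add_ac\<close>)+
  show "monoid ?R"
  proof (rule monoidI)
    have "Poly_Mapping.keys (scalar G 1 :: ('a, 'b) path \<Rightarrow>\<^sub>0 'r) \<subseteq> paths G"
      unfolding scalar_def
      by (intro order_trans[OF keys_sum] UN_least) (auto simp: trivial_path_in_paths)
    then show "\<one>\<^bsub>?R\<^esub> \<in> carrier ?R"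
      by (simp add: path_algebra_def)
  next
    fix f g assume "f \<in> carrier ?R" "g \<in> carrier ?R"
    then show "f \<otimes>\<^bsub>?R\<^esub> g \<in> carrier ?R"
      using keys_path_mult[of f G g] by (simp add: path_algebra_def)
  qed (simp_all add: path_algebra_def path_mult_assoc scalar_one_mult)
qed (simp_all add: path_algebra_def path_mult_add_left path_mult_add_right)


section \<open>The central extension of the preprojective algebra\<close>

text \<open>The coefficient ring \<open>k[z]\<close> is \<^typ>\<open>'k poly\<close>, with \<open>z = [:0, 1:]\<close>.\<close>

definition mesh_relation ::
  "('v, 'a) pre_digraph \<Rightarrow> 'v \<Rightarrow> ('v, 'a + 'a) path \<Rightarrow>\<^sub>0 'r::comm_ring_1" where
  "mesh_relation Q i =
     (\<Sum>\<alpha> | \<alpha> \<in> arcs Q \<and> tail Q \<alpha> = i. Poly_Mapping.single (i, [Inl \<alpha>, Inr \<alpha>]) 1) -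
     (\<Sum>\<alpha> | \<alpha> \<in> arcs Q \<and> head Q \<alpha> = i. Poly_Mapping.single (i, [Inr \<alpha>, Inl \<alpha>]) 1)"

definition central_relations ::
  "('v, 'a) pre_digraph \<Rightarrow> ('v \<Rightarrow> 'k::field) \<Rightarrow> (('v, 'a + 'a) path \<Rightarrow>\<^sub>0 'k poly) set" where
  "central_relations Q v =
     {mesh_relation Q i - Poly_Mapping.single (i, []) (smult (v i) [:0, 1:]) | i. i \<in> verts Q}"

definition central_ideal ::
  "('v, 'a) pre_digraph \<Rightarrow> ('v \<Rightarrow> 'k::field) \<Rightarrow> (('v, 'a + 'a) path \<Rightarrow>\<^sub>0 'k poly) set" where
  "central_ideal Q v = Idl\<^bsub>path_algebra (double_quiver Q)\<^esub> (central_relations Q v)"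

definition central_extension ::
  "('v, 'a) pre_digraph \<Rightarrow> ('v \<Rightarrow> 'k::field) \<Rightarrow> (('v, 'a + 'a) path \<Rightarrow>\<^sub>0 'k poly) set ring" where
  "central_extension Q v = path_algebra (double_quiver Q) Quot central_ideal Q v"

lemma fin_digraph_double_quiver:
  assumes "fin_digraph Q"
  shows "fin_digraph (double_quiver Q)"
proof -
  interpret fin_digraph Q by fact
  show ?thesis by unfold_locales (auto simp: double_quiver_def)
qed

lemma central_relations_carrier:
  fixes Q :: "('v, 'a) pre_digraph"
  assumes "fin_digraph Q"
  shows "central_relations Q (v :: 'v \<Rightarrow> 'c::field) \<subseteq> carrier (path_algebra (double_quiver Q))"
proof -
  interpret fin_digraph Q by fact
  let ?P = "paths (double_quiver Q)"
  have diff: "Poly_Mapping.keys (f - g) \<subseteq> ?P"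
    if "Poly_Mapping.keys f \<subseteq> ?P" "Poly_Mapping.keys g \<subseteq> ?P"
    for f g :: "_ \<Rightarrow>\<^sub>0 'c poly"
    using that Poly_Mapping.keys_diff[of f g] by blast
  have "(i, []) \<in> ?P" if "i \<in> verts Q" for i
    using that by (auto simp: double_quiver_def intro: trivial_path_in_paths)
  moreover have "(tail Q \<alpha>, [Inl \<alpha>, Inr \<alpha>]) \<in> ?P" "(head Q \<alpha>, [Inr \<alpha>, Inl \<alpha>]) \<in> ?P"
    if "\<alpha> \<in> arcs Q" for \<alpha>
    using that
    by (auto simp: paths_def path_end_def double_quiver_def pre_digraph.awalk_def
        pre_digraph.awalk_verts.simps pre_digraph.cas.simps)
  ultimately have "Poly_Mapping.keys (mesh_relation Q i - Poly_Mapping.single (i, []) c) \<subseteq> ?P"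
    if "i \<in> verts Q" for i and c :: "'c poly"
    using that unfolding mesh_relation_def
    by (intro diff order_trans[OF keys_sum] UN_least) auto
  then show ?thesis
    unfolding central_relations_def path_algebra_def by fastforce
qed

lemma ideal_central_ideal:
  assumes "fin_digraph Q"
  shows "ideal (central_ideal Q v) (path_algebra (double_quiver Q))"
  unfolding central_ideal_def
  using fin_digraph.ring_path_algebra[OF fin_digraph_double_quiver[OF assms]]
    central_relations_carrier[OF assms]
  by (rule ring.genideal_ideal)

lemma ring_central_extension:
  assumes "fin_digraph Q"
  shows "ring (central_extension Q v)"
  unfolding central_extension_def
  using ideal_central_ideal[OF assms] by (rule ideal.quotient_is_ring)

abbreviation residue_class ::
  "('v, 'a) pre_digraph \<Rightarrow> ('v \<Rightarrow> 'k::field) \<Rightarrow> (('v, 'a + 'a) path \<Rightarrow>\<^sub>0 'k poly)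
     \<Rightarrow> (('v, 'a + 'a) path \<Rightarrow>\<^sub>0 'k poly) set" where
  "residue_class Q v f \<equiv> central_ideal Q v +>\<^bsub>path_algebra (double_quiver Q)\<^esub> f"

text \<open>The grading: the path \<open>p\<close> times \<open>z\<^sup>m\<close> has degree \<open>length p + 2 m\<close>.\<close>

definition homogeneous :: "nat \<Rightarrow> (('v, 'a) path \<Rightarrow>\<^sub>0 'k::field poly) \<Rightarrow> bool" where
  "homogeneous n f \<longleftrightarrow>
     (\<forall>x m. poly.coeff (Poly_Mapping.lookup f x) m \<noteq> 0 \<longrightarrow> length (snd x) + 2 * m = n)"

definition graded_piece ::
  "('v, 'a) pre_digraph \<Rightarrow> ('v \<Rightarrow> 'k::field) \<Rightarrow> nat \<Rightarrow> (('v, 'a + 'a) path \<Rightarrow>\<^sub>0 'k poly) set set" where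
  "graded_piece Q v n =
     residue_class Q v ` {f \<in> carrier (path_algebra (double_quiver Q)). homogeneous n f}"

text \<open>
  The base field acts on the quotient through the residue classes of the constant scalars, which
  form the subfield used in \<^const>\<open>ring.dimension\<close>.
\<close>

definition base_field ::
  "('v, 'a) pre_digraph \<Rightarrow> ('v \<Rightarrow> 'k::field) \<Rightarrow> (('v, 'a + 'a) path \<Rightarrow>\<^sub>0 'k poly) set set" where
  "base_field Q v = range (\<lambda>c. residue_class Q v (scalar (double_quiver Q) [:c:]))"

definition peirce_piece ::
  "('v, 'a) pre_digraph \<Rightarrow> ('v \<Rightarrow> 'k::field) \<Rightarrow> (('v, 'a + 'a) path \<Rightarrow>\<^sub>0 'k poly) set set
     \<Rightarrow> 'v \<Rightarrow> 'v \<Rightarrow> (('v, 'a + 'a) path \<Rightarrow>\<^sub>0 'k poly) set set" where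
  "peirce_piece Q v M i j =
     (\<lambda>x. residue_class Q v (Poly_Mapping.single (i, []) 1) \<otimes>\<^bsub>central_extension Q v\<^esub> x
            \<otimes>\<^bsub>central_extension Q v\<^esub> residue_class Q v (Poly_Mapping.single (j, []) 1)) ` M"

definition dimension_matrix ::
  "('v::finite, 'a) pre_digraph \<Rightarrow> ('v \<Rightarrow> 'k::field) \<Rightarrow> (('v, 'a + 'a) path \<Rightarrow>\<^sub>0 'k poly) set set
     \<Rightarrow> (int, 'v) sqmat" where
  "dimension_matrix Q v M =
     to_sqmat (\<chi> i j. int (THE d.
       ring.dimension (central_extension Q v) d (base_field Q v) (peirce_piece Q v M i j)))"

definition hilbert_series ::
  "('v::finite, 'a) pre_digraph \<Rightarrow> ('v \<Rightarrow> 'k::field) \<Rightarrow> (int, 'v) sqmat fps" where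
  "hilbert_series Q v = Abs_fps (\<lambda>n. dimension_matrix Q v (graded_piece Q v n))"

end

theory Submission
  imports Defs "HOL-Library.Function_Algebras"
begin

text \<open>
  Dropping \<open>z\<close> from the notation, the homogeneous elements of degree \<open>n\<close> in \<open>e\<^sub>j k[z]Q e\<^sub>i\<close> (\<open>Q\<close> doubled)
  are the functions on walks from \<open>j\<close> to \<open>i\<close> of length at most \<open>n\<close> and of the same parity as \<open>n\<close>.

  A quiver that is not Dynkin carries positive vertex weights \<open>d\<close> with \<open>2 d \<le> C d\<close>: the null root of
  an extended Dynkin subgraph, spread along the connected quiver.

  For the preprojective algebra, right multiplication by the arrows leaving \<open>i\<close>, followed by the mesh
  relation, is a complex whose exactness is the recursion \<open>h\<^sub>n\<^sub>+\<^sub>2 = h\<^sub>n\<^sub>+\<^sub>1 C - h\<^sub>n\<close>; only the injectivity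
  of the first map, that is the absence of a right socle, has to be shown. A socle element \<open>x\<close> in the
  lowest possible degree \<open>n\<close> of \<open>e\<^sub>j \<Lambda>\<close> gives a rank one endomorphism of the pair of components of
  degrees \<open>n\<close> and \<open>n + 1\<close>. By exactness in lower degrees such an endomorphism descends to degree \<open>0\<close>,
  so it is a scalar, hence the component of degree \<open>n + 1\<close> vanishes. But the recursion makes the
  weighted dimensions convex and increasing in the degree, a contradiction.

  Finally \<open>z\<close> is a nonzero divisor on the central extension, again because the preprojective algebra
  has no right socle, so the central extension has the Hilbert series of \<open>\<Lambda>[z]\<close>.
\<close>

section \<open>Linear algebra\<close>

text \<open>Exactness makes degree \<open>n\<close> of e_j Lambda, through the products f e with
  arrows e, the kernel of a map from arrow-indexed copies of degree \<open>n + 1\<close> to degree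
  \<open>n + 2\<close>. So a pair of maps on degrees \<open>n + 1\<close> and \<open>n + 2\<close>
  that commutes with the arrows restricts to degree \<open>n\<close>. In degree 0 only multiples of
  the trivial path at \<open>j\<close> are left, which is where the scalar comes from. For f mapped
  to phi(f) x with phi(x) = 1, paired with zero in degree \<open>n + 1\<close>, the scalar must be
  1; then the identity of degree \<open>n\<close> is compatible with zero, so every product with an
  arrow vanishes. The obstacle is circularity: the descent and the dimension recursion both use the
  exactness that is being proved. Hence the strong induction on the degree, in which every step
  relies on lower degrees alone. For z the point is this: if z f is a combination of relations,
  reduction modulo z puts the leading part of its coefficients into the preprojective ideal, so that
  part can be lifted to the ideal and removed, and the rest divided by z.\<close>

locale scalar_space = vector_space scale
  for scale :: "'a::field \<Rightarrow> 'b::ab_group_add \<Rightarrow> 'b"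
begin

text \<open>The function spaces used below are infinite dimensional, and there \<open>dim\<close>
  says nothing about size: an infinite basis has cardinality 0. Finiteness is therefore carried
  along for single subspaces.\<close>

definition fin_dim :: "'b set \<Rightarrow> bool" where
  "fin_dim S \<longleftrightarrow> (\<exists>B. finite B \<and> S \<subseteq> span B)"

lemma fin_dim_subset: "fin_dim T \<Longrightarrow> S \<subseteq> T \<Longrightarrow> fin_dim S"
  unfolding fin_dim_def by blast

lemma fin_dim_basis:
  assumes "fin_dim S" "subspace S"
  obtains B where "finite B" "independent B" "span B = S" "card B = dim S"
proof -
  obtain B where B: "B \<subseteq> S" "independent B" "S \<subseteq> span B" "card B = dim S"
    using basis_exists[of S] by blast
  obtain C where C: "finite C" "S \<subseteq> span C"
    using assms(1) fin_dim_def by blast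
  have "finite B" using independent_span_bound[OF C(1) B(2)] B(1) C(2) by blast
  moreover have "span B = S" using B assms(2) by (simp add: span_minimal subset_antisym)
  ultimately show ?thesis using that B by blast
qed

lemma dim_span_insert:
  assumes "fin_dim U" "subspace U" "x \<notin> U"
  shows "dim (span (insert x U)) = Suc (dim U)"
proof -
  obtain B where B: "finite B" "independent B" "span B = U" "card B = dim U"
    using fin_dim_basis assms by blast
  have "independent (insert x B)" using B assms(3) by (simp add: independent_insertI)
  moreover have "span (insert x B) = span (insert x U)"
    using B(3) by (auto simp: span_insert span_span)
  moreover have "x \<notin> B" using B(3) assms(3) span_base by blast
  ultimately show ?thesis
    using B dim_span_eq_card_independent by fastforce
qed

lemma fin_dim_span_insert:
  assumes "fin_dim U" shows "fin_dim (span (insert x U))"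
proof -
  obtain B where B: "finite B" "U \<subseteq> span B" using assms fin_dim_def by blast
  have "insert x U \<subseteq> span (insert x B)" using B span_mono[of B "insert x B"] span_base by blast
  then have "span (insert x U) \<subseteq> span (insert x B)"
    using span_minimal subspace_span by blast
  then show ?thesis unfolding fin_dim_def using B(1) by blast
qed

lemma dim_mono_finite:
  assumes "fin_dim T" "S \<subseteq> T" "subspace S" "subspace T"
  shows "dim S \<le> dim T"
proof -
  obtain B where "finite B" "independent B" "span B = S" "card B = dim S"
    using fin_dim_basis fin_dim_subset assms by metis
  moreover obtain C where "finite C" "independent C" "span C = T" "card C = dim T"
    using fin_dim_basis assms by metis
  ultimately show ?thesis
    by (metis assms(2) independent_span_bound span_superset subset_trans)
qed

lemma subspace_eq_if_dim_le:
  assumes "fin_dim T" "S \<subseteq> T" "subspace S" "subspace T" "dim T \<le> dim S"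
  shows "S = T"
proof (rule ccontr)
  assume "S \<noteq> T"
  then obtain x where x: "x \<in> T" "x \<notin> S" using assms(2) by blast
  have "dim (span (insert x S)) \<le> dim T"
    using assms x(1) by (intro dim_mono_finite span_minimal) auto
  then show False
    using dim_span_insert[OF fin_dim_subset[OF assms(1,2)] assms(3) x(2)] assms(5) by simp
qed

lemma subspace_sum_image:
  assumes "Vector_Spaces.linear scale scale T" "subspace A" "subspace P"
  shows "subspace {a + T y |a y. a \<in> A \<and> y \<in> P}"
proof -
  interpret T: Vector_Spaces.linear scale scale T by fact
  show ?thesis
    using subspace_sums[OF assms(2) T.subspace_image[OF assms(3)]]
    by (rule back_subst[of subspace]) auto
qed

text \<open>Rank-nullity for the map that \<open>T\<close> induces from \<open>P\<close> to the
  quotient by \<open>A\<close>, stated without a quotient space. It is used with \<open>T\<close>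
  the mesh map, with \<open>T\<close> multiplication by an arrow, and with the identity.\<close>

lemma dim_sum_image:
  assumes T: "Vector_Spaces.linear scale scale T"
    and A: "subspace A" "fin_dim A" and P: "subspace P" "fin_dim P"
  shows "dim {a + T y |a y. a \<in> A \<and> y \<in> P} + dim {y \<in> P. T y \<in> A} = dim A + dim P"
proof -
  interpret T: Vector_Spaces.linear scale scale T by fact
  define S where "S U = {a + T y |a y. a \<in> A \<and> y \<in> U}" for U
  define K where "K = {y \<in> P. T y \<in> A}"
  have S_I: "a + T y \<in> S U" if "a \<in> A" "y \<in> U" for a y U
    using that unfolding S_def by blast
  have S_E: "\<exists>a\<in>A. \<exists>y\<in>U. x = a + T y" if "x \<in> S U" for x U
    using that unfolding S_def by blast
  have K: "subspace K"
    using A(1) P(1) by (auto simp: K_def subspace_def T.add T.scale T.zero)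
  obtain B where B: "finite B" "span B = P" using fin_dim_basis P by metis
  \<comment> \<open>Start from the kernel \<open>K\<close> and adjoin generators of \<open>P\<close>
    one at a time. A vector outside \<open>U\<close> raises both sides by one: if its image were
    already in \<open>S U\<close>, a difference with an element of \<open>U\<close> would lie in
    \<open>K\<close>, hence in \<open>U\<close>.\<close>
  have main: "\<exists>U. subspace U \<and> C \<subseteq> U \<and> K \<subseteq> U \<and> U \<subseteq> P \<and> fin_dim (S U)
      \<and> dim (S U) + dim K = dim A + dim U" if "finite C" "C \<subseteq> P" for C
    using that
  proof (induction C)
    case empty
    have "S K = A"
    proof
      show "S K \<subseteq> A"
        using subspace_add[OF A(1)] unfolding S_def K_def by blast
      show "A \<subseteq> S K"
        using S_I[of _ 0 K] subspace_0[OF K] by (auto simp: T.zero)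
    qed
    then have "fin_dim (S K)" "dim (S K) + dim K = dim A + dim K"
      using A(2) by simp_all
    moreover have "K \<subseteq> P" unfolding K_def by blast
    ultimately show ?case using K by blast
  next
    case (insert c C)
    then obtain U where U: "subspace U" "C \<subseteq> U" "K \<subseteq> U" "U \<subseteq> P" "fin_dim (S U)"
      "dim (S U) + dim K = dim A + dim U" by blast
    show ?case
    proof (cases "c \<in> U")
      case True
      then show ?thesis using U by blast
    next
      case False
      let ?V = "span (insert c U)"
      have SU: "subspace (S V)" if "subspace V" for V
        unfolding S_def using subspace_sum_image T A(1) that by blast
      have Tc: "T c \<notin> S U"
      proof
        assume "T c \<in> S U"
        then obtain a y where ay: "a \<in> A" "y \<in> U" "T c = a + T y" using S_E by blast
        then have "T (c - y) \<in> A" by (simp add: T.diff)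
        moreover have "c - y \<in> P" using insert.prems ay U P(1) subspace_diff by blast
        ultimately have "c - y \<in> U" using U(3) unfolding K_def by blast
        then have "c - y + y \<in> U" using subspace_add U(1) ay(2) by blast
        then show False using False by simp
      qed
      have eq: "S ?V = span (insert (T c) (S U))"
      proof
        show "S ?V \<subseteq> span (insert (T c) (S U))"
        proof
          fix x assume "x \<in> S ?V"
          then obtain a y where ay: "a \<in> A" "y \<in> ?V" "x = a + T y" using S_E by blast
          then obtain k where "y - scale k c \<in> span U" by (metis span_breakdown_eq)
          then have k: "y - scale k c \<in> U" using U(1) span_eq_iff by blast
          have "x - scale k (T c) = a + T (y - scale k c)"
            by (simp add: T.diff T.scale ay(3))
          then have "x - scale k (T c) \<in> span (S U)" using S_I[OF ay(1) k] span_base by simp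
          then show "x \<in> span (insert (T c) (S U))"
            unfolding span_breakdown_eq by blast
        qed
        have "T c \<in> S ?V"
          using S_I[OF subspace_0[OF A(1)], of c ?V] by (simp add: span_base)
        moreover have "S U \<subseteq> S ?V"
          unfolding S_def using span_superset[of "insert c U"] by blast
        ultimately show "span (insert (T c) (S U)) \<subseteq> S ?V"
          using SU[OF subspace_span] by (intro span_minimal) simp_all
      qed
      have fU: "fin_dim U" using fin_dim_subset P(2) U(4) by blast
      have "?V \<subseteq> P" using U(4) insert.prems P(1) by (intro span_minimal) simp_all
      moreover have "fin_dim (S ?V)" unfolding eq using fin_dim_span_insert U(5) by blast
      moreover have "dim (S ?V) + dim K = dim A + dim ?V"
        unfolding eq dim_span_insert[OF U(5) SU[OF U(1)] Tc] dim_span_insert[OF fU U(1) False]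
        using U(6) by simp
      moreover have "insert c C \<subseteq> ?V" "K \<subseteq> ?V"
        using U(2,3) span_superset[of "insert c U"] by blast+
      ultimately show ?thesis using subspace_span by blast
    qed
  qed
  have "B \<subseteq> P" using B(2) span_superset by blast
  from main[OF B(1) this] obtain U where U: "subspace U" "B \<subseteq> U" "U \<subseteq> P"
    "dim (S U) + dim K = dim A + dim U" by blast
  have "P \<subseteq> U" using B(2) U(1,2) span_minimal by blast
  then have "U = P" using U(3) by blast
  then show ?thesis using U(4) unfolding S_def K_def by simp
qed

text \<open>Provides the functional that separates a socle element from the ideal. A basis of
  \<open>A\<close> stays independent when \<open>x\<close> is added, so values may be prescribed on
  it.\<close>

lemma exists_functional:
  assumes "subspace A" "x \<notin> A"
  shows "\<exists>g. Vector_Spaces.linear scale (*) g \<and> g x = 1 \<and> (\<forall>y\<in>A. g y = 0)"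
proof -
  have vp: "vector_space_pair scale ((*) :: 'a \<Rightarrow> 'a \<Rightarrow> 'a)"
    by (rule vector_space_pair.intro[OF vector_space_axioms
          vector_space_over_itself.vector_space_axioms])
  obtain B where B: "B \<subseteq> A" "\<not> dependent B" "A \<subseteq> span B" "card B = dim A"
    by (rule basis_exists)
  have sp: "span B = A"
    using span_minimal[OF B(1) assms(1)] B(3) by (rule subset_antisym)
  then have ind: "\<not> dependent (insert x B)"
    using B(2) assms(2) by (intro independent_insertI) simp_all
  obtain g where g: "Vector_Spaces.linear scale (*) g"
    "\<forall>y\<in>insert x B. g y = (if y = x then 1 else 0)"
    using vector_space_pair.linear_independent_extend[OF vp ind,
        of "\<lambda>y. if y = x then 1 else 0"] by (elim exE conjE)
  have hom: "module_hom scale (*) g"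
    using g(1) by (simp add: Vector_Spaces.linear_def)
  have "x \<notin> B" using B(1) assms(2) by blast
  have "g y = 0" if "y \<in> A" for y
  proof -
    have "y \<in> span B" using sp that by simp
    then show "g y = 0"
    proof (induction rule: span_induct_alt)
      case base then show ?case by (rule module_hom.zero[OF hom])
    next
      case (step c b z)
      then have "g b = 0" using g(2) \<open>x \<notin> B\<close> by auto
      then show ?case using step by (simp add: module_hom.add[OF hom] module_hom.scale[OF hom])
    qed
  qed
  then show ?thesis using g by (intro exI[of _ g]) simp
qed

end

section \<open>Weights on quivers that are not Dynkin\<close>

definition opposite_arrow :: "'a + 'a \<Rightarrow> 'a + 'a" where
  "opposite_arrow = case_sum Inr Inl"

text \<open>
  Adjacency lists and positive weights of a graph with \<open>2 w \<le> C w\<close>. A map into the quiver that is only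
  injective on the neighbours of each vertex transports the weights, see \<open>good_template\<close>.
\<close>

definition template :: "nat list list \<Rightarrow> nat list \<Rightarrow> bool" where
  "template Ns ws \<longleftrightarrow> ws \<noteq> [] \<and> (\<forall>w\<in>set ws. w > 0) \<and>
     (\<forall>k\<in>set [0..<length ws]. distinct (Ns ! k) \<and>
       (\<forall>l\<in>set (Ns ! k). l < length ws \<and> k \<in> set (Ns ! l)) \<and>
       2 * ws ! k \<le> (\<Sum>l\<leftarrow>Ns ! k. ws ! l))"

text \<open>Abstracts the double quiver. Loops are allowed; by \<open>opp_neq\<close> a loop comes
  with a second, parallel loop.\<close>

locale symmetric_quiver =
  fixes E :: "'e set" and src tgt :: "'e \<Rightarrow> 'v::finite" and opp :: "'e \<Rightarrow> 'e"
  assumes finite_E: "finite E"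
    and opp_in [simp]: "a \<in> E \<Longrightarrow> opp a \<in> E"
    and opp_opp [simp]: "opp (opp a) = a"
    and opp_neq: "opp a \<noteq> a"
    and src_opp [simp]: "src (opp a) = tgt a"
    and tgt_opp [simp]: "tgt (opp a) = src a"
begin

definition adj :: "'v \<Rightarrow> 'v \<Rightarrow> bool" where
  "adj x y \<longleftrightarrow> (\<exists>e\<in>E. src e = x \<and> tgt e = y)"

text \<open>The entry at \<open>x\<close> of the vector C d.\<close>

definition nsum :: "('v \<Rightarrow> real) \<Rightarrow> 'v \<Rightarrow> real" where
  "nsum d x = (\<Sum>e | e \<in> E \<and> src e = x. d (tgt e))"

text \<open>Nonnegative instead of positive, so that the null root of a subgraph can be extended by
  zero; \<open>good_imp_positive\<close> restores positivity.\<close>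

definition good :: "('v \<Rightarrow> real) \<Rightarrow> bool" where
  "good d \<longleftrightarrow> (\<forall>x. d x \<ge> 0) \<and> (\<exists>x. d x > 0) \<and> (\<forall>x. 2 * d x \<le> nsum d x)"

definition gpath :: "'v list \<Rightarrow> bool" where
  "gpath xs \<longleftrightarrow> xs \<noteq> [] \<and> distinct xs \<and> (\<forall>i. Suc i < length xs \<longrightarrow> adj (xs ! i) (xs ! Suc i))"

lemma adj_sym: "adj x y \<Longrightarrow> adj y x"
  unfolding adj_def by (metis opp_in src_opp tgt_opp)

lemma finite_out: "finite {e. e \<in> E \<and> src e = x}"
  using finite_E by simp

lemma nsum_ge:
  assumes "\<And>x. d x \<ge> 0" "\<And>y. y \<in> A \<Longrightarrow> adj x y"
  shows "sum d A \<le> nsum d x"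
proof -
  let ?N = "{e. e \<in> E \<and> src e = x}"
  have "A \<subseteq> tgt ` ?N" using assms(2) by (force simp: adj_def)
  then have "sum d A \<le> sum d (tgt ` ?N)"
    using assms(1) finite_out by (intro sum_mono2) auto
  also have "\<dots> \<le> sum (d \<circ> tgt) ?N"
    using assms(1) finite_out by (intro sum_image_le) auto
  finally show ?thesis by (simp add: nsum_def)
qed

lemma nsum_mono: "(\<And>x. d x \<le> d' x) \<Longrightarrow> nsum d x \<le> nsum d' x"
  unfolding nsum_def by (intro sum_mono) simp

text \<open>Choose \<open>d\<close> with the largest support. At a zero of \<open>d\<close> next to
  the support, half of the neighbour sum is a positive value that satisfies the inequality there,
  and all other neighbour sums can only grow. So the support is closed under adjacency.\<close>

lemma good_imp_positive:
  assumes conn: "\<And>S. S \<noteq> {} \<Longrightarrow> (\<And>x y. x \<in> S \<Longrightarrow> adj x y \<Longrightarrow> y \<in> S) \<Longrightarrow> S = UNIV"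
    and "good d"
  shows "\<exists>d. (\<forall>x. d x > 0) \<and> (\<forall>x. 2 * d x \<le> nsum d x)"
proof -
  have "\<exists>d. good d \<and> (\<forall>d'. good d' \<longrightarrow> card {x. d' x > 0} \<le> card {x. d x > 0})"
    by (rule ex_has_greatest_nat[where P = good and k = d and b = "Suc (card (UNIV :: 'v set))"])
      (simp_all add: assms(2) card_mono le_imp_less_Suc)
  then obtain d where d: "good d" "\<And>d'. good d' \<Longrightarrow> card {x. d' x > 0} \<le> card {x. d x > 0}"
    by blast
  have d0: "\<And>x. d x \<ge> 0" and ds: "\<And>x. 2 * d x \<le> nsum d x" and "{x. d x > 0} \<noteq> {}"
    using d(1) by (auto simp: good_def)
  have "{x. d x > 0} = UNIV"
  proof (rule conn)
    fix x y assume x: "x \<in> {x. d x > 0}" and xy: "adj x y"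
    show "y \<in> {x. d x > 0}"
    proof (rule ccontr)
      assume "y \<notin> {x. d x > 0}"
      then have y: "d y = 0" using d0[of y] by simp
      have pos: "nsum d y > 0"
        using nsum_ge[of d "{x}" y] d0 adj_sym[OF xy] x by simp
      define d' where "d' = d(y := nsum d y / 2)"
      have le: "d z \<le> d' z" for z using pos y by (simp add: d'_def)
      have "2 * d' z \<le> nsum d z" for z
        using ds[of z] by (simp add: d'_def)
      then have "2 * d' z \<le> nsum d' z" for z
        using nsum_mono[of d d' z] le by (meson order_trans)
      moreover have "d' y > 0" using pos by (simp add: d'_def)
      moreover have "d' z \<ge> 0" for z using le[of z] d0[of z] by linarith
      ultimately have "good d'" unfolding good_def by blast
      then have "card {x. d' x > 0} \<le> card {x. d x > 0}" by (rule d(2))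
      moreover have "{x. d x > 0} \<subset> {x. d' x > 0}"
      proof
        show "{x. d x > 0} \<subseteq> {x. d' x > 0}" using le by (auto intro: less_le_trans)
        have "y \<in> {x. d' x > 0}" "y \<notin> {x. d x > 0}" using y \<open>d' y > 0\<close> by simp_all
        then show "{x. d x > 0} \<noteq> {x. d' x > 0}" by blast
      qed
      then have "card {x. d x > 0} < card {x. d' x > 0}" by (intro psubset_card_mono) simp_all
      ultimately show False by simp
    qed
  qed fact
  then show ?thesis using ds by (intro exI[of _ d]) auto
qed

text \<open>Constant weight 1 is the null root of a cycle, the extended diagram of type A. Arrows
  are counted instead of neighbours so that double edges and loops are covered.\<close>

lemma good_indicator:
  assumes "S \<noteq> {}" "\<And>x. x \<in> S \<Longrightarrow> \<exists>N. N \<subseteq> {e. e \<in> E \<and> src e = x \<and> tgt e \<in> S} \<and> card N = 2"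
  shows "good (\<lambda>x. if x \<in> S then 1 else 0)"
  unfolding good_def
proof (intro conjI allI)
  fix x
  let ?d = "\<lambda>x. if x \<in> S then 1 else 0 :: real"
  show "2 * ?d x \<le> nsum ?d x"
  proof (cases "x \<in> S")
    case True
    then obtain N where N: "N \<subseteq> {e. e \<in> E \<and> src e = x \<and> tgt e \<in> S}" "card N = 2"
      using assms(2) by blast
    have "(\<Sum>e\<in>N. ?d (tgt e)) \<le> nsum ?d x"
      unfolding nsum_def using N(1) finite_out by (intro sum_mono2) auto
    moreover have "(\<Sum>e\<in>N. ?d (tgt e)) = (\<Sum>e\<in>N. 1)"
      using N(1) by (intro sum.cong) auto
    ultimately show ?thesis using True N(2) by simp
  qed (auto simp: nsum_def intro!: sum_nonneg)
qed (use assms(1) in auto)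

text \<open>The pattern of the null root in extended type D: 2 along the inner path, 1 at the four
  ends.\<close>

lemma good_two_one:
  fixes S L :: "'v set"
  defines "d \<equiv> \<lambda>x. if x \<in> S then 2 else if x \<in> L then 1 else 0 :: real"
  assumes "S \<noteq> {}"
    and S: "\<And>x. x \<in> S \<Longrightarrow> \<exists>A. (\<forall>y\<in>A. adj x y) \<and> 4 \<le> sum d A"
    and L: "\<And>x. x \<in> L \<Longrightarrow> \<exists>y\<in>S. adj x y"
  shows "good d"
  unfolding good_def
proof (intro conjI allI)
  have nonneg: "d x \<ge> 0" for x by (simp add: d_def)
  then show "d x \<ge> 0" for x .
  show "\<exists>x. d x > 0" using assms(2) by (auto simp: d_def)
  fix x
  consider "x \<in> S" | "x \<in> L" "x \<notin> S" | "x \<notin> S" "x \<notin> L" by blast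
  then show "2 * d x \<le> nsum d x"
  proof cases
    case 1
    then obtain A where "\<forall>y\<in>A. adj x y" "4 \<le> sum d A" using S by blast
    then show ?thesis using nsum_ge[of d A x] nonneg 1 by (simp add: d_def)
  next
    case 2
    then obtain y where "y \<in> S" "adj x y" using L by blast
    then show ?thesis using nsum_ge[of d "{y}" x] nonneg 2 by (simp add: d_def)
  next
    case 3
    then show ?thesis using nsum_ge[of d "{}" x] nonneg by (simp add: d_def)
  qed
qed

text \<open>A vertex receives the sum of the weights of all template indices mapped to it. Global
  injectivity of \<open>us\<close> is thus never an issue, and the applications have to compare only
  few vertices.\<close>

lemma good_template:
  assumes t: "template Ns ws" and len: "length us = length ws"
    and us: "\<And>k. k < length us \<Longrightarrow> distinct (map ((!) us) (Ns ! k)) \<and> (\<forall>l\<in>set (Ns ! k). adj (us ! k) (us ! l))"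
  shows "\<exists>d. good d"
proof -
  let ?n = "length ws"
  define w where "w k = real (ws ! k)" for k
  define N where "N k = set (Ns ! k)" for k
  have N: "l < ?n" "k \<in> N l" if "k < ?n" "l \<in> N k" for k l
  proof -
    have "k \<in> set [0..<?n]" using that(1) by simp
    then have "\<forall>l\<in>set (Ns ! k). l < ?n \<and> k \<in> set (Ns ! l)"
      using t unfolding template_def by blast
    then show "l < ?n" "k \<in> N l" using that(2) unfolding N_def by blast+
  qed
  have w: "2 * w k \<le> sum w (N k)" if "k < ?n" for k
  proof -
    have "k \<in> set [0..<?n]" using that by simp
    then have "2 * ws ! k \<le> (\<Sum>l\<leftarrow>Ns ! k. ws ! l)" "distinct (Ns ! k)"
      using t unfolding template_def by blast+
    then have "2 * ws ! k \<le> (\<Sum>l\<in>N k. ws ! l)"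
      by (simp add: N_def sum_list_distinct_conv_sum_set)
    then have "real (2 * ws ! k) \<le> real (\<Sum>l\<in>N k. ws ! l)" by (rule of_nat_mono)
    then show ?thesis by (simp add: w_def)
  qed
  define d where "d x = (\<Sum>k | k < ?n \<and> us ! k = x. w k)" for x
  have d0: "d x \<ge> 0" for x unfolding d_def w_def by (intro sum_nonneg) simp
  have "2 * d x \<le> nsum d x" for x
  proof -
    let ?A = "{y. adj x y}"
    have "2 * d x = (\<Sum>l | l < ?n \<and> us ! l = x. 2 * w l)" by (simp add: d_def sum_distrib_left)
    also have "\<dots> \<le> (\<Sum>l | l < ?n \<and> us ! l = x. sum w (N l))" using w by (intro sum_mono) simp
    also have "\<dots> = (\<Sum>l\<in>{l. l < ?n \<and> us ! l = x}. \<Sum>k\<in>{k \<in> {..<?n}. k \<in> N l}. w k)"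
      using N(1) by (intro sum.cong refl) auto
    also have "\<dots> = (\<Sum>k<?n. \<Sum>l\<in>{l \<in> {l. l < ?n \<and> us ! l = x}. k \<in> N l}. w k)"
      by (rule sum.swap_restrict) simp_all
    also have "\<dots> = (\<Sum>k<?n. \<Sum>l | l < ?n \<and> us ! l = x \<and> l \<in> N k. w k)"
    proof (intro sum.cong refl)
      fix k assume "k \<in> {..<?n}"
      then show "{l \<in> {l. l < ?n \<and> us ! l = x}. k \<in> N l} = {l. l < ?n \<and> us ! l = x \<and> l \<in> N k}"
        using N(2) by auto
    qed
    \<comment> \<open>Indices over \<open>x\<close> that neighbour \<open>k\<close> are neighbours
      of a single index, and \<open>us\<close> is injective on these. So there is at most one of
      them, and if it exists then \<open>us ! k\<close> is adjacent to \<open>x\<close>.\<close>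
    also have "\<dots> \<le> (\<Sum>k<?n. if adj x (us ! k) then w k else 0)"
    proof (rule sum_mono)
      fix k assume k: "k \<in> {..<?n}"
      define M where "M = {l. l < ?n \<and> us ! l = x \<and> l \<in> N k}"
      have inj: "inj_on ((!) us) (N k)"
        using us[of k] k len by (simp add: distinct_map N_def)
      have w0: "w k \<ge> 0" by (simp add: w_def)
      have "(\<Sum>l\<in>M. w k) \<le> (if adj x (us ! k) then w k else 0)"
      proof (cases "M = {}")
        case True
        then show ?thesis using w0 by simp
      next
        case False
        then obtain l where l: "l \<in> M" by blast
        have "M = {l}"
        proof (intro subset_antisym subsetI)
          fix l' assume "l' \<in> M"
          then show "l' \<in> {l}" using inj_onD[OF inj, of l' l] l by (simp add: M_def)
        qed (use l in simp)
        moreover have "adj (us ! k) x" using us[of k] k len l by (auto simp: N_def M_def)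
        ultimately show ?thesis using adj_sym by simp
      qed
      then show "(\<Sum>l | l < ?n \<and> us ! l = x \<and> l \<in> N k. w k) \<le> (if adj x (us ! k) then w k else 0)"
        unfolding M_def .
    qed
    also have "\<dots> = (\<Sum>k | k \<in> {..<?n} \<and> us ! k \<in> ?A. w k)"
      by (simp add: sum.inter_filter[symmetric])
    also have "\<dots> = (\<Sum>y\<in>?A. \<Sum>k | k \<in> {k \<in> {..<?n}. us ! k \<in> ?A} \<and> us ! k = y. w k)"
      by (rule sum.group[symmetric]) auto
    also have "\<dots> = sum d ?A"
      unfolding d_def by (intro sum.cong refl) auto
    also have "\<dots> \<le> nsum d x"
      using d0 by (intro nsum_ge) auto
    finally show ?thesis .
  qed
  moreover have "d (us ! 0) > 0"
  proof -
    have "ws \<noteq> []" "\<forall>w\<in>set ws. w > 0" using t unfolding template_def by blast+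
    then have "0 < ?n" "ws ! 0 > 0" by simp_all
    then have "w 0 \<le> d (us ! 0)" unfolding d_def
      by (intro member_le_sum) (auto simp: w_def)
    then show ?thesis using \<open>ws ! 0 > 0\<close> by (simp add: w_def)
  qed
  ultimately show ?thesis unfolding good_def using d0 by blast
qed

lemma gpath_Cons: "gpath xs \<Longrightarrow> adj y (xs ! 0) \<Longrightarrow> y \<notin> set xs \<Longrightarrow> gpath (y # xs)"
  by (auto simp: gpath_def nth_Cons split: nat.split)

lemma gpath_rev: "gpath xs \<Longrightarrow> gpath (rev xs)"
  unfolding gpath_def
proof (elim conjE, intro conjI allI impI)
  fix i assume *: "\<forall>i. Suc i < length xs \<longrightarrow> adj (xs ! i) (xs ! Suc i)" "Suc i < length (rev xs)"
  then have "adj (xs ! (length xs - Suc (Suc i))) (xs ! Suc (length xs - Suc (Suc i)))" by simp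
  moreover have "Suc (length xs - Suc (Suc i)) = length xs - Suc i" using *(2) by simp
  ultimately show "adj (rev xs ! i) (rev xs ! Suc i)"
    using *(2) adj_sym by (simp add: rev_nth)
qed simp_all

lemma gpath_drop: "gpath xs \<Longrightarrow> c < length xs \<Longrightarrow> gpath (drop c xs)"
  by (auto simp: gpath_def)

lemma gpath_adj: "gpath xs \<Longrightarrow> Suc i < length xs \<Longrightarrow> adj (xs ! i) (xs ! Suc i)"
  by (simp add: gpath_def)

lemma gpath_nth_eq: "gpath xs \<Longrightarrow> i < length xs \<Longrightarrow> j < length xs \<Longrightarrow> xs ! i = xs ! j \<longleftrightarrow> i = j"
  by (simp add: gpath_def nth_eq_iff_index_eq)

lemma longest_gpath: "\<exists>xs. gpath xs \<and> (\<forall>ys. gpath ys \<longrightarrow> length ys \<le> length xs)"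
proof (rule ex_has_greatest_nat)
  show "gpath [undefined]" by (simp add: gpath_def)
  show "\<forall>ys. gpath ys \<longrightarrow> length ys < Suc (card (UNIV :: 'v set))"
    by (auto simp: gpath_def distinct_card[symmetric] less_Suc_eq_le intro: card_mono)
qed

end

section \<open>Connected graphs without weights: paths with at most one extra leaf\<close>

locale no_weights = symmetric_quiver E src tgt opp
  for E :: "'e set" and src tgt :: "'e \<Rightarrow> 'v::finite" and opp :: "'e \<Rightarrow> 'e" +
  assumes not_good: "\<not> good d"
    and connected: "\<And>S. S \<noteq> {} \<Longrightarrow> (\<And>x y. x \<in> S \<Longrightarrow> adj x y \<Longrightarrow> y \<in> S) \<Longrightarrow> S = UNIV"
begin

text \<open>Two parallel arrows and their opposites form a cycle of length two. A loop and its
  opposite are the degenerate case with one vertex.\<close>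

lemma no_parallel:
  assumes "e \<in> E" "e' \<in> E" "src e = src e'" "tgt e = tgt e'"
  shows "e = e'"
proof (rule ccontr)
  assume "e \<noteq> e'"
  let ?S = "{src e, tgt e}"
  have "good (\<lambda>x. if x \<in> ?S then 1 else 0)"
  proof (rule good_indicator)
    fix x assume "x \<in> ?S"
    have "opp e \<noteq> opp e'" using \<open>e \<noteq> e'\<close> by (metis opp_opp)
    show "\<exists>N. N \<subseteq> {e. e \<in> E \<and> src e = x \<and> tgt e \<in> ?S} \<and> card N = 2"
    proof (cases "x = src e")
      case True
      then show ?thesis using assms \<open>e \<noteq> e'\<close> by (intro exI[of _ "{e, e'}"]) auto
    next
      case False
      then have "x = tgt e" using \<open>x \<in> ?S\<close> by blast
      then show ?thesis using assms \<open>opp e \<noteq> opp e'\<close>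
        by (intro exI[of _ "{opp e, opp e'}"]) auto
    qed
  qed simp
  then show False using not_good by blast
qed

lemma adj_irrefl: "\<not> adj x x"
proof
  assume "adj x x"
  then obtain e where e: "e \<in> E" "src e = x" "tgt e = x" by (auto simp: adj_def)
  then show False using no_parallel[of e "opp e"] opp_neq[of e] by simp
qed

text \<open>Such a set contains a cycle, but there is no need to extract it: constant weight 1 on
  the whole set already works.\<close>

lemma no_cycle:
  assumes "S \<noteq> {}" "\<And>x. x \<in> S \<Longrightarrow> \<exists>y\<in>S. \<exists>z\<in>S. y \<noteq> z \<and> adj x y \<and> adj x z"
  shows False
proof -
  have "good (\<lambda>x. if x \<in> S then 1 else 0)"
  proof (rule good_indicator[OF assms(1)])
    fix x assume "x \<in> S"
    then obtain y z where yz: "y \<in> S" "z \<in> S" "y \<noteq> z" "adj x y" "adj x z"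
      using assms(2) by blast
    then obtain e f where "e \<in> E" "src e = x" "tgt e = y" "f \<in> E" "src f = x" "tgt f = z"
      by (auto simp: adj_def)
    moreover from this have "e \<noteq> f" using yz(3) by auto
    ultimately show "\<exists>N. N \<subseteq> {e. e \<in> E \<and> src e = x \<and> tgt e \<in> S} \<and> card N = 2"
      using yz by (intro exI[of _ "{e, f}"]) auto
  qed
  then show False using not_good by blast
qed

text \<open>A chord closes the segment from \<open>i\<close> to \<open>j\<close> to a cycle.\<close>

lemma no_chord:
  assumes "gpath xs" "i < j" "j < length xs" "adj (xs ! i) (xs ! j)"
  shows "j = Suc i"
proof (rule ccontr)
  assume "j \<noteq> Suc i"
  then have ij: "Suc i < j" using assms(2) by simp
  note eq = gpath_nth_eq[OF assms(1)]
  show False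
  proof (rule no_cycle)
    show "(!) xs ` {i..j} \<noteq> {}" using assms(2) by simp
    fix x assume "x \<in> (!) xs ` {i..j}"
    then obtain k where k: "i \<le> k" "k \<le> j" "x = xs ! k" by auto
    consider "k = i" | "k = j" | "i < k" "k < j" using k by linarith
    then show "\<exists>y\<in>(!) xs ` {i..j}. \<exists>z\<in>(!) xs ` {i..j}. y \<noteq> z \<and> adj x y \<and> adj x z"
    proof cases
      case 1
      have "xs ! Suc i \<noteq> xs ! j" using eq[of "Suc i" j] ij assms(3) by simp
      then show ?thesis using 1 k assms ij gpath_adj[OF assms(1), of i]
        by (intro bexI[of _ "xs ! Suc i"] bexI[of _ "xs ! j"]) auto
    next
      case 2
      obtain l where l: "j = Suc l" using ij by (cases j) auto
      have "xs ! l \<noteq> xs ! i" using eq[of l i] ij assms(3) l by simp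
      then show ?thesis using 2 k assms ij l gpath_adj[OF assms(1), of l] adj_sym
        by (intro bexI[of _ "xs ! l"] bexI[of _ "xs ! i"]) auto
    next
      case 3
      obtain l where l: "k = Suc l" using 3 by (cases k) auto
      have "xs ! l \<noteq> xs ! Suc k" using eq[of l "Suc k"] 3 assms(3) l by simp
      then show ?thesis using 3 k assms(3) l gpath_adj[OF assms(1), of l] gpath_adj[OF assms(1), of k] adj_sym
        by (intro bexI[of _ "xs ! l"] bexI[of _ "xs ! Suc k"]) auto
    qed
  qed
qed

lemma gpath_adj_iff:
  assumes "gpath xs" "i < length xs" "j < length xs"
  shows "adj (xs ! i) (xs ! j) \<longleftrightarrow> j = Suc i \<or> i = Suc j"
proof
  assume a: "adj (xs ! i) (xs ! j)"
  consider "i < j" | "j < i" | "i = j" by linarith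
  then show "j = Suc i \<or> i = Suc j"
  proof cases
    case 1 then show ?thesis using no_chord[OF assms(1) 1 assms(3) a] by simp
  next
    case 2 then show ?thesis using no_chord[OF assms(1) 2 assms(2) adj_sym[OF a]] by simp
  next
    case 3 then show ?thesis using a adj_irrefl by simp
  qed
next
  assume "j = Suc i \<or> i = Suc j"
  then show "adj (xs ! i) (xs ! j)"
    using gpath_adj[OF assms(1)] adj_sym assms(2,3) by blast
qed

definition longest :: "'v list \<Rightarrow> bool" where
  "longest xs \<longleftrightarrow> gpath xs \<and> (\<forall>ys. gpath ys \<longrightarrow> length ys \<le> length xs)"

lemma longest_rev: "longest xs \<Longrightarrow> longest (rev xs)"
  by (simp add: longest_def gpath_rev)

lemma longest_end: "longest xs \<Longrightarrow> adj (xs ! 0) y \<Longrightarrow> y \<in> set xs"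
  using gpath_Cons[of xs y] adj_sym[of "xs ! 0" y] unfolding longest_def
  by (metis length_Cons not_less_eq_eq order_refl)

definition branch :: "'v list \<Rightarrow> nat \<Rightarrow> 'v \<Rightarrow> bool" where
  "branch xs c y \<longleftrightarrow> c < length xs \<and> adj (xs ! c) y \<and> y \<notin> set xs"

lemma branch_rev:
  assumes "branch xs c y" shows "branch (rev xs) (length xs - Suc c) y"
  using assms by (auto simp: branch_def rev_nth Suc_diff_Suc)

lemma branch_interior:
  assumes "longest xs" "branch xs c y"
  shows "0 < c" "Suc c < length xs"
proof -
  have pos: "0 < c" if "longest xs" "branch xs c y" for xs c
    using longest_end[of xs y] that by (cases c) (auto simp: branch_def)
  show "0 < c" using pos assms .
  have "0 < length xs - Suc c"
    using pos[OF longest_rev[OF assms(1)] branch_rev[OF assms(2)]] .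
  then show "Suc c < length xs" by simp
qed

text \<open>Two different branches give an extended Dynkin diagram of type \<open>D\<close>.\<close>

lemma branch_unique_le:
  assumes "longest xs" "branch xs b y" "branch xs c z" "b \<le> c"
  shows "b = c \<and> y = z"
proof (rule ccontr)
  assume ne: "\<not> (b = c \<and> y = z)"
  have xs: "gpath xs" using assms(1) by (simp add: longest_def)
  note eq = gpath_nth_eq[OF xs] and adj = gpath_adj_iff[OF xs]
  have b: "0 < b" "Suc b < length xs" and c: "0 < c" "Suc c < length xs"
    using branch_interior[OF assms(1)] assms(2,3) by blast+
  have y: "adj (xs ! b) y" "y \<notin> set xs" and z: "adj (xs ! c) z" "z \<notin> set xs"
    using assms(2,3) by (auto simp: branch_def)
  \<comment> \<open>The null root of extended type D: 2 on the segment between the two branches, 1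
    on the next path vertex on either side and on \<open>y\<close> and \<open>z\<close>. For
    \<open>b = c\<close> this is a centre with four neighbours; for \<open>b < c\<close> the two
    branches may share their end.\<close>
  define S where "S = (!) xs ` {b..c}"
  define L where "L = {xs ! (b - 1), xs ! Suc c, y, z}"
  define d where "d = (\<lambda>x. if x \<in> S then 2 else if x \<in> L then 1 else 0 :: real)"
  have L1: "d x \<ge> 1" if "x \<in> L" for x using that by (simp add: d_def)
  have S2: "d (xs ! k) = 2" if "b \<le> k" "k \<le> c" for k using that by (simp add: S_def d_def)
  have ny: "y \<noteq> xs ! k" "z \<noteq> xs ! k" if "k < length xs" for k using y z that by auto
  have deg: "\<exists>A. (\<forall>y\<in>A. adj x y) \<and> 4 \<le> sum d A" if "x \<in> S" for x
  proof -
    obtain k where k: "b \<le> k" "k \<le> c" "x = xs ! k" using \<open>x \<in> S\<close> by (auto simp: S_def)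
    obtain p where p: "k = Suc p" using k(1) b(1) by (cases k) auto
    have kl: "p < length xs" "Suc k < length xs" using k c p by simp_all
    have nb: "adj x (xs ! p)" "adj x (xs ! Suc k)" "xs ! p \<noteq> xs ! Suc k"
      using kl k(3) p by (simp_all add: adj eq)
    note ny = ny[OF kl(1)] ny[OF kl(2)]
    have y1: "d y \<ge> 1" and z1: "d z \<ge> 1" by (rule L1, simp add: L_def)+
    have p1: "d (xs ! p) \<ge> 1" if "k = b"
    proof -
      have "b - 1 = p" using that p by simp
      then show ?thesis by (intro L1) (simp add: L_def)
    qed
    have q1: "d (xs ! Suc k) \<ge> 1" if "k = c" by (rule L1) (use that in \<open>simp add: L_def\<close>)
    consider "k = b" "k = c" | "k = b" "b < c" | "k = c" "b < c" | "b < k" "k < c" using k by linarith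
    then show ?thesis
    proof cases
      case 1
      then have "y \<noteq> z" using ne by simp
      then have "sum d {xs ! p, xs ! Suc k, y, z} = d (xs ! p) + d (xs ! Suc k) + d y + d z"
        using nb(3) ny by simp
      then have "4 \<le> sum d {xs ! p, xs ! Suc k, y, z}" using p1 q1 y1 z1 1 by simp
      moreover have "\<forall>u\<in>{xs ! p, xs ! Suc k, y, z}. adj x u" using nb 1 y z k(3) by simp
      ultimately show ?thesis by blast
    next
      case 2
      have "sum d {xs ! p, xs ! Suc k, y} = d (xs ! p) + d (xs ! Suc k) + d y"
        using nb(3) ny by simp
      moreover have "d (xs ! Suc k) = 2" using 2 by (intro S2) simp_all
      ultimately have "4 \<le> sum d {xs ! p, xs ! Suc k, y}" using p1 y1 2 by simp
      moreover have "\<forall>u\<in>{xs ! p, xs ! Suc k, y}. adj x u" using nb 2 y k(3) by simp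
      ultimately show ?thesis by blast
    next
      case 3
      have "sum d {xs ! p, xs ! Suc k, z} = d (xs ! p) + d (xs ! Suc k) + d z"
        using nb(3) ny by simp
      moreover have "d (xs ! p) = 2" using 3 p by (intro S2) simp_all
      ultimately have "4 \<le> sum d {xs ! p, xs ! Suc k, z}" using q1 z1 3 by simp
      moreover have "\<forall>u\<in>{xs ! p, xs ! Suc k, z}. adj x u" using nb 3 z k(3) by simp
      ultimately show ?thesis by blast
    next
      case 4
      have "sum d {xs ! p, xs ! Suc k} = d (xs ! p) + d (xs ! Suc k)"
        using nb(3) by simp
      moreover have "d (xs ! p) = 2" "d (xs ! Suc k) = 2" using 4 p by (intro S2; simp)+
      ultimately have "4 \<le> sum d {xs ! p, xs ! Suc k}" by simp
      moreover have "\<forall>u\<in>{xs ! p, xs ! Suc k}. adj x u" using nb by simp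
      ultimately show ?thesis by blast
    qed
  qed
  have "good d"
    unfolding d_def
  proof (rule good_two_one)
    show "S \<noteq> {}" using assms(4) by (simp add: S_def)
  next
    fix x assume "x \<in> L"
    moreover have "xs ! b \<in> S" "xs ! c \<in> S" using assms(4) by (simp_all add: S_def)
    moreover have "adj (xs ! (b - 1)) (xs ! b)" "adj (xs ! Suc c) (xs ! c)"
      using b c by (simp_all add: adj)
    ultimately show "\<exists>y\<in>S. adj x y" using y z adj_sym unfolding L_def by blast
  qed (use deg in \<open>simp add: d_def\<close>)
  then show False using not_good by blast
qed

lemma branch_unique:
  assumes "longest xs" "branch xs b y" "branch xs c z"
  shows "b = c \<and> y = z"
  using branch_unique_le[OF assms] branch_unique_le[OF assms(1,3,2)]
  by (cases "b \<le> c") auto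

text \<open>If \<open>z\<close> were on the path, \<open>y\<close> would branch off at two places.
  If \<open>c\<close> were 1, replacing the initial vertex by \<open>z\<close>, \<open>y\<close>
  would give a path longer than the longest one.\<close>

lemma branch_short:
  assumes "longest xs" "branch xs c y" "adj y z" "z \<noteq> xs ! c"
  shows "z \<notin> set xs" "2 \<le> c"
proof -
  have xs: "gpath xs" using assms(1) by (simp add: longest_def)
  have yc: "adj (xs ! c) y" "y \<notin> set xs" "c < length xs" using assms(2) by (auto simp: branch_def)
  show z: "z \<notin> set xs"
  proof
    assume "z \<in> set xs"
    then obtain k where k: "k < length xs" "z = xs ! k" by (metis in_set_conv_nth)
    then have "branch xs k y" using yc adj_sym[OF assms(3)] by (simp add: branch_def)
    then show False using branch_unique[OF assms(1,2)] k assms(4) by blast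
  qed
  have c: "0 < c" by (rule branch_interior(1)[OF assms(1,2)])
  show "2 \<le> c"
  proof (rule ccontr)
    assume "\<not> 2 \<le> c"
    then have "c = 1" using c by simp
    have "gpath (y # drop c xs)"
      using gpath_Cons[OF gpath_drop[OF xs yc(3)]] yc adj_sym in_set_dropD[of y c xs] by auto
    moreover have "z \<noteq> y" using assms(3) adj_irrefl by blast
    ultimately have "gpath (z # y # drop c xs)"
      using gpath_Cons[of "y # drop c xs" z] z in_set_dropD[of z c xs] adj_sym[OF assms(3)] by auto
    then have "length (z # y # drop c xs) \<le> length xs" using assms(1) unfolding longest_def by blast
    then show False using \<open>c = 1\<close> yc(3) by simp
  qed
qed

lemma template_contradiction:
  assumes "template Ns ws" "length us = length ws"
    "\<And>k. k < length us \<Longrightarrow> distinct (map ((!) us) (Ns ! k)) \<and> (\<forall>l\<in>set (Ns ! k). adj (us ! k) (us ! l))"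
  shows False
  using good_template[OF assms] not_good by blast

text \<open>A branch of length two forces both sides of the path to have length at least two, by
  \<open>branch_short\<close> for the path and its reversal. This gives extended E_6: centre of
  weight 3 and three arms of weights 2, 1.\<close>

lemma leaf_branch:
  assumes "longest xs" "branch xs c y" "adj y z"
  shows "z = xs ! c"
proof (rule ccontr)
  assume ne: "z \<noteq> xs ! c"
  have xs: "gpath xs" using assms(1) by (simp add: longest_def)
  note eq = gpath_nth_eq[OF xs] and adj = gpath_adj_iff[OF xs]
  have y: "adj (xs ! c) y" "y \<notin> set xs" "c < length xs" using assms(2) by (auto simp: branch_def)
  have c: "2 \<le> c" using branch_short(2)[OF assms ne] .
  have "z \<noteq> rev xs ! (length xs - Suc c)" using ne y(3) by (simp add: rev_nth Suc_diff_Suc)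
  from branch_short(2)[OF longest_rev[OF assms(1)] branch_rev[OF assms(2)] assms(3) this]
  have c': "Suc (Suc c) < length xs" by simp
  have ny: "y \<noteq> xs ! k" if "k < length xs" for k using y that by auto
  show False
  proof (rule template_contradiction[of "[[1,3,5],[0,2],[1],[0,4],[3],[0,6],[5]]" "[3,2,1,2,1,2,1]"
        "[xs ! c, xs ! (c - 1), xs ! (c - 2), xs ! Suc c, xs ! Suc (Suc c), y, z]"])
    show "template [[1,3,5],[0,2],[1],[0,4],[3],[0,6],[5]] [3,2,1,2,1,2,1]" by code_simp
  next
    fix k assume "k < length [xs ! c, xs ! (c - 1), xs ! (c - 2), xs ! Suc c, xs ! Suc (Suc c), y, z]"
    then consider "k = 0" | "k = 1" | "k = 2" | "k = 3" | "k = 4" | "k = 5" | "k = 6" by fastforce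
    then show "distinct (map ((!) [xs ! c, xs ! (c - 1), xs ! (c - 2), xs ! Suc c, xs ! Suc (Suc c), y, z])
        ([[1,3,5],[0,2],[1],[0,4],[3],[0,6],[5]] ! k)) \<and>
      (\<forall>l\<in>set ([[1,3,5],[0,2],[1],[0,4],[3],[0,6],[5]] ! k).
        adj ([xs ! c, xs ! (c - 1), xs ! (c - 2), xs ! Suc c, xs ! Suc (Suc c), y, z] ! k)
          ([xs ! c, xs ! (c - 1), xs ! (c - 2), xs ! Suc c, xs ! Suc (Suc c), y, z] ! l))"
      using c c' y ne assms(3) adj_sym[OF y(1)] adj_sym[OF assms(3)] ny[of "c - 1"] ny[of "Suc c"]
      by cases (auto simp: eq adj)
  qed simp
qed

text \<open>A star with three arms: one is the single vertex \<open>y\<close>, the other two have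
  \<open>c\<close> and \<open>length xs - Suc c\<close> vertices.\<close>

definition shape :: "'v list \<Rightarrow> 'v \<Rightarrow> nat \<Rightarrow> bool" where
  "shape xs y c \<longleftrightarrow> gpath xs \<and> y \<notin> set xs \<and> insert y (set xs) = UNIV \<and> 0 < c \<and> Suc c < length xs \<and>
     (\<forall>k<length xs. adj (xs ! k) y \<longleftrightarrow> k = c)"

lemma shape_rev:
  assumes "shape xs y c" shows "shape (rev xs) y (length xs - Suc c)"
  unfolding shape_def
proof (intro conjI allI impI)
  fix k assume k: "k < length (rev xs)"
  then have "adj (rev xs ! k) y \<longleftrightarrow> length xs - Suc k = c"
    using assms unfolding shape_def by (simp add: rev_nth)
  also have "\<dots> \<longleftrightarrow> k = length xs - Suc c"
    using assms k unfolding shape_def by auto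
  finally show "adj (rev xs ! k) y \<longleftrightarrow> k = length xs - Suc c" .
qed (use assms gpath_rev in \<open>auto simp: shape_def\<close>)

text \<open>Two arms with at least three vertices contain extended E_7, whose null root is 4 at the
  centre, 3, 2, 1 on both long arms and 2 on the leaf.\<close>

lemma shape_not_E7:
  assumes "shape xs y c" "3 \<le> c" "c + 3 < length xs"
  shows False
proof -
  obtain p where c: "c = p + 3" using assms(2) by (metis add.commute le_Suc_ex)
  let ?us = "[xs ! (p+3), xs ! (p+2), xs ! (p+1), xs ! p, xs ! (p+4), xs ! (p+5), xs ! (p+6), y]"
  have xs: "gpath xs" using assms(1) by (simp add: shape_def)
  note eq = gpath_nth_eq[OF xs] and adj = gpath_adj_iff[OF xs]
  have y: "adj (xs ! (p+3)) y" using assms(1) c unfolding shape_def by auto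
  have ny: "y \<noteq> xs ! k" if "k < length xs" for k using assms(1) that by (auto simp: shape_def)
  have p: "p + 6 < length xs" using assms(3) c by simp
  show False
  proof (rule template_contradiction[of "[[1,4,7],[0,2],[1,3],[2],[0,5],[4,6],[5],[0]]" "[4,3,2,1,3,2,1,2]" ?us])
    show "template [[1,4,7],[0,2],[1,3],[2],[0,5],[4,6],[5],[0]] [4,3,2,1,3,2,1,2]" by code_simp
  next
    fix k assume "k < length ?us"
    then consider "k = 0" | "k = 1" | "k = 2" | "k = 3" | "k = 4" | "k = 5" | "k = 6" | "k = 7" by fastforce
    then show "distinct (map ((!) ?us) ([[1,4,7],[0,2],[1,3],[2],[0,5],[4,6],[5],[0]] ! k)) \<and>
      (\<forall>l\<in>set ([[1,4,7],[0,2],[1,3],[2],[0,5],[4,6],[5],[0]] ! k). adj (?us ! k) (?us ! l))"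
      using p y adj_sym[OF y] ny[of "p+2"] ny[of "p+4"]
      by cases (simp_all add: eq adj)
  qed simp
qed

text \<open>Arms with at least two and five vertices contain extended E_8, whose null root is 6 at
  the centre, 5, 4, 3, 2, 1 and 4, 2 on the arms and 3 on the leaf.\<close>

lemma shape_not_E8:
  assumes "shape xs y c" "2 \<le> c" "c + 5 < length xs"
  shows False
proof -
  obtain p where c: "c = p + 2" using assms(2) by (metis add.commute le_Suc_ex)
  let ?us = "[xs ! (p+2), xs ! (p+3), xs ! (p+4), xs ! (p+5), xs ! (p+6), xs ! (p+7), xs ! (p+1), xs ! p, y]"
  have xs: "gpath xs" using assms(1) by (simp add: shape_def)
  note eq = gpath_nth_eq[OF xs] and adj = gpath_adj_iff[OF xs]
  have y: "adj (xs ! (p+2)) y" using assms(1) c unfolding shape_def by auto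
  have ny: "y \<noteq> xs ! k" if "k < length xs" for k using assms(1) that by (auto simp: shape_def)
  have p: "p + 7 < length xs" using assms(3) c by simp
  show False
  proof (rule template_contradiction[of "[[1,6,8],[0,2],[1,3],[2,4],[3,5],[4],[0,7],[6],[0]]" "[6,5,4,3,2,1,4,2,3]" ?us])
    show "template [[1,6,8],[0,2],[1,3],[2,4],[3,5],[4],[0,7],[6],[0]] [6,5,4,3,2,1,4,2,3]" by code_simp
  next
    fix k assume "k < length ?us"
    then consider "k = 0" | "k = 1" | "k = 2" | "k = 3" | "k = 4" | "k = 5" | "k = 6" | "k = 7" | "k = 8" by fastforce
    then show "distinct (map ((!) ?us) ([[1,6,8],[0,2],[1,3],[2,4],[3,5],[4],[0,7],[6],[0]] ! k)) \<and>
      (\<forall>l\<in>set ([[1,6,8],[0,2],[1,3],[2,4],[3,5],[4],[0,7],[6],[0]] ! k). adj (?us ! k) (?us ! l))"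
      using p y adj_sym[OF y] ny[of "p+1"] ny[of "p+3"]
      by cases (simp_all add: eq adj)
  qed simp
qed

text \<open>Let p and q be the numbers of vertices on the two arms along the path, both positive.
  Excluded are p, q >= 3 and, using the reversed path, one arm >= 2 with the other >= 5. What
  remains is an arm with one vertex, type D, or arms with 2 and with 2, 3 or 4 vertices, types E_6,
  E_7, E_8; these paths have 5, 6 or 7 vertices.\<close>

lemma classification:
  "(\<exists>xs. gpath xs \<and> set xs = UNIV) \<or>
   (\<exists>xs y c. shape xs y c \<and> (Suc (Suc c) = length xs \<or> c = 2 \<and> length xs \<in> {5, 6, 7}))"
proof -
  obtain xs where l: "longest xs" using longest_gpath unfolding longest_def by blast
  then have xs: "gpath xs" by (simp add: longest_def)
  then have ne: "xs \<noteq> []" by (simp add: gpath_def)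
  show ?thesis
  proof (cases "\<exists>c y. branch xs c y")
    case False
    have "set xs = UNIV"
    proof (rule connected)
      fix x z assume "x \<in> set xs" "adj x z"
      then show "z \<in> set xs" using False by (auto simp: branch_def in_set_conv_nth)
    qed (use ne in simp)
    then show ?thesis using xs by blast
  next
    case True
    then obtain c y where b: "branch xs c y" by blast
    have "insert y (set xs) = UNIV"
    proof (rule connected)
      fix x z assume x: "x \<in> insert y (set xs)" "adj x z"
      show "z \<in> insert y (set xs)"
      proof (cases "x = y")
        case True
        then have "z = xs ! c" using leaf_branch[OF l b] x(2) by blast
        then show ?thesis using b by (simp add: branch_def)
      next
        case False
        then obtain k where k: "k < length xs" "x = xs ! k" using x(1) by (auto simp: in_set_conv_nth)
        show ?thesis
        proof (rule ccontr)
          assume n: "z \<notin> insert y (set xs)"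
          then have "branch xs k z" using k x(2) by (simp add: branch_def)
          then show False using branch_unique[OF l b] n by blast
        qed
      qed
    qed simp
    moreover have "adj (xs ! k) y \<longleftrightarrow> k = c" if "k < length xs" for k
      using branch_unique[OF l b, of k y] b that by (auto simp: branch_def)
    ultimately have sh: "shape xs y c"
      using xs b branch_interior[OF l b] by (simp add: shape_def branch_def)
    let ?c' = "length xs - Suc c"
    have sh': "shape (rev xs) y ?c'" by (rule shape_rev[OF sh])
    have c: "0 < c" "Suc c < length xs" using sh by (auto simp: shape_def)
    have E7: "\<not> (3 \<le> c \<and> c + 3 < length xs)" using shape_not_E7[OF sh] by blast
    have E8: "\<not> (2 \<le> c \<and> c + 5 < length xs)" using shape_not_E8[OF sh] by blast
    have E8': "\<not> (2 \<le> ?c' \<and> ?c' + 5 < length (rev xs))" using shape_not_E8[OF sh'] by blast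
    have "(Suc (Suc c) = length xs \<or> c = 2 \<and> length xs \<in> {5, 6, 7}) \<or>
      (Suc (Suc ?c') = length (rev xs) \<or> ?c' = 2 \<and> length (rev xs) \<in> {5, 6, 7})"
      using c E7 E8 E8' by auto
    then show ?thesis using sh sh' by blast
  qed
qed

end

section \<open>From lists of vertices to Dynkin diagrams\<close>

lemma underlying_graph_isoI:
  fixes Q :: "('v, 'a) pre_digraph"
  assumes "distinct zs" "set zs = verts Q"
    and "\<And>\<alpha> \<beta>. \<alpha> \<in> arcs Q \<Longrightarrow> \<beta> \<in> arcs Q \<Longrightarrow> {tail Q \<alpha>, head Q \<alpha>} = {tail Q \<beta>, head Q \<beta>} \<Longrightarrow> \<alpha> = \<beta>"
    and "\<And>\<alpha>. \<alpha> \<in> arcs Q \<Longrightarrow> tail Q \<alpha> \<in> verts Q \<and> head Q \<alpha> \<in> verts Q"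
    and "\<And>e. e \<in> X \<longleftrightarrow> (\<exists>i<length zs. \<exists>k<length zs. e = {Suc i, Suc k} \<and>
      (\<exists>\<alpha>\<in>arcs Q. tail Q \<alpha> = zs ! i \<and> head Q \<alpha> = zs ! k))"
  shows "underlying_graph_iso Q (length zs) X"
proof -
  let ?n = "length zs"
  \<comment> \<open>List positions start at 0, the vertices of the diagrams at 1.\<close>
  define f where "f x = Suc (the_inv_into {..<?n} ((!) zs) x)" for x
  have bij: "bij_betw ((!) zs) {..<?n} (verts Q)"
    using assms(1,2) by (intro bij_betw_nth) simp_all
  have inv: "bij_betw (the_inv_into {..<?n} ((!) zs)) (verts Q) {..<?n}"
    by (rule bij_betw_the_inv_into[OF bij])
  have Suc: "bij_betw Suc {..<?n} {1..?n}"
    by (intro bij_betwI[of _ _ _ "\<lambda>x. x - 1"]) auto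
  have f: "bij_betw f (verts Q) {1..?n}"
    using bij_betw_trans[OF inv Suc] by (simp add: f_def comp_def[abs_def] bij_betw_def inj_on_def)
  have fz: "f (zs ! i) = Suc i" if "i < ?n" for i
    using the_inv_into_f_f[OF bij_betw_imp_inj_on[OF bij], of i] that by (simp add: f_def)
  have nth: "\<exists>i<?n. x = zs ! i" if "x \<in> verts Q" for x
    using that assms(2) by (metis in_set_conv_nth)
  have "bij_betw (\<lambda>\<alpha>. {f (tail Q \<alpha>), f (head Q \<alpha>)}) (arcs Q) X"
    unfolding bij_betw_def
  proof
    show "inj_on (\<lambda>\<alpha>. {f (tail Q \<alpha>), f (head Q \<alpha>)}) (arcs Q)"
    proof (rule inj_onI)
      fix \<alpha> \<beta> assume ab: "\<alpha> \<in> arcs Q" "\<beta> \<in> arcs Q"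
        "{f (tail Q \<alpha>), f (head Q \<alpha>)} = {f (tail Q \<beta>), f (head Q \<beta>)}"
      then have "f ` {tail Q \<alpha>, head Q \<alpha>} = f ` {tail Q \<beta>, head Q \<beta>}" by simp
      moreover have "{tail Q \<alpha>, head Q \<alpha>} \<subseteq> verts Q" "{tail Q \<beta>, head Q \<beta>} \<subseteq> verts Q"
        using assms(4)[OF ab(1)] assms(4)[OF ab(2)] by simp_all
      ultimately have "{tail Q \<alpha>, head Q \<alpha>} = {tail Q \<beta>, head Q \<beta>}"
        using inj_on_image_eq_iff[OF bij_betw_imp_inj_on[OF f]] by metis
      then show "\<alpha> = \<beta>" using assms(3) ab(1,2) by blast
    qed
    show "(\<lambda>\<alpha>. {f (tail Q \<alpha>), f (head Q \<alpha>)}) ` arcs Q = X"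
    proof (intro subset_antisym subsetI)
      fix e assume "e \<in> (\<lambda>\<alpha>. {f (tail Q \<alpha>), f (head Q \<alpha>)}) ` arcs Q"
      then obtain \<alpha> where \<alpha>: "\<alpha> \<in> arcs Q" "e = {f (tail Q \<alpha>), f (head Q \<alpha>)}" by blast
      obtain i k where ik: "i < ?n" "tail Q \<alpha> = zs ! i" "k < ?n" "head Q \<alpha> = zs ! k"
        using nth assms(4)[OF \<alpha>(1)] by blast
      have "e = {Suc i, Suc k}" using \<alpha>(2) ik fz by simp
      then show "e \<in> X" unfolding assms(5) using ik \<alpha>(1) by blast
    next
      fix e assume "e \<in> X"
      then obtain i k \<alpha> where *: "i < ?n" "k < ?n" "e = {Suc i, Suc k}" "\<alpha> \<in> arcs Q"
        "tail Q \<alpha> = zs ! i" "head Q \<alpha> = zs ! k" unfolding assms(5) by blast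
      then have "e = {f (tail Q \<alpha>), f (head Q \<alpha>)}" using fz by simp
      then show "e \<in> (\<lambda>\<alpha>. {f (tail Q \<alpha>), f (head Q \<alpha>)}) ` arcs Q" using *(4) by blast
    qed
  qed
  then show ?thesis using f unfolding underlying_graph_iso_def by blast
qed

lemma symmetric_quiver_double:
  fixes Q :: "('v::finite, 'a) pre_digraph"
  assumes "fin_digraph Q"
  shows "symmetric_quiver (arcs (double_quiver Q)) (tail (double_quiver Q)) (head (double_quiver Q))
    opposite_arrow"
proof
  show "finite (arcs (double_quiver Q))"
    using fin_digraph.finite_arcs[OF assms] by (simp add: double_quiver_def)
qed (auto simp: double_quiver_def opposite_arrow_def split: sum.splits)

lemma connected_closed_set:
  assumes "Digraph_Component.connected Q" "S \<subseteq> verts Q" "S \<noteq> {}"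
    and "\<And>\<alpha>. \<alpha> \<in> arcs Q \<Longrightarrow> tail Q \<alpha> \<in> S \<longleftrightarrow> head Q \<alpha> \<in> S"
  shows "S = verts Q"
proof -
  obtain x where x: "x \<in> S" using assms(3) by blast
  have "y \<in> S" if "y \<in> verts Q" for y
  proof -
    have "(x, y) \<in> rtrancl_on (verts (with_proj (mk_symmetric Q))) (arcs_ends (with_proj (mk_symmetric Q)))"
      using assms(1,2) x that
      unfolding Digraph_Component.connected_def strongly_connected_def reachable_def by auto
    then show ?thesis
      by (induction rule: rtrancl_on_induct) (use x assms(4) in \<open>auto simp: mk_symmetric_def\<close>)
  qed
  then show ?thesis using assms(2) by blast
qed

lemma path_edges_iff: "e \<in> path_edges m \<longleftrightarrow> (\<exists>i. Suc i < m \<and> e = {Suc i, Suc (Suc i)})"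
proof
  assume "e \<in> path_edges m"
  then obtain i where "1 \<le> i" "i < m" "e = {i, i + 1}" unfolding path_edges_def by blast
  then show "\<exists>i. Suc i < m \<and> e = {Suc i, Suc (Suc i)}" by (intro exI[of _ "i - 1"]) auto
next
  assume "\<exists>i. Suc i < m \<and> e = {Suc i, Suc (Suc i)}"
  then obtain i where "Suc i < m" "e = {Suc i, Suc (Suc i)}" by blast
  then show "e \<in> path_edges m" unfolding path_edges_def by (intro CollectI exI[of _ "Suc i"]) simp
qed

text \<open>Contrapositive of the classification: without good weights, the list of vertices found
  there numbers \<open>Q\<close> as a diagram of type A, D or E.\<close>

lemma non_dynkin_weights:
  fixes Q :: "('v::finite, 'a) pre_digraph"
  assumes "fin_digraph Q" "verts Q = UNIV" "Digraph_Component.connected Q" "\<not> dynkin Q"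
  shows "\<exists>d :: 'v \<Rightarrow> real. (\<forall>k. d k > 0) \<and> (\<forall>k. 2 * d k \<le>
    (\<Sum>e | e \<in> arcs (double_quiver Q) \<and> tail (double_quiver Q) e = k. d (head (double_quiver Q) e)))"
proof -
  let ?G = "double_quiver Q"
  interpret symmetric_quiver "arcs ?G" "tail ?G" "head ?G" opposite_arrow
    by (rule symmetric_quiver_double[OF assms(1)])
  have adj_Q: "adj x y \<longleftrightarrow> (\<exists>\<alpha>\<in>arcs Q. tail Q \<alpha> = x \<and> head Q \<alpha> = y \<or> tail Q \<alpha> = y \<and> head Q \<alpha> = x)" for x y
  proof -
    have "(\<exists>e\<in>arcs Q <+> arcs Q. R e) \<longleftrightarrow> (\<exists>\<alpha>\<in>arcs Q. R (Inl \<alpha>) \<or> R (Inr \<alpha>))" for R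
      by auto
    then show ?thesis unfolding adj_def by (simp add: double_quiver_def conj_commute)
  qed
  have conn: "S = UNIV" if S: "S \<noteq> {}" "\<And>x y. x \<in> S \<Longrightarrow> adj x y \<Longrightarrow> y \<in> S" for S
  proof -
    have "tail Q \<alpha> \<in> S \<longleftrightarrow> head Q \<alpha> \<in> S" if "\<alpha> \<in> arcs Q" for \<alpha>
      using S(2)[of "tail Q \<alpha>" "head Q \<alpha>"] S(2)[of "head Q \<alpha>" "tail Q \<alpha>"] that adj_Q by blast
    from connected_closed_set[OF assms(3) _ S(1) this] show ?thesis by (simp add: assms(2))
  qed
  have "\<exists>d. good d"
  proof (rule ccontr)
    assume "\<nexists>d. good d"
    then interpret no_weights "arcs ?G" "tail ?G" "head ?G" opposite_arrow
      by unfold_locales (use conn in auto)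
    have inj: "\<alpha> = \<beta>" if ab: "\<alpha> \<in> arcs Q" "\<beta> \<in> arcs Q"
      "{tail Q \<alpha>, head Q \<alpha>} = {tail Q \<beta>, head Q \<beta>}" for \<alpha> \<beta>
    proof -
      have G: "Inl \<alpha> \<in> arcs ?G" "Inl \<beta> \<in> arcs ?G" "Inr \<beta> \<in> arcs ?G"
        using that(1,2) by (auto simp: double_quiver_def)
      consider "tail Q \<alpha> = tail Q \<beta>" "head Q \<alpha> = head Q \<beta>" | "tail Q \<alpha> = head Q \<beta>" "head Q \<alpha> = tail Q \<beta>"
        using ab(3) by (auto simp: doubleton_eq_iff)
      then show ?thesis
      proof cases
        case 1
        then show ?thesis using no_parallel[OF G(1,2)] by (simp add: double_quiver_def)
      next
        case 2
        then show ?thesis using no_parallel[OF G(1,3)] by (simp add: double_quiver_def)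
      qed
    qed
    have iso: "underlying_graph_iso Q (length zs) X"
      if z: "distinct zs" "set zs = UNIV"
        "\<And>e. e \<in> X \<longleftrightarrow> (\<exists>i<length zs. \<exists>k<length zs. e = {Suc i, Suc k} \<and> adj (zs ! i) (zs ! k))" for zs X
    proof (rule underlying_graph_isoI)
      fix e
      show "e \<in> X \<longleftrightarrow> (\<exists>i<length zs. \<exists>k<length zs. e = {Suc i, Suc k} \<and>
          (\<exists>\<alpha>\<in>arcs Q. tail Q \<alpha> = zs ! i \<and> head Q \<alpha> = zs ! k))" (is "_ \<longleftrightarrow> ?r")
      proof
        assume "e \<in> X"
        then obtain i k \<alpha> where *: "i < length zs" "k < length zs" "e = {Suc i, Suc k}" "\<alpha> \<in> arcs Q"
          "tail Q \<alpha> = zs ! i \<and> head Q \<alpha> = zs ! k \<or> tail Q \<alpha> = zs ! k \<and> head Q \<alpha> = zs ! i"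
          unfolding z(3) adj_Q by blast
        have "e = {Suc k, Suc i}" using *(3) by (simp only: insert_commute)
        with * show ?r by blast
      next
        assume ?r
        then show "e \<in> X" unfolding z(3) adj_Q by blast
      qed
    next
      show "distinct zs" by (rule z(1))
      show "set zs = verts Q" by (simp only: z(2) assms(2))
      show "\<alpha> = \<beta>" if "\<alpha> \<in> arcs Q" "\<beta> \<in> arcs Q" "{tail Q \<alpha>, head Q \<alpha>} = {tail Q \<beta>, head Q \<beta>}" for \<alpha> \<beta>
        by (rule inj[OF that])
      show "tail Q \<alpha> \<in> verts Q \<and> head Q \<alpha> \<in> verts Q" for \<alpha> by (simp only: assms(2) UNIV_I simp_thms)
    qed
    have path: "(\<exists>i<length xs. \<exists>k<length xs. e = {Suc i, Suc k} \<and> adj (xs ! i) (xs ! k))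
        \<longleftrightarrow> e \<in> path_edges (length xs)" (is "?l \<longleftrightarrow> _") if xs: "gpath xs" for xs e
    proof
      assume ?l
      then obtain i k where ik: "i < length xs" "k < length xs" "e = {Suc i, Suc k}" "adj (xs ! i) (xs ! k)"
        by blast
      have "e = {Suc k, Suc i}" using ik(3) by (simp only: insert_commute)
      with ik gpath_adj_iff[OF xs ik(1,2)] show "e \<in> path_edges (length xs)"
        unfolding path_edges_iff by blast
    next
      assume "e \<in> path_edges (length xs)"
      then obtain i where i: "Suc i < length xs" "e = {Suc i, Suc (Suc i)}" unfolding path_edges_iff by blast
      with gpath_adj[OF xs i(1)] Suc_lessD[OF i(1)] show ?l by blast
    qed
    from classification show False
    proof (elim disjE exE conjE)
      fix xs assume xs: "gpath xs" "set xs = UNIV"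
      then have "underlying_graph_iso Q (length xs) (path_edges (length xs))"
        by (intro iso) (simp_all only: path[OF xs(1)] gpath_def)
      moreover have "length xs \<ge> 1" using xs(1) by (cases xs) (auto simp: gpath_def)
      ultimately show False using assms(4) unfolding dynkin_def by blast
    next
      \<comment> \<open>The leaf \<open>y\<close> is numbered last, and position \<open>c\<close>
        becomes the vertex \<open>Suc c\<close>. With n vertices in all, a final arm of one vertex
        means attachment to n - 2, and \<open>c = 2\<close> means attachment to 3, as in the
        definition of \<open>dynkin\<close>.\<close>
      have iso': "underlying_graph_iso Q (Suc (length xs)) (insert {Suc c, Suc (length xs)} (path_edges (length xs)))"
        if sh: "shape xs y c" for xs y c
      proof -
        have xs: "gpath xs" and y: "y \<notin> set xs" "insert y (set xs) = UNIV" and c: "Suc c < length xs"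
          and yc: "\<And>k. k < length xs \<Longrightarrow> adj (xs ! k) y \<longleftrightarrow> k = c"
          using sh by (auto simp: shape_def)
        have yc': "adj y (xs ! k) \<longleftrightarrow> k = c" if "k < length xs" for k
          using yc[OF that] adj_sym by blast
        have "underlying_graph_iso Q (length (xs @ [y])) (insert {Suc c, Suc (length xs)} (path_edges (length xs)))"
        proof (rule iso)
          show "distinct (xs @ [y])" using xs y by (simp add: gpath_def)
          show "set (xs @ [y]) = UNIV" using y by simp
          fix e
          have "(\<exists>i<length (xs @ [y]). \<exists>k<length (xs @ [y]). e = {Suc i, Suc k} \<and> adj ((xs @ [y]) ! i) ((xs @ [y]) ! k))
            \<longleftrightarrow> (\<exists>i<length xs. \<exists>k<length xs. e = {Suc i, Suc k} \<and> adj (xs ! i) (xs ! k))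
              \<or> (\<exists>i<length xs. e = {Suc i, Suc (length xs)} \<and> adj (xs ! i) y)
              \<or> (\<exists>k<length xs. e = {Suc (length xs), Suc k} \<and> adj y (xs ! k))"
          proof -
            have "(\<exists>i<length (xs @ [y]). T i) \<longleftrightarrow> (\<exists>i<length xs. T i) \<or> T (length xs)" for T
              by (auto simp: less_Suc_eq)
            moreover have "(xs @ [y]) ! i = xs ! i" if "i < length xs" for i using that by (simp add: nth_append)
            moreover have "(xs @ [y]) ! length xs = y" by simp
            ultimately show ?thesis using adj_irrefl[of y] by (simp cong: conj_cong) blast
          qed
          also have "\<dots> \<longleftrightarrow> e \<in> insert {Suc c, Suc (length xs)} (path_edges (length xs))"
          proof -
            have "(\<exists>i<length xs. e = {Suc i, Suc (length xs)} \<and> adj (xs ! i) y) \<longleftrightarrow> e = {Suc c, Suc (length xs)}"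
              by (rule iffI) (use yc Suc_lessD[OF c] in blast)+
            moreover have "(\<exists>k<length xs. e = {Suc (length xs), Suc k} \<and> adj y (xs ! k)) \<longleftrightarrow> e = {Suc c, Suc (length xs)}"
              unfolding insert_commute[of "Suc (length xs)"]
              by (rule iffI) (use yc' Suc_lessD[OF c] in blast)+
            ultimately show ?thesis unfolding path[OF xs] insert_iff by blast
          qed
          finally show "e \<in> insert {Suc c, Suc (length xs)} (path_edges (length xs)) \<longleftrightarrow>
            (\<exists>i<length (xs @ [y]). \<exists>k<length (xs @ [y]). e = {Suc i, Suc k} \<and> adj ((xs @ [y]) ! i) ((xs @ [y]) ! k))"
            by simp
        qed
        then show ?thesis by simp
      qed
      {
        fix xs y c assume sh: "shape xs y c" "Suc (Suc c) = length xs"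
        let ?n = "Suc (length xs)"
        have "underlying_graph_iso Q ?n (insert {?n - 2, ?n} (path_edges (?n - 1)))"
        proof -
          have "Suc c = ?n - 2" "length xs = ?n - 1" using sh(2) by simp_all
          then show ?thesis using iso'[OF sh(1)] by simp
        qed
        moreover have "?n \<ge> 4" using sh by (auto simp: shape_def)
        ultimately show False using assms(4) unfolding dynkin_def by blast
      }
      {
        fix xs y c assume sh: "shape xs y c" "c = 2" "length xs \<in> {5, 6, 7}"
        let ?n = "Suc (length xs)"
        have "underlying_graph_iso Q ?n (insert {3, ?n} (path_edges (?n - 1)))"
          using iso'[OF sh(1)] sh(2) by (simp add: numeral_3_eq_3)
        moreover have "?n \<in> {6, 7, 8}" using sh(3) by auto
        ultimately show False using assms(4) unfolding dynkin_def by blast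
      }
    qed
  qed
  then obtain d where "good d" by blast
  from good_imp_positive[OF conn this] show ?thesis unfolding nsum_def by blast
qed

section \<open>Right ideals generated by the mesh relations\<close>

definition fscale :: "'k::field \<Rightarrow> ('b \<Rightarrow> 'k) \<Rightarrow> 'b \<Rightarrow> 'k" where
  "fscale c f = (\<lambda>p. c * f p)"

lemma fscale_apply [simp]: "fscale c f p = c * f p"
  by (simp add: fscale_def)

interpretation fs: scalar_space "fscale :: 'k::field \<Rightarrow> ('b \<Rightarrow> 'k) \<Rightarrow> 'b \<Rightarrow> 'k"
  by unfold_locales (auto simp: fun_eq_iff algebra_simps)

declare fs.scale_scale [simp del]

abbreviation flinear :: "(('b \<Rightarrow> 'k::field) \<Rightarrow> 'b \<Rightarrow> 'k) \<Rightarrow> bool" where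
  "flinear \<equiv> Vector_Spaces.linear fscale fscale"

lemma flinearI:
  assumes "\<And>f g. T (f + g) = T f + T g" "\<And>c f. T (fscale c f) = fscale c (T f)"
  shows "flinear T"
  using assms by (unfold_locales) auto

lemma flinearD:
  assumes "flinear T"
  shows "T (f + g) = T f + T g" "T (fscale c f) = fscale c (T f)" "T 0 = 0"
    "T (f - g) = T f - T g" "T (sum h A) = (\<Sum>a\<in>A. T (h a))"
proof -
  have hom: "module_hom fscale fscale T"
    using assms by (simp add: Vector_Spaces.linear_def)
  show "T (f + g) = T f + T g" "T (fscale c f) = fscale c (T f)" "T 0 = 0"
    "T (f - g) = T f - T g" "T (sum h A) = (\<Sum>a\<in>A. T (h a))"
    by (rule module_hom.add[OF hom] module_hom.scale[OF hom] module_hom.zero[OF hom]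
        module_hom.diff[OF hom] module_hom.sum[OF hom])+
qed

lemma sum_fun_apply: "sum f A x = (\<Sum>a\<in>A. f a x)"
  for f :: "'i \<Rightarrow> 'b \<Rightarrow> 'k::comm_monoid_add"
  by (induction A rule: infinite_finite_induct) auto

lemma fsubspaceI:
  assumes "0 \<in> S" "\<And>f g. f \<in> S \<Longrightarrow> g \<in> S \<Longrightarrow> f + g \<in> S"
    "\<And>c f. f \<in> S \<Longrightarrow> fscale c f \<in> S"
  shows "fs.subspace S"
  using assms by (simp add: fs.subspace_def)

text \<open>Walks are stored in reverse: \<open>a # p\<close> is the walk \<open>p\<close> followed by the arrow \<open>a\<close>.\<close>

definition snoc_arrow :: "'e \<Rightarrow> ('e list \<Rightarrow> 'k::field) \<Rightarrow> 'e list \<Rightarrow> 'k" where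
  "snoc_arrow a f = (\<lambda>p. case p of [] \<Rightarrow> 0 | b # q \<Rightarrow> if b = a then f q else 0)"

definition div_arrow :: "'e \<Rightarrow> ('e list \<Rightarrow> 'k::field) \<Rightarrow> 'e list \<Rightarrow> 'k" where
  "div_arrow a f = (\<lambda>p. f (a # p))"

lemma snoc_arrow_simps [simp]:
  "snoc_arrow a f [] = 0" "snoc_arrow a f (b # q) = (if b = a then f q else 0)"
  by (simp_all add: snoc_arrow_def)

lemma div_arrow_apply [simp]: "div_arrow a f p = f (a # p)"
  by (simp add: div_arrow_def)

lemma div_snoc_arrow: "div_arrow a (snoc_arrow b f) = (if a = b then f else 0)"
  by (rule ext) simp

lemma flinear_snoc_arrow: "flinear (snoc_arrow (a :: 'e) :: _ \<Rightarrow> _ \<Rightarrow> 'k::field)"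
proof (rule flinearI; rule ext)
  fix f g :: "'e list \<Rightarrow> 'k" and c p
  show "snoc_arrow a (f + g) p = (snoc_arrow a f + snoc_arrow a g) p"
    "snoc_arrow a (fscale c f) p = fscale c (snoc_arrow a f) p"
    by (cases p; simp)+
qed

lemma flinear_div_arrow: "flinear (div_arrow a)"
  by (rule flinearI; rule ext) simp_all

lemmas snoc_arrow_lin = flinearD[OF flinear_snoc_arrow]
lemmas div_arrow_lin = flinearD[OF flinear_div_arrow]

lemma list_fun_eqI:
  assumes "f [] = g []" "\<And>a. div_arrow a f = div_arrow a g"
  shows "f = g"
proof
  fix p show "f p = g p"
    using assms(1) fun_cong[OF assms(2), of "hd p" "tl p"] by (cases p) simp_all
qed

text \<open>\<open>sg\<close> holds the signs of the mesh relation, treated as arbitrary nonzero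
  scalars, and \<open>c\<close> the parameters v_i of the central extension.\<close>

locale mesh_quiver = symmetric_quiver E src tgt opp
  for E :: "'e set" and src tgt :: "'e \<Rightarrow> 'v::finite" and opp :: "'e \<Rightarrow> 'e" +
  fixes sg :: "'e \<Rightarrow> 'k::field" and c :: "'v \<Rightarrow> 'k"
  assumes sg_nz: "sg a \<noteq> 0"
begin

fun walk :: "'v \<Rightarrow> 'e list \<Rightarrow> 'v \<Rightarrow> bool" where
  "walk j [] i \<longleftrightarrow> i = j"
| "walk j (a # p) i \<longleftrightarrow> a \<in> E \<and> tgt a = i \<and> walk j p (src a)"

definition P :: "'v \<Rightarrow> nat \<Rightarrow> 'v \<Rightarrow> ('e list \<Rightarrow> 'k) set" where
  "P j n i = {f. \<forall>p. f p \<noteq> 0 \<longrightarrow> walk j p i \<and> length p = n}"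

definition F :: "'v \<Rightarrow> nat \<Rightarrow> 'v \<Rightarrow> ('e list \<Rightarrow> 'k) set" where
  "F j n i = {f. \<forall>p. f p \<noteq> 0 \<longrightarrow> walk j p i \<and> length p \<le> n \<and> even (n + length p)}"

text \<open>Right multiplication of \<open>y\<close> by the mesh relation at \<open>i\<close>;
  summing over the doubled quiver puts both halves of the relation into one signed sum.\<close>

definition mesh :: "'v \<Rightarrow> ('e list \<Rightarrow> 'k) \<Rightarrow> 'e list \<Rightarrow> 'k" where
  "mesh i y = (\<Sum>e | e \<in> E \<and> src e = i. fscale (sg e) (snoc_arrow (opp e) (snoc_arrow e y)))"

text \<open>The sums of products g a with an arrow a into \<open>i\<close> and g in
  \<open>A (src a)\<close>, characterised by their parts ending in each arrow. The value
  \<open>{0}\<close> for other arrows and at the empty list fixes the support.\<close>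

definition Ext :: "('v \<Rightarrow> ('e list \<Rightarrow> 'k) set) \<Rightarrow> 'v \<Rightarrow> ('e list \<Rightarrow> 'k) set" where
  "Ext A i = {f. f [] = 0 \<and> (\<forall>a. div_arrow a f \<in> (if a \<in> E \<and> tgt a = i then A (src a) else {0}))}"

text \<open>
  \<open>J j n i\<close> and \<open>I j n i\<close> are the parts of degree \<open>n\<close>, between \<open>j\<close> and \<open>i\<close>, of the ideals defining the
  preprojective algebra and the central extension: a product \<open>p \<rho> q\<close> either has \<open>q\<close> trivial or ends in
  an arrow. In degree \<open>n\<close> the power of \<open>z\<close> is determined by the length of the walk, so \<open>z\<close> is set to \<open>1\<close>
  and multiplication by \<open>z\<close> becomes the inclusion of \<open>F j n i\<close> into \<open>F j (n + 2) i\<close>.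
\<close>

primrec J :: "'v \<Rightarrow> nat \<Rightarrow> 'v \<Rightarrow> ('e list \<Rightarrow> 'k) set" where
  "J j 0 = (\<lambda>i. {0})"
| "J j (Suc n) = (\<lambda>i. if n = 0 then {0}
    else {f. \<exists>y\<in>P j (n - 1) i. f - mesh i y \<in> Ext (J j n) i})"

primrec I :: "'v \<Rightarrow> nat \<Rightarrow> 'v \<Rightarrow> ('e list \<Rightarrow> 'k) set" where
  "I j 0 = (\<lambda>i. {0})"
| "I j (Suc n) = (\<lambda>i. if n = 0 then {0}
    else {f. \<exists>y\<in>F j (n - 1) i. f - (mesh i y - fscale (c i) y) \<in> Ext (I j n) i})"

declare J.simps [simp del] I.simps [simp del]

lemma J_0 [simp]: "J j 0 i = {0}" "J j (Suc 0) i = {0}"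
  and J_Suc_Suc: "J j (Suc (Suc n)) i = {f. \<exists>y\<in>P j n i. f - mesh i y \<in> Ext (J j (Suc n)) i}"
  by (simp_all add: J.simps)

lemma I_0 [simp]: "I j 0 i = {0}" "I j (Suc 0) i = {0}"
  and I_Suc_Suc: "I j (Suc (Suc n)) i =
    {f. \<exists>y\<in>F j n i. f - (mesh i y - fscale (c i) y) \<in> Ext (I j (Suc n)) i}"
  by (simp_all add: I.simps)

lemma finite_arrows [simp]: "finite {e. e \<in> E \<and> Q e}"
  using finite_E by simp

lemma mesh_Nil [simp]: "mesh i y [] = 0"
  by (simp add: mesh_def sum_fun_apply)

lemma div_mesh:
  "div_arrow a (mesh i y) =
     (if a \<in> E \<and> tgt a = i then fscale (sg (opp a)) (snoc_arrow (opp a) y) else 0)"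
proof -
  have "div_arrow a (mesh i y) = (\<Sum>e | e \<in> E \<and> src e = i.
      if e = opp a then fscale (sg e) (snoc_arrow e y) else 0)"
    unfolding mesh_def div_arrow_lin(5)
    by (intro sum.cong refl) (auto simp: div_arrow_lin(2) div_snoc_arrow)
  also have "\<dots> = (if opp a \<in> {e. e \<in> E \<and> src e = i}
      then fscale (sg (opp a)) (snoc_arrow (opp a) y) else 0)"
    by (simp add: sum.delta)
  also have "opp a \<in> {e. e \<in> E \<and> src e = i} \<longleftrightarrow> a \<in> E \<and> tgt a = i"
    using opp_in[of a] opp_in[of "opp a"] by auto
  finally show ?thesis .
qed

lemma flinear_mesh: "flinear (mesh i)"
  by (rule flinearI)
    (simp_all add: mesh_def snoc_arrow_lin fs.scale_right_distrib sum.distrib fs.scale_sum_right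
      fs.scale_left_commute)

lemmas mesh_lin = flinearD[OF flinear_mesh]

lemma Ext_iff:
  "f \<in> Ext A i \<longleftrightarrow> f [] = 0 \<and> (\<forall>a\<in>E. tgt a = i \<longrightarrow> div_arrow a f \<in> A (src a))
     \<and> (\<forall>a. \<not> (a \<in> E \<and> tgt a = i) \<longrightarrow> div_arrow a f = 0)"
  unfolding Ext_def by auto

lemma ExtD: "f \<in> Ext A i \<Longrightarrow> a \<in> E \<Longrightarrow> tgt a = i \<Longrightarrow> div_arrow a f \<in> A (src a)"
  by (simp add: Ext_iff)

lemma subspace_Ext:
  assumes "\<And>k. fs.subspace (A k)"
  shows "fs.subspace (Ext A i)"
  using assms by (auto simp: fs.subspace_def Ext_iff div_arrow_lin)

lemma snoc_in_Ext:
  assumes "a \<in> E" "y \<in> A (src a)" "\<And>k. 0 \<in> A k"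
  shows "snoc_arrow a y \<in> Ext A (tgt a)"
  using assms by (auto simp: Ext_iff div_snoc_arrow)

lemma Ext_mono: "(\<And>k. A k \<subseteq> B k) \<Longrightarrow> Ext A i \<subseteq> Ext B i"
  unfolding Ext_iff[abs_def] subset_iff Ball_def by blast

lemma Ext_sum:
  assumes "f \<in> Ext A i"
  shows "f = (\<Sum>a | a \<in> E \<and> tgt a = i. snoc_arrow a (div_arrow a f))"
proof (rule list_fun_eqI)
  show "f [] = (\<Sum>a | a \<in> E \<and> tgt a = i. snoc_arrow a (div_arrow a f)) []"
    using assms by (simp add: Ext_iff sum_fun_apply)
  fix b
  have "div_arrow b (\<Sum>a | a \<in> E \<and> tgt a = i. snoc_arrow a (div_arrow a f))
      = (\<Sum>a | a \<in> E \<and> tgt a = i. if a = b then div_arrow b f else 0)"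
    unfolding div_arrow_lin(5) by (intro sum.cong) (auto simp: div_snoc_arrow)
  also have "\<dots> = div_arrow b f"
    using assms by (auto simp: sum.delta Ext_iff)
  finally show "div_arrow b f = div_arrow b (\<Sum>a | a \<in> E \<and> tgt a = i. snoc_arrow a (div_arrow a f))"
    by simp
qed

lemma subspace_P: "fs.subspace (P j n i)"
  by (auto simp: fs.subspace_def P_def) (metis add.right_neutral)+

lemma subspace_F: "fs.subspace (F j n i)"
  by (auto simp: fs.subspace_def F_def) (metis add.right_neutral)+

lemma P_0: "P j 0 i = (if i = j then range (\<lambda>b. fscale b (\<lambda>p. if p = [] then 1 else 0)) else {0})"
proof (cases "i = j")
  case True
  have "f \<in> range (\<lambda>b. fscale b (\<lambda>p. if p = [] then 1 else 0))" if "f \<in> P j 0 i" for f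
    using that by (intro image_eqI[of _ _ "f []"]) (auto simp: P_def fun_eq_iff)
  then show ?thesis using True by (auto simp: P_def split: if_splits)
next
  case False
  then show ?thesis by (auto simp: P_def fun_eq_iff) (metis walk.simps(1))
qed

lemma list_fun_support_iff:
  "(\<forall>p. f p \<noteq> 0 \<longrightarrow> Q p) \<longleftrightarrow> (f [] \<noteq> 0 \<longrightarrow> Q []) \<and> (\<forall>a p. f (a # p) \<noteq> 0 \<longrightarrow> Q (a # p))"
  by (metis list.exhaust)

lemma P_Suc: "P j (Suc n) i = Ext (P j n) i"
  unfolding P_def Ext_def list_fun_support_iff[of _ "\<lambda>p. walk j p i \<and> length p = Suc n"]
  by (intro Collect_cong) (auto simp: fun_eq_iff)

text \<open>No product with an arrow yields the trivial walk. It belongs to degree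
  \<open>Suc n\<close> when this degree is even, where it stands for a power of z; hence
  \<open>odd n\<close>.\<close>

lemma F_Suc: "f \<in> F j (Suc n) i \<longleftrightarrow> f - fscale (f []) (\<lambda>p. if p = [] then 1 else 0) \<in> Ext (F j n) i
    \<and> (f [] \<noteq> 0 \<longrightarrow> i = j \<and> odd n)"
  unfolding F_def Ext_def mem_Collect_eq
    list_fun_support_iff[of _ "\<lambda>p. walk j p i \<and> length p \<le> Suc n \<and> even (Suc n + length p)"]
  by (auto simp: fun_eq_iff)

lemma subspace_J: "fs.subspace (J j n i)"
proof (induction n arbitrary: i rule: induct_nat_012)
  case (ge2 n)
  have E: "fs.subspace (Ext (J j (Suc n)) k)" for k by (rule subspace_Ext) (rule ge2)
  show ?case
  proof (rule fsubspaceI)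
    show "0 \<in> J j (Suc (Suc n)) i"
      using fs.subspace_0[OF E] fs.subspace_0[OF subspace_P]
      by (auto simp: J_Suc_Suc mesh_lin(3) intro!: bexI[of _ 0])
  next
    fix f g assume "f \<in> J j (Suc (Suc n)) i" "g \<in> J j (Suc (Suc n)) i"
    then obtain y z where y: "y \<in> P j n i" "f - mesh i y \<in> Ext (J j (Suc n)) i"
      and z: "z \<in> P j n i" "g - mesh i z \<in> Ext (J j (Suc n)) i" by (auto simp: J_Suc_Suc)
    have "(f - mesh i y) + (g - mesh i z) = (f + g) - mesh i (y + z)"
      by (simp add: mesh_lin)
    with fs.subspace_add[OF E y(2) z(2)] fs.subspace_add[OF subspace_P y(1) z(1)]
    show "f + g \<in> J j (Suc (Suc n)) i"
      unfolding J_Suc_Suc by (intro CollectI bexI[of _ "y + z"]) (simp_all only:)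
  next
    fix b f assume "f \<in> J j (Suc (Suc n)) i"
    then obtain y where y: "y \<in> P j n i" "f - mesh i y \<in> Ext (J j (Suc n)) i"
      by (auto simp: J_Suc_Suc)
    have "fscale b (f - mesh i y) = fscale b f - mesh i (fscale b y)"
      by (simp add: mesh_lin fs.scale_right_diff_distrib)
    with fs.subspace_scale[OF E y(2), of b] fs.subspace_scale[OF subspace_P y(1), of b]
    show "fscale b f \<in> J j (Suc (Suc n)) i"
      unfolding J_Suc_Suc by (intro CollectI bexI[of _ "fscale b y"]) (simp_all only:)
  qed
qed simp_all

lemma subspace_I: "fs.subspace (I j n i)"
proof (induction n arbitrary: i rule: induct_nat_012)
  case (ge2 n)
  have E: "fs.subspace (Ext (I j (Suc n)) k)" for k by (rule subspace_Ext) (rule ge2)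
  show ?case
  proof (rule fsubspaceI)
    show "0 \<in> I j (Suc (Suc n)) i"
      using fs.subspace_0[OF E] fs.subspace_0[OF subspace_F]
      by (auto simp: I_Suc_Suc mesh_lin(3) intro!: bexI[of _ 0])
  next
    fix f g assume "f \<in> I j (Suc (Suc n)) i" "g \<in> I j (Suc (Suc n)) i"
    then obtain y z where
      y: "y \<in> F j n i" "f - (mesh i y - fscale (c i) y) \<in> Ext (I j (Suc n)) i" and
      z: "z \<in> F j n i" "g - (mesh i z - fscale (c i) z) \<in> Ext (I j (Suc n)) i"
      by (auto simp: I_Suc_Suc)
    have "(f - (mesh i y - fscale (c i) y)) + (g - (mesh i z - fscale (c i) z))
        = (f + g) - (mesh i (y + z) - fscale (c i) (y + z))"
      by (simp add: mesh_lin fs.scale_right_distrib)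
    with fs.subspace_add[OF E y(2) z(2)] fs.subspace_add[OF subspace_F y(1) z(1)]
    show "f + g \<in> I j (Suc (Suc n)) i"
      unfolding I_Suc_Suc by (intro CollectI bexI[of _ "y + z"]) (simp_all only:)
  next
    fix b f assume "f \<in> I j (Suc (Suc n)) i"
    then obtain y where y: "y \<in> F j n i" "f - (mesh i y - fscale (c i) y) \<in> Ext (I j (Suc n)) i"
      by (auto simp: I_Suc_Suc)
    have "fscale b (f - (mesh i y - fscale (c i) y))
        = fscale b f - (mesh i (fscale b y) - fscale (c i) (fscale b y))"
      by (simp add: mesh_lin fs.scale_right_diff_distrib fs.scale_left_commute)
    with fs.subspace_scale[OF E y(2), of b] fs.subspace_scale[OF subspace_F y(1), of b]
    show "fscale b f \<in> I j (Suc (Suc n)) i"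
      unfolding I_Suc_Suc by (intro CollectI bexI[of _ "fscale b y"]) (simp_all only:)
  qed
qed simp_all

lemmas zero_P = fs.subspace_0[OF subspace_P] and zero_F = fs.subspace_0[OF subspace_F]
  and zero_J = fs.subspace_0[OF subspace_J] and zero_I = fs.subspace_0[OF subspace_I]

lemma snoc_P: "a \<in> E \<Longrightarrow> y \<in> P j n (src a) \<Longrightarrow> snoc_arrow a y \<in> P j (Suc n) (tgt a)"
  unfolding P_Suc by (rule snoc_in_Ext) (simp_all add: zero_P)

lemma Ext_F_subset: "Ext (F j n) i \<subseteq> F j (Suc n) i"
  by (auto simp: F_Suc Ext_iff)

lemma F_Suc_Nil: "f \<in> F j (Suc n) i \<Longrightarrow> f [] = 0 \<Longrightarrow> f \<in> Ext (F j n) i"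
  by (simp add: F_Suc)

lemma snoc_F: "a \<in> E \<Longrightarrow> y \<in> F j n (src a) \<Longrightarrow> snoc_arrow a y \<in> F j (Suc n) (tgt a)"
  using snoc_in_Ext[of a y "F j n"] Ext_F_subset zero_F by blast

lemma snoc_J:
  assumes "a \<in> E" "y \<in> J j n (src a)"
  shows "snoc_arrow a y \<in> J j (Suc n) (tgt a)"
proof (cases n)
  case 0
  then show ?thesis using assms by (simp add: snoc_arrow_lin)
next
  case (Suc m)
  then show ?thesis using snoc_in_Ext[of a y "J j n", OF assms zero_J] zero_P
    by (auto simp: J_Suc_Suc mesh_lin intro!: bexI[of _ 0])
qed

lemma snoc_I:
  assumes "a \<in> E" "y \<in> I j n (src a)"
  shows "snoc_arrow a y \<in> I j (Suc n) (tgt a)"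
proof (cases n)
  case 0
  then show ?thesis using assms by (simp add: snoc_arrow_lin)
next
  case (Suc m)
  then show ?thesis using snoc_in_Ext[of a y "I j n", OF assms zero_I] zero_F
    by (auto simp: I_Suc_Suc mesh_lin intro!: bexI[of _ 0])
qed

text \<open>The arrow \<open>opp e\<close> ends just one summand of the mesh relation, the one
  starting with \<open>e\<close>. Taking off last arrows therefore separates the products of
  \<open>y\<close> with the individual arrows.\<close>

lemma mesh_in_Ext_iff:
  assumes "\<And>k. fs.subspace (A k)"
  shows "mesh i y \<in> Ext A i \<longleftrightarrow> (\<forall>e\<in>E. src e = i \<longrightarrow> snoc_arrow e y \<in> A (tgt e))"
proof -
  have "mesh i y \<in> Ext A i \<longleftrightarrow>
      (\<forall>a\<in>E. tgt a = i \<longrightarrow> fscale (sg (opp a)) (snoc_arrow (opp a) y) \<in> A (src a))"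
    by (auto simp: Ext_iff div_mesh)
  also have "\<dots> \<longleftrightarrow> (\<forall>a\<in>E. tgt a = i \<longrightarrow> snoc_arrow (opp a) y \<in> A (src a))"
  proof -
    have "fscale s f \<in> A k \<longleftrightarrow> f \<in> A k" if "s \<noteq> 0" for s f k
      using fs.subspace_scale[OF assms, of f k s]
        fs.subspace_scale[OF assms, of "fscale s f" k "inverse s"] that
      by (auto simp: fs.scale_scale)
    then show ?thesis using sg_nz by simp
  qed
  also have "\<dots> \<longleftrightarrow> (\<forall>e\<in>E. src e = i \<longrightarrow> snoc_arrow e y \<in> A (tgt e))"
    by (metis opp_in opp_opp src_opp tgt_opp)
  finally show ?thesis .
qed

lemma mesh_P: "y \<in> P j n i \<Longrightarrow> mesh i y \<in> P j (Suc (Suc n)) i"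
  unfolding P_Suc[of _ "Suc n"] by (subst mesh_in_Ext_iff) (auto simp: subspace_P snoc_P)

lemma mesh_F: "y \<in> F j n i \<Longrightarrow> mesh i y \<in> F j (Suc (Suc n)) i"
  by (rule subsetD[OF Ext_F_subset], subst mesh_in_Ext_iff) (auto simp: subspace_F snoc_F)

lemma mesh_in_J: "y \<in> P j n i \<Longrightarrow> mesh i y \<in> J j (Suc (Suc n)) i"
  using fs.subspace_0[OF subspace_Ext[of "J j (Suc n)", OF subspace_J]]
  by (auto simp: J_Suc_Suc intro!: bexI[of _ y])

lemma J_subset_P: "J j n i \<subseteq> P j n i"
proof (induction n arbitrary: i rule: induct_nat_012)
  case (ge2 n)
  show ?case
  proof
    fix f assume "f \<in> J j (Suc (Suc n)) i"
    then obtain y where y: "y \<in> P j n i" "f - mesh i y \<in> Ext (J j (Suc n)) i"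
      by (auto simp: J_Suc_Suc)
    then have "f - mesh i y \<in> P j (Suc (Suc n)) i"
      using Ext_mono[of "J j (Suc n)", OF ge2(2)] by (auto simp: P_Suc[of _ "Suc n"])
    from fs.subspace_add[OF subspace_P this mesh_P[OF y(1)]]
    show "f \<in> P j (Suc (Suc n)) i" by simp
  qed
qed (simp_all add: zero_P)

lemma F_Suc_Suc: "F j n i \<subseteq> F j (Suc (Suc n)) i"
  by (auto simp: F_def)

lemma I_subset_F: "I j n i \<subseteq> F j n i"
proof (induction n arbitrary: i rule: induct_nat_012)
  case (ge2 n)
  show ?case
  proof
    fix f assume "f \<in> I j (Suc (Suc n)) i"
    then obtain y where y: "y \<in> F j n i" "f - (mesh i y - fscale (c i) y) \<in> Ext (I j (Suc n)) i"
      by (auto simp: I_Suc_Suc)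
    then have *: "f - (mesh i y - fscale (c i) y) \<in> F j (Suc (Suc n)) i"
      using Ext_mono[of "I j (Suc n)", OF ge2(2)] Ext_F_subset by blast
    have "mesh i y - fscale (c i) y \<in> F j (Suc (Suc n)) i"
      using fs.subspace_diff[OF subspace_F mesh_F[OF y(1)]] fs.subspace_scale[OF subspace_F] y(1)
        F_Suc_Suc by blast
    from fs.subspace_add[OF subspace_F * this]
    show "f \<in> F j (Suc (Suc n)) i" by simp
  qed
qed (simp_all add: zero_F)

definition walks :: "'v \<Rightarrow> nat \<Rightarrow> 'v \<Rightarrow> 'e list set" where
  "walks j n i = {p. walk j p i \<and> length p = n}"

lemma walk_arrows: "walk j p i \<Longrightarrow> set p \<subseteq> E"
  by (induction p arbitrary: i) auto

lemma finite_walks: "finite (walks j n i)"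
  by (rule finite_subset[OF _ finite_lists_length_eq[OF finite_E, of n]])
    (auto simp: walks_def dest: walk_arrows)

lemma walk_decomposition:
  fixes f :: "'e list \<Rightarrow> 'k"
  assumes "finite W" "\<And>p. f p \<noteq> 0 \<Longrightarrow> p \<in> W"
  shows "f = (\<Sum>w\<in>W. fscale (f w) (\<lambda>p. if p = w then 1 else 0))"
  using assms by (auto simp: fun_eq_iff sum_fun_apply if_distrib sum.delta cong: if_cong)

lemma fin_dim_F: "fs.fin_dim (F j n i)"
  unfolding fs.fin_dim_def
proof (intro exI conjI)
  let ?W = "\<Union>m\<le>n. walks j m i"
  let ?B = "(\<lambda>w p. if p = w then 1 else 0 :: 'k) ` ?W"
  have W: "finite ?W" using finite_walks by simp
  then show "finite ?B" by simp
  show "F j n i \<subseteq> fs.span ?B"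
  proof
    fix f assume "f \<in> F j n i"
    then have f: "f = (\<Sum>w\<in>?W. fscale (f w) (\<lambda>p. if p = w then 1 else 0))"
      by (intro walk_decomposition W) (auto simp: F_def walks_def)
    show "f \<in> fs.span ?B"
      by (subst f, intro fs.span_sum fs.span_scale fs.span_base) auto
  qed
qed

lemma P_subset_F: "P j n i \<subseteq> F j n i"
  by (auto simp: P_def F_def)

lemma fin_dim_P: "fs.fin_dim (P j n i)" and fin_dim_I: "fs.fin_dim (I j n i)"
  and fin_dim_J: "fs.fin_dim (J j n i)"
  using fin_dim_F P_subset_F J_subset_P I_subset_F fs.fin_dim_subset by (meson subset_trans)+

end

lemma fscale_eta [simp]: "(\<lambda>a f p. a * f p) = fscale"
  by (simp add: fun_eq_iff)

section \<open>Descent of endomorphisms and the right socle\<close>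

context mesh_quiver
begin

lemma opp_eq_iff: "opp a = opp b \<longleftrightarrow> a = b"
  by (metis opp_opp)

text \<open>Degree \<open>n\<close> of e_j Lambda contains no nonzero element killed by all arrows.
  By \<open>mesh_in_Ext_iff\<close> this is the injectivity of the left map of the complex in this
  degree.\<close>

definition socle_free :: "'v \<Rightarrow> nat \<Rightarrow> bool" where
  "socle_free j n \<longleftrightarrow> (\<forall>i. \<forall>y\<in>P j n i.
     (\<forall>a\<in>E. src a = i \<longrightarrow> snoc_arrow a y \<in> J j (Suc n) (tgt a)) \<longrightarrow> y \<in> J j n i)"

text \<open>Maps of the quotients are represented by maps of walks that preserve \<open>J\<close>.
  Exactness in the middle is built into the definition of \<open>J\<close> and yields
  \<open>S\<close> on representatives; \<open>socle_free\<close> makes \<open>S\<close> preserve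
  \<open>J\<close>.\<close>

lemma endomorphism_descends:
  fixes T T' :: "'v \<Rightarrow> ('e list \<Rightarrow> 'k) \<Rightarrow> 'e list \<Rightarrow> 'k"
  assumes "socle_free j n"
    and T: "\<And>k. flinear (T k)" "\<And>k f. f \<in> P j (Suc n) k \<Longrightarrow> T k f \<in> P j (Suc n) k"
      "\<And>k f. f \<in> J j (Suc n) k \<Longrightarrow> T k f \<in> J j (Suc n) k"
    and T': "\<And>k. flinear (T' k)"
      "\<And>k f. f \<in> J j (Suc (Suc n)) k \<Longrightarrow> T' k f \<in> J j (Suc (Suc n)) k"
    and comm: "\<And>a y. a \<in> E \<Longrightarrow> y \<in> P j (Suc n) (src a) \<Longrightarrow>
      T' (tgt a) (snoc_arrow a y) - snoc_arrow a (T (src a) y) \<in> J j (Suc (Suc n)) (tgt a)"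
  shows "\<exists>S. (\<forall>k. flinear (S k)) \<and> (\<forall>k. \<forall>f\<in>P j n k. S k f \<in> P j n k)
     \<and> (\<forall>k. \<forall>f\<in>J j n k. S k f \<in> J j n k)
     \<and> (\<forall>a\<in>E. \<forall>y\<in>P j n (src a).
          T (tgt a) (snoc_arrow a y) - snoc_arrow a (S (src a) y) \<in> J j (Suc n) (tgt a))"
proof -
  have ex: "\<exists>y\<in>P j n k. \<forall>a\<in>E. src a = k \<longrightarrow>
      T (tgt a) (snoc_arrow a f) - snoc_arrow a y \<in> J j (Suc n) (tgt a)"
    if f: "f \<in> P j n k" for k f
  proof -
    \<comment> \<open>This is f times the mesh relation, with \<open>T\<close> applied after the
      first arrow. Modulo \<open>J\<close> it equals \<open>T'\<close> of an element of
      \<open>J\<close>, so it lies in \<open>J\<close>; unfolding \<open>J\<close> produces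
      \<open>y\<close>, and comparing last arrows gives T(f a) = y a modulo
      \<open>J\<close>.\<close>
    let ?X = "\<Sum>e | e \<in> E \<and> src e = k. fscale (sg e) (snoc_arrow (opp e) (T (tgt e) (snoc_arrow e f)))"
    have "T' k (mesh k f) - ?X = (\<Sum>e | e \<in> E \<and> src e = k. fscale (sg e)
        (T' k (snoc_arrow (opp e) (snoc_arrow e f)) - snoc_arrow (opp e) (T (tgt e) (snoc_arrow e f))))"
      by (simp add: mesh_def flinearD[OF T'(1)] sum_subtractf fs.scale_right_diff_distrib)
    also have "\<dots> \<in> J j (Suc (Suc n)) k"
    proof (intro fs.subspace_sum[OF subspace_J] fs.subspace_scale[OF subspace_J])
      fix e assume e: "e \<in> {e. e \<in> E \<and> src e = k}"
      then have "snoc_arrow e f \<in> P j (Suc n) (src (opp e))" using f snoc_P by simp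
      from comm[OF _ this] e
      show "T' k (snoc_arrow (opp e) (snoc_arrow e f)) - snoc_arrow (opp e) (T (tgt e) (snoc_arrow e f))
          \<in> J j (Suc (Suc n)) k" by simp
    qed
    finally have "T' k (mesh k f) - (T' k (mesh k f) - ?X) \<in> J j (Suc (Suc n)) k"
      using T'(2)[OF mesh_in_J[OF f]] fs.subspace_diff[OF subspace_J] by blast
    then have "?X \<in> J j (Suc (Suc n)) k" by simp
    then obtain y where y: "y \<in> P j n k" "?X - mesh k y \<in> Ext (J j (Suc n)) k"
      by (auto simp: J_Suc_Suc)
    have "T (tgt a) (snoc_arrow a f) - snoc_arrow a y \<in> J j (Suc n) (tgt a)"
      if a: "a \<in> E" "src a = k" for a
    proof -
      have "?X - mesh k y = (\<Sum>e | e \<in> E \<and> src e = k. fscale (sg e)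
          (snoc_arrow (opp e) (T (tgt e) (snoc_arrow e f) - snoc_arrow e y)))"
        by (simp add: mesh_def sum_subtractf fs.scale_right_diff_distrib snoc_arrow_lin)
      then have "div_arrow (opp a) (?X - mesh k y) = (\<Sum>e | e \<in> E \<and> src e = k.
          div_arrow (opp a) (fscale (sg e)
            (snoc_arrow (opp e) (T (tgt e) (snoc_arrow e f) - snoc_arrow e y))))"
        by (simp only: div_arrow_lin(5))
      also have "\<dots> = (\<Sum>e | e \<in> E \<and> src e = k.
          if e = a then fscale (sg e) (T (tgt e) (snoc_arrow e f) - snoc_arrow e y) else 0)"
        by (intro sum.cong refl) (auto simp: div_arrow_lin(2) div_snoc_arrow opp_eq_iff)
      also have "\<dots> = fscale (sg a) (T (tgt a) (snoc_arrow a f) - snoc_arrow a y)"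
        using a by (simp add: sum.delta)
      finally have "fscale (sg a) (T (tgt a) (snoc_arrow a f) - snoc_arrow a y) \<in> J j (Suc n) (tgt a)"
        using ExtD[OF y(2), of "opp a"] a by simp
      from fs.subspace_scale[OF subspace_J this, of "inverse (sg a)"] show ?thesis
        using sg_nz by (simp add: fs.scale_scale)
    qed
    with y(1) show ?thesis by blast
  qed
  define Q where "Q k f y \<longleftrightarrow> y \<in> P j n k \<and> (\<forall>a\<in>E. src a = k \<longrightarrow>
      T (tgt a) (snoc_arrow a f) - snoc_arrow a y \<in> J j (Suc n) (tgt a))" for k f y
  define g where "g k f = (SOME y. Q k f y)" for k f
  have "Q k f (g k f)" if "f \<in> P j n k" for k f
    unfolding g_def using ex[OF that] by (intro someI_ex[of "Q k f"]) (auto simp: Q_def)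
  then have g: "\<And>k f. f \<in> P j n k \<Longrightarrow> g k f \<in> P j n k"
    "\<And>k f a. f \<in> P j n k \<Longrightarrow> a \<in> E \<Longrightarrow> src a = k \<Longrightarrow>
      T (tgt a) (snoc_arrow a f) - snoc_arrow a (g k f) \<in> J j (Suc n) (tgt a)"
    unfolding Q_def by blast+
  \<comment> \<open>The chosen \<open>y\<close> need not depend linearly on \<open>f\<close>, so the
    choice is kept on the basis of walks only and extended linearly.\<close>
  define \<delta> :: "'e list \<Rightarrow> 'e list \<Rightarrow> 'k" where "\<delta> w = (\<lambda>p. if p = w then 1 else 0)" for w
  define S where "S k f = (\<Sum>w\<in>walks j n k. fscale (f w) (g k (\<delta> w)))" for k f
  have \<delta>: "\<delta> w \<in> P j n k" if "w \<in> walks j n k" for w k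
    using that by (auto simp: \<delta>_def P_def walks_def)
  have S1: "flinear (S k)" for k
    by (rule flinearI)
      (simp_all add: S_def fs.scale_left_distrib sum.distrib fs.scale_sum_right fs.scale_scale)
  have S2: "S k f \<in> P j n k" for k f
    unfolding S_def by (intro fs.subspace_sum[OF subspace_P] fs.subspace_scale[OF subspace_P] g(1) \<delta>)
  have S3: "T (tgt a) (snoc_arrow a y) - snoc_arrow a (S (src a) y) \<in> J j (Suc n) (tgt a)"
    if "a \<in> E" "y \<in> P j n (src a)" for a y
  proof -
    let ?W = "walks j n (src a)"
    have y: "y = (\<Sum>w\<in>?W. fscale (y w) (\<delta> w))"
      unfolding \<delta>_def using that(2)
      by (intro walk_decomposition finite_walks) (auto simp: P_def walks_def)
    have "T (tgt a) (snoc_arrow a y) = (\<Sum>w\<in>?W. fscale (y w) (T (tgt a) (snoc_arrow a (\<delta> w))))"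
      by (subst y) (simp add: snoc_arrow_lin flinearD[OF T(1)])
    moreover have "snoc_arrow a (S (src a) y) = (\<Sum>w\<in>?W. fscale (y w) (snoc_arrow a (g (src a) (\<delta> w))))"
      by (simp add: S_def snoc_arrow_lin)
    ultimately have "T (tgt a) (snoc_arrow a y) - snoc_arrow a (S (src a) y) =
        (\<Sum>w\<in>?W. fscale (y w) (T (tgt a) (snoc_arrow a (\<delta> w)) - snoc_arrow a (g (src a) (\<delta> w))))"
      by (simp add: sum_subtractf fs.scale_right_diff_distrib)
    then show ?thesis using g(2) \<delta> that(1)
      by (simp only:) (intro fs.subspace_sum[OF subspace_J] fs.subspace_scale[OF subspace_J], blast)
  qed
  \<comment> \<open>Here \<open>socle_free\<close> enters: if f is in \<open>J\<close>, all products
    of \<open>S k f\<close> with arrows agree modulo \<open>J\<close> with images of elements of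
    \<open>J\<close>.\<close>
  have S4: "S k f \<in> J j n k" if f: "f \<in> J j n k" for k f
  proof -
    have "snoc_arrow a (S k f) \<in> J j (Suc n) (tgt a)" if a: "a \<in> E" "src a = k" for a
    proof -
      have "T (tgt a) (snoc_arrow a f) \<in> J j (Suc n) (tgt a)"
        using T(3) snoc_J a f by blast
      from fs.subspace_diff[OF subspace_J this S3[OF a(1), of f]] f a(2) J_subset_P
      show ?thesis by auto
    qed
    with assms(1) S2 show ?thesis unfolding socle_free_def by blast
  qed
  show ?thesis using S1 S2 S3 S4 by blast
qed

text \<open>An endomorphism of two consecutive components descends to degree zero.\<close>

lemma endomorphism_scalar:
  fixes T T' :: "'v \<Rightarrow> ('e list \<Rightarrow> 'k) \<Rightarrow> 'e list \<Rightarrow> 'k"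
  assumes "\<And>m. m < n \<Longrightarrow> socle_free j m"
    and "\<And>k. flinear (T k)" "\<And>k f. f \<in> P j n k \<Longrightarrow> T k f \<in> P j n k"
      "\<And>k f. f \<in> J j n k \<Longrightarrow> T k f \<in> J j n k"
    and "\<And>k. flinear (T' k)"
      "\<And>k f. f \<in> J j (Suc n) k \<Longrightarrow> T' k f \<in> J j (Suc n) k"
    and "\<And>a y. a \<in> E \<Longrightarrow> y \<in> P j n (src a) \<Longrightarrow>
      T' (tgt a) (snoc_arrow a y) - snoc_arrow a (T (src a) y) \<in> J j (Suc n) (tgt a)"
  shows "\<exists>b. \<forall>k. \<forall>f\<in>P j n k. T k f - fscale b f \<in> J j n k"
  using assms
proof (induction n arbitrary: T T')
  case 0
  let ?d = "\<lambda>p :: 'e list. if p = [] then 1 else 0 :: 'k"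
  have "?d \<in> P j 0 j" by (auto simp: P_def)
  then have "T j ?d \<in> P j 0 j" using 0(3) by blast
  then obtain b where b: "T j ?d = fscale b ?d" unfolding P_0 by auto
  have "T k f - fscale b f \<in> J j 0 k" if f: "f \<in> P j 0 k" for k f
  proof (cases "k = j")
    case True
    then obtain s where "f = fscale s ?d" using f unfolding P_0 by auto
    then show ?thesis using True b
      by (simp add: flinearD[OF 0(2)]) (simp add: fun_eq_iff mult.left_commute)
  next
    case False
    then have "f = 0" using f by (simp add: P_0)
    then show ?thesis by (simp add: flinearD[OF 0(2)])
  qed
  then show ?case by blast
next
  case (Suc n)
  have "socle_free j n" using Suc.prems(1) by simp
  from endomorphism_descends[OF this Suc.prems(2-7)]
  obtain S where S: "\<And>k. flinear (S k)" "\<And>k f. f \<in> P j n k \<Longrightarrow> S k f \<in> P j n k"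
    "\<And>k f. f \<in> J j n k \<Longrightarrow> S k f \<in> J j n k"
    "\<And>a y. a \<in> E \<Longrightarrow> y \<in> P j n (src a) \<Longrightarrow>
          T (tgt a) (snoc_arrow a y) - snoc_arrow a (S (src a) y) \<in> J j (Suc n) (tgt a)"
    by blast
  \<comment> \<open>The pair \<open>S\<close>, \<open>T\<close> in degrees n and n + 1 replaces
    \<open>T\<close>, \<open>T'\<close> in degrees n + 1 and n + 2. The scalar found for
    \<open>S\<close> also serves for \<open>T\<close>, since products with an arrow span degree n +
    1.\<close>
  have "\<exists>b. \<forall>k. \<forall>f\<in>P j n k. S k f - fscale b f \<in> J j n k"
  proof (rule Suc.IH[of S T])
    show "socle_free j m" if "m < n" for m using Suc.prems(1) that by simp
  qed (fact S Suc.prems)+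
  then obtain b where b: "\<And>k f. f \<in> P j n k \<Longrightarrow> S k f - fscale b f \<in> J j n k" by blast
  have gen: "T (tgt a) (snoc_arrow a y) - fscale b (snoc_arrow a y) \<in> J j (Suc n) (tgt a)"
    if "a \<in> E" "y \<in> P j n (src a)" for a y
  proof -
    have "snoc_arrow a (S (src a) y - fscale b y) \<in> J j (Suc n) (tgt a)"
      using snoc_J[OF that(1) b[OF that(2)]] .
    from fs.subspace_add[OF subspace_J S(4)[OF that] this] show ?thesis
      by (simp add: snoc_arrow_lin)
  qed
  have "T k f - fscale b f \<in> J j (Suc n) k" if f: "f \<in> P j (Suc n) k" for k f
  proof -
    have f': "f \<in> Ext (P j n) k" using f by (simp add: P_Suc)
    let ?A = "{a. a \<in> E \<and> tgt a = k}"
    have eq: "f = (\<Sum>a\<in>?A. snoc_arrow a (div_arrow a f))" using Ext_sum[OF f'] by simp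
    have "T k f - fscale b f = (\<Sum>a\<in>?A. T k (snoc_arrow a (div_arrow a f))
        - fscale b (snoc_arrow a (div_arrow a f)))"
      by (subst (1 2) eq) (simp add: flinearD[OF Suc.prems(2)] sum_subtractf fs.scale_sum_right)
    also have "\<dots> \<in> J j (Suc n) k"
      using gen ExtD[OF f'] by (intro fs.subspace_sum[OF subspace_J]) auto
    finally show ?thesis .
  qed
  then show ?case by blast
qed

text \<open>A socle element \<open>x\<close> gives the rank one endomorphism \<open>\<phi>(_) x\<close>, which has to be a scalar.\<close>

lemma socle_imp_generated_in_lower_degrees:
  assumes "\<And>m. m < n \<Longrightarrow> socle_free j m"
    and x: "x \<in> P j n i" "x \<notin> J j n i"
      "\<And>a. a \<in> E \<Longrightarrow> src a = i \<Longrightarrow> snoc_arrow a x \<in> J j (Suc n) (tgt a)"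
  shows "P j (Suc n) k = J j (Suc n) k"
proof -
  obtain \<phi> where \<phi>: "Vector_Spaces.linear fscale (*) \<phi>" "\<phi> x = 1" "\<forall>y\<in>J j n i. \<phi> y = 0"
    using fs.exists_functional[OF subspace_J x(2)] by blast
  have hom: "module_hom fscale (*) \<phi>" using \<phi>(1) by (simp add: Vector_Spaces.linear_def)
  define T where "T k f = (if k = i then fscale (\<phi> f) x else 0)" for k f
  \<comment> \<open>The zero map in degree n + 1 is compatible with \<open>T\<close>, because every
    product of \<open>x\<close> with an arrow is zero modulo \<open>J\<close>.\<close>
  have "\<exists>b. \<forall>k. \<forall>f\<in>P j n k. T k f - fscale b f \<in> J j n k"
  proof (rule endomorphism_scalar[where T' = "\<lambda>k f. 0"])
    show "flinear (T k)" for k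
      by (rule flinearI)
        (simp_all add: T_def module_hom.add[OF hom] module_hom.scale[OF hom]
          fs.scale_left_distrib fs.scale_scale)
    show "T k f \<in> P j n k" for k f
      using x(1) fs.subspace_scale[OF subspace_P] zero_P by (simp add: T_def)
    show "T k f \<in> J j n k" if "f \<in> J j n k" for k f
      using that by (cases "k = i") (simp_all add: T_def \<phi>(3)[rule_format] zero_J)
    show "flinear (\<lambda>f. 0 :: 'e list \<Rightarrow> 'k)" by (rule flinearI) simp_all
    show "0 - snoc_arrow a (T (src a) y) \<in> J j (Suc n) (tgt a)" if "a \<in> E" for a y
      using x(3)[OF that] fs.subspace_scale[OF subspace_J] fs.subspace_neg[OF subspace_J] zero_J
      by (simp add: T_def snoc_arrow_lin)
  qed (use assms(1) zero_J in auto)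
  then obtain b where b: "\<And>k f. f \<in> P j n k \<Longrightarrow> T k f - fscale b f \<in> J j n k" by blast
  \<comment> \<open>\<open>T\<close> fixes \<open>x\<close>, which is nonzero modulo
    \<open>J\<close>. So \<open>T\<close> is the identity modulo \<open>J\<close>, while
    \<open>T y\<close> times an arrow always lies in \<open>J\<close>.\<close>
  have "b = 1"
  proof (rule ccontr)
    assume "b \<noteq> 1"
    have "T i x - fscale b x = fscale (1 - b) x"
      by (simp add: T_def \<phi>(2) fs.scale_left_diff_distrib)
    then have "fscale (1 - b) x \<in> J j n i" using b[OF x(1)] by simp
    from fs.subspace_scale[OF subspace_J this, of "inverse (1 - b)"] show False
      using x(2) \<open>b \<noteq> 1\<close> by (simp add: fs.scale_scale)
  qed
  have gen: "snoc_arrow a y \<in> J j (Suc n) (tgt a)" if "a \<in> E" "y \<in> P j n (src a)" for a y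
  proof -
    have "snoc_arrow a (T (src a) y - y) \<in> J j (Suc n) (tgt a)"
      using snoc_J[OF that(1) b[OF that(2)]] \<open>b = 1\<close> by simp
    moreover have "snoc_arrow a (T (src a) y) \<in> J j (Suc n) (tgt a)"
      using x(3)[OF that(1)] fs.subspace_scale[OF subspace_J] zero_J
      by (simp add: T_def snoc_arrow_lin)
    ultimately have "snoc_arrow a (T (src a) y) - snoc_arrow a (T (src a) y - y) \<in> J j (Suc n) (tgt a)"
      using fs.subspace_diff[OF subspace_J] by blast
    then show ?thesis by (simp add: snoc_arrow_lin)
  qed
  have "f \<in> J j (Suc n) k" if "f \<in> P j (Suc n) k" for f
  proof -
    have f': "f \<in> Ext (P j n) k" using that by (simp add: P_Suc)
    show ?thesis
      by (subst Ext_sum[OF f'], intro fs.subspace_sum[OF subspace_J])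
        (use gen ExtD[OF f'] in auto)
  qed
  then show ?thesis using J_subset_P by blast
qed

section \<open>The Hilbert function of the preprojective algebra\<close>

lemma dim_zero: "fs.dim ({0} :: ('e list \<Rightarrow> 'k) set) = 0"
  by (rule fs.dim_unique[of "{}"]) (simp_all add: fs.independent_empty)

text \<open>Taking off the last arrow identifies \<open>Ext A i\<close> with the direct sum of the
  spaces \<open>A (src a)\<close>; the sum is built up one arrow at a time.\<close>

lemma dim_Ext:
  assumes sub: "\<And>k. fs.subspace (A k)" and fin: "\<And>k. fs.fin_dim (A k)" "fs.fin_dim (Ext A i)"
  shows "fs.dim (Ext A i) = (\<Sum>a | a \<in> E \<and> tgt a = i. fs.dim (A (src a)))"
proof -
  define X where "X S = {f. f [] = 0 \<and> (\<forall>a. div_arrow a f \<in> (if a \<in> S then A (src a) else {0}))}" for S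
  have X_mono: "X S \<subseteq> X S'" if "S \<subseteq> S'" for S S'
    using that fs.subspace_0[OF sub] by (auto simp: X_def) metis
  have X_sub: "fs.subspace (X S)" for S
    using sub by (auto simp: fs.subspace_def X_def div_arrow_lin)
  have Ext: "Ext A i = X {a. a \<in> E \<and> tgt a = i}"
    unfolding X_def Ext_def mem_Collect_eq by (rule refl)
  have "fs.dim (X S) = (\<Sum>a\<in>S. fs.dim (A (src a)))" if "finite S" "S \<subseteq> {a. a \<in> E \<and> tgt a = i}" for S
    using that
  proof (induction S)
    case empty
    have "f = 0" if "f \<in> X {}" for f
      using that by (rule_tac list_fun_eqI) (simp_all add: X_def div_arrow_lin)
    moreover have "0 \<in> X {}" by (simp add: X_def div_arrow_lin)
    ultimately have X0: "X {} = {0}" by blast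
    show ?case unfolding X0 dim_zero by simp
  next
    case (insert a S)
    have X: "X (insert a S) = {f + snoc_arrow a y |f y. f \<in> X S \<and> y \<in> A (src a)}"
    proof (intro subset_antisym subsetI)
      fix f assume f: "f \<in> X (insert a S)"
      have "f = (f - snoc_arrow a (div_arrow a f)) + snoc_arrow a (div_arrow a f)" by simp
      moreover have "f - snoc_arrow a (div_arrow a f) \<in> X S"
      proof -
        have *: "div_arrow b f \<in> (if b \<in> insert a S then A (src b) else {0})" for b
          using f unfolding X_def by blast
        have "div_arrow b (f - snoc_arrow a (div_arrow a f)) \<in> (if b \<in> S then A (src b) else {0})" for b
          using *[of b] insert.hyps(2)
          by (cases "b = a") (auto simp: div_arrow_lin div_snoc_arrow split: if_splits)
        then show ?thesis using f by (simp add: X_def)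
      qed
      moreover have "div_arrow a f \<in> A (src a)" using f by (auto simp: X_def split: if_splits)
      ultimately show "f \<in> {f + snoc_arrow a y |f y. f \<in> X S \<and> y \<in> A (src a)}" by blast
    next
      fix g assume "g \<in> {f + snoc_arrow a y |f y. f \<in> X S \<and> y \<in> A (src a)}"
      then obtain f y where g: "g = f + snoc_arrow a y" "f \<in> X S" "y \<in> A (src a)" by blast
      have *: "div_arrow b f \<in> (if b \<in> S then A (src b) else {0})" for b
        using g(2) unfolding X_def by blast
      have "div_arrow b g \<in> (if b \<in> insert a S then A (src b) else {0})" for b
        using *[of b] g(3) insert.hyps(2)
        by (cases "b = a") (auto simp: g(1) div_arrow_lin div_snoc_arrow split: if_splits)
      then show "g \<in> X (insert a S)" using g(1,2) unfolding X_def by simp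
    qed
    have K: "{y \<in> A (src a). snoc_arrow a y \<in> X S} = {0}"
    proof (intro subset_antisym subsetI)
      fix y assume y: "y \<in> {y \<in> A (src a). snoc_arrow a y \<in> X S}"
      then have "div_arrow a (snoc_arrow a y) \<in> (if a \<in> S then A (src a) else {0})"
        unfolding X_def by blast
      then have "div_arrow a (snoc_arrow a y) \<in> {0}" using insert.hyps(2) by simp
      then show "y \<in> {0}" by (simp add: div_snoc_arrow)
    next
      fix y :: "'e list \<Rightarrow> 'k" assume "y \<in> {0}"
      then show "y \<in> {y \<in> A (src a). snoc_arrow a y \<in> X S}"
        using fs.subspace_0[OF sub] fs.subspace_0[OF X_sub] by (simp add: snoc_arrow_lin)
    qed
    have "fs.fin_dim (X S)"
      using fs.fin_dim_subset[OF fin(2)] X_mono[of S] insert.prems unfolding Ext by blast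
    from fs.dim_sum_image[OF flinear_snoc_arrow X_sub this sub fin(1), of a "src a" ]
    have "fs.dim (X (insert a S)) + fs.dim ({0} :: ('e list \<Rightarrow> 'k) set) = fs.dim (X S) + fs.dim (A (src a))"
      unfolding X K .
    then show ?case using insert by (simp add: dim_zero)
  qed
  from this[of "{a. a \<in> E \<and> tgt a = i}"] show ?thesis by (simp add: Ext)
qed

text \<open>The dimension of e_j Lambda_n e_i, as an integer because the recursion
  subtracts.\<close>

definition lam :: "'v \<Rightarrow> nat \<Rightarrow> 'v \<Rightarrow> int" where
  "lam j n i = int (fs.dim (P j n i)) - int (fs.dim (J j n i))"

lemma lam_nonneg: "lam j n i \<ge> 0"
  unfolding lam_def
  using fs.dim_mono_finite[OF fin_dim_P J_subset_P subspace_J subspace_P] by simp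

lemma dim_P_0: "fs.dim (P j 0 i) = (if i = j then 1 else 0)"
proof (cases "i = j")
  case True
  let ?d = "\<lambda>p :: 'e list. if p = [] then 1 else 0 :: 'k"
  have "?d \<noteq> 0" by (auto simp: fun_eq_iff)
  moreover have "P j 0 i = fs.span {?d}" using True by (simp add: P_0 fs.span_singleton)
  ultimately show ?thesis using True fs.dim_span_eq_card_independent[of "{?d}"]
    by (simp add: fs.dependent_single)
next
  case False
  then show ?thesis by (simp add: P_0 dim_zero)
qed

lemma lam_0: "lam j 0 i = (if i = j then 1 else 0)"
  by (simp add: lam_def dim_P_0 dim_zero)

lemma dim_P_Suc: "fs.dim (P j (Suc n) i) = (\<Sum>a | a \<in> E \<and> tgt a = i. fs.dim (P j n (src a)))"
  unfolding P_Suc using fin_dim_P[of j "Suc n" i]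
  by (intro dim_Ext subspace_P fin_dim_P) (simp add: P_Suc)

lemma lam_Suc_0: "lam j (Suc 0) i = (\<Sum>a | a \<in> E \<and> tgt a = i. lam j 0 (src a))"
  by (simp add: lam_def dim_P_Suc dim_zero)

text \<open>In degree n + 2 the ideal is \<open>Ext (J j (Suc n)) i\<close> plus the image of
  \<open>mesh i\<close>. By \<open>socle_free\<close>, the elements that \<open>mesh i\<close> sends
  into the first summand are those of \<open>J j n i\<close>, so \<open>dim_sum_image\<close> counts
  the overlap.\<close>

lemma lam_Suc_Suc:
  assumes "socle_free j n"
  shows "lam j (Suc (Suc n)) i = (\<Sum>a | a \<in> E \<and> tgt a = i. lam j (Suc n) (src a)) - lam j n i"
proof -
  have sub: "fs.subspace (Ext (J j (Suc n)) i)" by (intro subspace_Ext subspace_J)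
  have fin: "fs.fin_dim (Ext (J j (Suc n)) i)"
    by (rule fs.fin_dim_subset[OF fin_dim_P[of j "Suc (Suc n)" i]])
      (unfold P_Suc[of j "Suc n"], intro Ext_mono J_subset_P)
  have J: "J j (Suc (Suc n)) i = {f + mesh i y |f y. f \<in> Ext (J j (Suc n)) i \<and> y \<in> P j n i}"
  proof (intro subset_antisym subsetI)
    fix f assume "f \<in> J j (Suc (Suc n)) i"
    then obtain y where y: "y \<in> P j n i" "f - mesh i y \<in> Ext (J j (Suc n)) i"
      by (auto simp: J_Suc_Suc)
    have "f = (f - mesh i y) + mesh i y" by simp
    with y show "f \<in> {f + mesh i y |f y. f \<in> Ext (J j (Suc n)) i \<and> y \<in> P j n i}" by blast
  next
    fix g assume "g \<in> {f + mesh i y |f y. f \<in> Ext (J j (Suc n)) i \<and> y \<in> P j n i}"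
    then obtain f y where "g = f + mesh i y" "f \<in> Ext (J j (Suc n)) i" "y \<in> P j n i" by blast
    then show "g \<in> J j (Suc (Suc n)) i" by (auto simp: J_Suc_Suc intro!: bexI[of _ y])
  qed
  have K: "{y \<in> P j n i. mesh i y \<in> Ext (J j (Suc n)) i} = J j n i"
    using assms subsetD[OF J_subset_P] snoc_J
    by (auto simp: mesh_in_Ext_iff[OF subspace_J] socle_free_def)
  have "fs.dim (J j (Suc (Suc n)) i) + fs.dim (J j n i)
      = (\<Sum>a | a \<in> E \<and> tgt a = i. fs.dim (J j (Suc n) (src a))) + fs.dim (P j n i)"
    using fs.dim_sum_image[OF flinear_mesh[of i] sub fin subspace_P fin_dim_P, of j n i]
    unfolding J[symmetric] K dim_Ext[OF subspace_J fin_dim_J fin] .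
  moreover have "fs.dim (P j (Suc (Suc n)) i) = (\<Sum>a | a \<in> E \<and> tgt a = i. fs.dim (P j (Suc n) (src a)))"
    by (rule dim_P_Suc)
  ultimately show ?thesis
    by (simp add: lam_def sum_subtractf flip: of_nat_sum of_nat_add)
qed

text \<open>The induction hypothesis is used twice: it gives the recursion for the dimensions up to
  degree n + 1, and it makes a socle element in degree n annihilate all of degree n + 1. The
  weighted dimension \<open>S\<close> shows that degree n + 1 is not zero.\<close>

lemma socle_free_if_weights:
  fixes d :: "'v \<Rightarrow> real"
  assumes V: "finite V" "j \<in> V" "src ` E \<subseteq> V" "tgt ` E \<subseteq> V"
    and d: "\<And>k. k \<in> V \<Longrightarrow> d k > 0"
      "\<And>k. k \<in> V \<Longrightarrow> 2 * d k \<le> (\<Sum>a | a \<in> E \<and> src a = k. d (tgt a))"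
  shows "socle_free j n"
proof (induction n rule: less_induct)
  case (less n)
  define S where "S m = (\<Sum>i\<in>V. d i * real_of_int (lam j m i))" for m
  have nonneg: "d k * real_of_int (lam j m k) \<ge> 0" if "k \<in> V" for m k
    using d(1)[OF that] lam_nonneg by simp
  \<comment> \<open>Regroup the arrows by source instead of target; the inequality for
    \<open>d\<close> then applies at each source.\<close>
  have key: "(\<Sum>i\<in>V. d i * real_of_int (\<Sum>a | a \<in> E \<and> tgt a = i. lam j m (src a))) \<ge> 2 * S m" for m
  proof -
    have "(\<Sum>i\<in>V. d i * real_of_int (\<Sum>a | a \<in> E \<and> tgt a = i. lam j m (src a)))
        = (\<Sum>i\<in>V. \<Sum>a | a \<in> E \<and> tgt a = i. d (tgt a) * real_of_int (lam j m (src a)))"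
      by (intro sum.cong refl) (simp add: sum_distrib_left)
    also have "\<dots> = (\<Sum>a\<in>E. d (tgt a) * real_of_int (lam j m (src a)))"
      by (rule sum.group[OF finite_E V(1,4)])
    also have "\<dots> = (\<Sum>k\<in>V. \<Sum>a | a \<in> E \<and> src a = k. d (tgt a) * real_of_int (lam j m (src a)))"
      by (rule sum.group[OF finite_E V(1,3), symmetric])
    also have "\<dots> = (\<Sum>k\<in>V. (\<Sum>a | a \<in> E \<and> src a = k. d (tgt a)) * real_of_int (lam j m k))"
      by (intro sum.cong refl) (simp add: sum_distrib_right)
    also have "\<dots> \<ge> (\<Sum>k\<in>V. (2 * d k) * real_of_int (lam j m k))"
      using d(2) lam_nonneg by (intro sum_mono mult_right_mono) auto
    also have "(\<Sum>k\<in>V. (2 * d k) * real_of_int (lam j m k)) = 2 * S m"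
      by (simp add: S_def sum_distrib_left mult.assoc)
    finally show ?thesis .
  qed
  have S0: "S 0 = d j"
    using V(1,2) by (simp add: S_def lam_0 if_distrib sum.delta cong: if_cong)
  \<comment> \<open>Base case: \<open>S 1\<close> is at least twice \<open>S 0\<close>, and
    \<open>S 0 = d j\<close>. After that the recursion and \<open>key\<close> show that the
    increments never decrease.\<close>
  have "S (Suc m) - S m \<ge> d j" if "m \<le> n" for m
    using that
  proof (induction m)
    case 0
    have "S (Suc 0) \<ge> 2 * S 0" using key[of 0] by (simp add: S_def lam_Suc_0)
    then show ?case using S0 by simp
  next
    case (Suc m)
    then have "socle_free j m" using less by simp
    then have "S (Suc (Suc m)) = (\<Sum>i\<in>V. d i * real_of_int (\<Sum>a | a \<in> E \<and> tgt a = i. lam j (Suc m) (src a))) - S m"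
      by (simp add: S_def lam_Suc_Suc right_diff_distrib sum_subtractf)
    then show ?case using key[of "Suc m"] Suc by simp
  qed
  moreover have "S n \<ge> 0" unfolding S_def by (intro sum_nonneg nonneg)
  ultimately have pos: "S (Suc n) > 0" using d(1)[OF V(2)] by (smt (verit) le_refl)
  show ?case
  proof (rule ccontr)
    assume "\<not> socle_free j n"
    then have "\<exists>i. \<exists>y\<in>P j n i. (\<forall>a\<in>E. src a = i \<longrightarrow> snoc_arrow a y \<in> J j (Suc n) (tgt a))
        \<and> y \<notin> J j n i"
      unfolding socle_free_def by simp
    then obtain i y where y: "y \<in> P j n i" "y \<notin> J j n i"
      "\<forall>a\<in>E. src a = i \<longrightarrow> snoc_arrow a y \<in> J j (Suc n) (tgt a)"
      by (elim exE bexE conjE)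
    have "P j (Suc n) k = J j (Suc n) k" for k
      by (rule socle_imp_generated_in_lower_degrees[OF less y(1,2)]) (simp_all add: y(3))
    then have "lam j (Suc n) k = 0" for k by (simp only: lam_def diff_self)
    then show False using pos by (simp add: S_def)
  qed
qed

section \<open>Reduction modulo z, and z as a nonzero divisor\<close>

definition top_part :: "nat \<Rightarrow> ('e list \<Rightarrow> 'k) \<Rightarrow> 'e list \<Rightarrow> 'k" where
  "top_part n f = (\<lambda>p. if length p = n then f p else 0)"

lemma flinear_top: "flinear (top_part n)"
  by (rule flinearI) (auto simp: top_part_def fun_eq_iff)

lemmas top_lin = flinearD[OF flinear_top]

lemma top_snoc: "top_part (Suc n) (snoc_arrow a f) = snoc_arrow a (top_part n f)"
proof
  fix p show "top_part (Suc n) (snoc_arrow a f) p = snoc_arrow a (top_part n f) p"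
    by (cases p) (auto simp: top_part_def)
qed

lemma div_top: "div_arrow a (top_part (Suc n) f) = top_part n (div_arrow a f)"
  by (auto simp: top_part_def fun_eq_iff)

lemma top_mesh: "top_part (Suc (Suc n)) (mesh i y) = mesh i (top_part n y)"
  by (simp add: mesh_def top_lin top_snoc)

lemma top_P: "y \<in> P j n i \<Longrightarrow> top_part n y = y"
  by (auto simp: top_part_def P_def fun_eq_iff)

lemma top_F: "y \<in> F j n i \<Longrightarrow> top_part n y \<in> P j n i"
  by (auto simp: top_part_def F_def P_def)

lemma top_F_less: "y \<in> F j n i \<Longrightarrow> top_part (Suc (Suc n)) y = 0"
  by (auto simp: top_part_def F_def fun_eq_iff)

text \<open>In degree n a walk of length n carries no z, so \<open>top_part n\<close> sets z to 0.
  By parity the next length is two less: what vanishes modulo z is divisible by z, which here is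
  membership in the smaller \<open>F\<close>.\<close>

lemma top_eq_0_F: "y \<in> F j (Suc (Suc n)) i \<Longrightarrow> top_part (Suc (Suc n)) y = 0 \<Longrightarrow> y \<in> F j n i"
  by (auto simp: top_part_def F_def fun_eq_iff) (metis even_Suc le_Suc_eq even_add)

lemma length_F_less_2: "y \<in> F j n i \<Longrightarrow> y p \<noteq> 0 \<Longrightarrow> n < 2 \<Longrightarrow> length p = n"
proof -
  assume "y \<in> F j n i" "y p \<noteq> 0" "n < 2"
  then have "length p \<le> n" "even (n + length p)" "n < 2" by (simp_all add: F_def)
  then show "length p = n" by presburger
qed

lemma top_eq_0_F_less_2:
  assumes "y \<in> F j n i" "top_part n y = 0" "n < 2"
  shows "y = 0"
proof
  fix p show "y p = 0 p"
    using length_F_less_2[OF assms(1) _ assms(3), of p] fun_cong[OF assms(2), of p]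
    by (cases "y p = 0") (simp_all add: top_part_def)
qed

lemma top_Ext:
  assumes "g \<in> Ext A i" "\<And>k f. f \<in> A k \<Longrightarrow> top_part n f \<in> B k"
  shows "top_part (Suc n) g \<in> Ext B i"
  using assms by (auto simp: Ext_iff div_top top_lin) (simp add: top_part_def)

lemma top_I: "f \<in> I j n i \<Longrightarrow> top_part n f \<in> J j n i"
proof (induction n arbitrary: i f rule: induct_nat_012)
  case (ge2 n)
  then obtain y where y: "y \<in> F j n i" "f - (mesh i y - fscale (c i) y) \<in> Ext (I j (Suc n)) i"
    by (auto simp: I_Suc_Suc)
  have "top_part (Suc (Suc n)) (f - (mesh i y - fscale (c i) y)) \<in> Ext (J j (Suc n)) i"
    using top_Ext[OF y(2)] ge2(2) by blast
  moreover have "top_part (Suc (Suc n)) (f - (mesh i y - fscale (c i) y))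
      = top_part (Suc (Suc n)) f - mesh i (top_part n y)"
    by (simp add: top_lin top_mesh top_F_less[OF y(1)])
  ultimately show ?case using top_F[OF y(1)] by (auto simp: J_Suc_Suc)
qed (simp_all add: top_lin)

text \<open>Together with \<open>top_I\<close>: the preprojective algebra is the central extension
  modulo z. The lift follows the recursion, replacing the mesh relation by the central relation and
  lifting the parts ending in each arrow.\<close>

lemma J_subset_top_I: "g \<in> J j n i \<Longrightarrow> \<exists>f\<in>I j n i. top_part n f = g"
proof (induction n arbitrary: i g rule: induct_nat_012)
  case (ge2 n)
  let ?A = "{a. a \<in> E \<and> tgt a = i}"
  from ge2(3) obtain y where y: "y \<in> P j n i" "g - mesh i y \<in> Ext (J j (Suc n)) i"
    by (auto simp: J_Suc_Suc)
  have "\<forall>a\<in>?A. \<exists>f. f \<in> I j (Suc n) (src a) \<and> top_part (Suc n) f = div_arrow a (g - mesh i y)"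
    using ge2(2) ExtD[OF y(2)] by blast
  then obtain h where h: "\<forall>a\<in>?A. h a \<in> I j (Suc n) (src a) \<and> top_part (Suc n) (h a) = div_arrow a (g - mesh i y)"
    by (rule bchoice[THEN exE])
  let ?s = "\<Sum>a\<in>?A. snoc_arrow a (h a)"
  define f where "f = (mesh i y - fscale (c i) y) + ?s"
  have yF: "y \<in> F j n i" using y(1) P_subset_F by blast
  have "?s \<in> Ext (I j (Suc n)) i"
  proof (intro fs.subspace_sum[OF subspace_Ext[OF subspace_I]])
    fix a assume "a \<in> ?A"
    then show "snoc_arrow a (h a) \<in> Ext (I j (Suc n)) i"
      using snoc_in_Ext[of a "h a" "I j (Suc n)"] h zero_I by auto
  qed
  then have "f \<in> I j (Suc (Suc n)) i"
    using yF unfolding I_Suc_Suc f_def by (intro CollectI bexI[of _ y]) simp_all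
  moreover have "top_part (Suc (Suc n)) ?s = g - mesh i y"
    using h by (subst Ext_sum[OF y(2)]) (simp add: top_lin top_snoc)
  then have "top_part (Suc (Suc n)) f = g"
    unfolding f_def by (simp add: top_lin top_mesh top_P[OF y(1)] top_F_less[OF yF])
  ultimately show ?case by blast
qed (simp_all add: top_lin)

lemma Ext_zero: "f \<in> Ext (\<lambda>k. {0}) i \<Longrightarrow> f = 0"
  by (rule list_fun_eqI) (auto simp: Ext_iff div_arrow_lin)

text \<open>The ideal is stable under multiplication by z.\<close>

lemma I_Suc_Suc_mono: "I j n i \<subseteq> I j (Suc (Suc n)) i"
proof (induction n arbitrary: i rule: induct_nat_012)
  case (ge2 n)
  show ?case
    using F_Suc_Suc[of j n i] Ext_mono[of "I j (Suc n)" "I j (Suc (Suc (Suc n)))", OF ge2(2)]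
    unfolding I_Suc_Suc[of j n] I_Suc_Suc[of j "Suc (Suc n)"] by blast
qed (simp_all add: zero_I)

text \<open>z is a nonzero divisor. Write z f as y times the central relation plus a sum of ideal
  elements ending in arrows. After \<open>y\<close> has been corrected by an ideal element it is
  divisible by z; the arrow parts are then divisible as well, and the induction hypothesis divides
  them inside the ideal.\<close>

lemma torsion_free:
  assumes "\<And>m. socle_free j m" "f \<in> I j (Suc (Suc n)) i" "f \<in> F j n i"
  shows "f \<in> I j n i"
  using assms(2,3)
proof (induction n arbitrary: i f rule: less_induct)
  case (less n)
  from less.prems(1) obtain y where y: "y \<in> F j n i"
    "f - (mesh i y - fscale (c i) y) \<in> Ext (I j (Suc n)) i" by (auto simp: I_Suc_Suc)
  define g where "g = f - (mesh i y - fscale (c i) y)"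
  have g: "g \<in> Ext (I j (Suc n)) i" using y(2) by (simp add: g_def)
  \<comment> \<open>Modulo z both \<open>f\<close> and the multiple of \<open>y\<close> disappear,
    so the top part of \<open>y\<close> is a socle element. It lies in \<open>J\<close> and is
    lifted to \<open>y1\<close> in \<open>I\<close>.\<close>
  have "top_part (Suc (Suc n)) g = - mesh i (top_part n y)"
    by (simp add: g_def top_lin top_mesh top_F_less[OF y(1)] top_F_less[OF less.prems(2)])
  moreover have "top_part (Suc (Suc n)) g \<in> Ext (J j (Suc n)) i"
    using top_Ext[OF g] top_I by blast
  ultimately have "- mesh i (top_part n y) \<in> Ext (J j (Suc n)) i" by simp
  from fs.subspace_neg[OF subspace_Ext[of "J j (Suc n)", OF subspace_J] this]
  have "mesh i (top_part n y) \<in> Ext (J j (Suc n)) i" by simp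
  then have "top_part n y \<in> J j n i"
    using assms(1)[of n] top_F[OF y(1)] by (simp add: mesh_in_Ext_iff[OF subspace_J] socle_free_def)
  then obtain y1 where y1: "y1 \<in> I j n i" "top_part n y1 = top_part n y"
    using J_subset_top_I by blast
  define y2 where "y2 = y - y1"
  have y1F: "y1 \<in> F j n i" using y1(1) I_subset_F by blast
  have y2F: "y2 \<in> F j n i" unfolding y2_def using fs.subspace_diff[OF subspace_F y(1) y1F] .
  have y2top: "top_part n y2 = 0" by (simp add: y2_def top_lin y1(2))
  define g' where "g' = f + fscale (c i) y - mesh i y2"
  have "mesh i y1 \<in> Ext (I j (Suc n)) i"
    using snoc_I y1(1) by (subst mesh_in_Ext_iff[OF subspace_I]) auto
  from fs.subspace_add[OF subspace_Ext[of "I j (Suc n)", OF subspace_I] g this]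
  moreover have "g + mesh i y1 = g'" by (simp add: g'_def g_def y2_def mesh_lin algebra_simps)
  ultimately have g': "g' \<in> Ext (I j (Suc n)) i" by simp
  show ?case
  proof (cases "n < 2")
    case True
    \<comment> \<open>Degrees 0 and 1 leave no room for z, so the coefficient vanishes altogether
      and \<open>f\<close> is a sum of products with arrows. Degree 1 reduces to degree 0.\<close>
    have "y2 = 0" using top_eq_0_F_less_2[OF y2F y2top True] .
    moreover have "y1 = 0" using y1(1) True by (auto simp: less_2_cases_iff)
    ultimately have "y = 0" by (simp add: y2_def)
    then have f: "f \<in> Ext (I j (Suc n)) i"
      using g by (simp add: g_def mesh_lin)
    show ?thesis
    proof (cases n)
      case 0
      then have "f \<in> Ext (\<lambda>k. {0}) i" using f by (simp add: Ext_iff)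
      then show ?thesis using 0 Ext_zero by simp
    next
      case (Suc m)
      then have m: "n = Suc 0" using True by simp
      then have "f \<in> Ext (F j 0) i"
        using less.prems(2) f F_Suc_Nil[of f j 0 i] by (simp add: Ext_iff)
      then have "f \<in> Ext (\<lambda>k. {0}) i"
        using f less.IH[of 0] m by (auto simp: Ext_iff)
      then show ?thesis using m Ext_zero by simp
    qed
  next
    case False
    then obtain m where n: "n = Suc (Suc m)" by (cases n; cases "n - 1") auto
    have y2F': "y2 \<in> F j m i" using top_eq_0_F y2F y2top n by blast
    have "f + fscale (c i) y \<in> F j n i"
      using fs.subspace_add[OF subspace_F less.prems(2)] fs.subspace_scale[OF subspace_F y(1)] by blast
    then have "g' \<in> F j n i"
      unfolding g'_def using fs.subspace_diff[OF subspace_F] mesh_F[OF y2F'] n by blast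
    then have g'F: "g' \<in> Ext (F j (Suc m)) i"
      using F_Suc_Nil g' n by (simp add: Ext_iff)
    have "div_arrow a g' \<in> I j (Suc m) (src a)" if "a \<in> E" "tgt a = i" for a
      using less.IH[of "Suc m"] n ExtD[OF g' that] ExtD[OF g'F that] by simp
    then have g'I: "g' \<in> Ext (I j (Suc m)) i" using g' by (simp add: Ext_iff)
    \<comment> \<open>Since \<open>y = y1 + y2\<close>, moving the multiple of the ideal element
      \<open>y1\<close> to the left leaves a relation with coefficient \<open>y2\<close> of degree n
      - 2 and the remainder \<open>g'\<close>.\<close>
    define u where "u = f + fscale (c i) y1"
    have "u - (mesh i y2 - fscale (c i) y2) = g'"
      by (simp add: u_def g'_def y2_def fs.scale_right_diff_distrib)
    then have "u \<in> I j n i" using y2F' g'I n by (auto simp: I_Suc_Suc)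
    from fs.subspace_diff[OF subspace_I this fs.subspace_scale[OF subspace_I y1(1), of "c i"]]
    show ?thesis by (simp add: u_def)
  qed
qed

text \<open>The dimension of the part of degree n between \<open>j\<close> and \<open>i\<close> in
  the central extension; \<open>dimension_peirce_piece\<close> matches it with the ring-theoretic
  dimension.\<close>

definition bdim :: "'v \<Rightarrow> nat \<Rightarrow> 'v \<Rightarrow> int" where
  "bdim j n i = int (fs.dim (F j n i)) - int (fs.dim (I j n i))"

lemma F_eq_P:
  assumes "n < 2" shows "F j n i = P j n i"
proof
  show "F j n i \<subseteq> P j n i"
  proof
    fix f assume f: "f \<in> F j n i"
    have "length p = n" if "f p \<noteq> 0" for p
      by (rule length_F_less_2[OF f that assms])
    then show "f \<in> P j n i" using f unfolding F_def P_def by blast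
  qed
qed (rule P_subset_F)

lemma bdim_lt_2: "n < 2 \<Longrightarrow> bdim j n i = lam j n i"
  unfolding bdim_def lam_def by (cases n) (simp_all add: F_eq_P)

lemma flinear_id: "flinear (\<lambda>y. y)"
  by (rule flinearI) simp_all

text \<open>Multiplication by z from degree n to n + 2 is injective by \<open>torsion_free\<close>,
  with cokernel the preprojective algebra. The count applies \<open>dim_sum_image\<close> with the
  identity to \<open>P\<close>, \<open>J\<close> and \<open>I\<close> in degree n + 2, each time
  against \<open>F j n i\<close>.\<close>

lemma bdim_Suc_Suc:
  assumes "\<And>m. socle_free j m"
  shows "bdim j (Suc (Suc n)) i = bdim j n i + lam j (Suc (Suc n)) i"
proof -
  let ?n = "Suc (Suc n)"
  note d = fs.dim_sum_image[OF flinear_id subspace_F fin_dim_F]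
  have zero: "y \<in> P j ?n i \<Longrightarrow> y \<in> F j n i \<Longrightarrow> y = 0" for y
    using top_P top_F_less by metis
  have F: "{a + y |a y. a \<in> F j n i \<and> y \<in> P j ?n i} = F j ?n i"
  proof (intro subset_antisym subsetI)
    fix f assume f: "f \<in> F j ?n i"
    have "f - top_part ?n f \<in> F j n i"
    proof (rule top_eq_0_F)
      show "f - top_part ?n f \<in> F j ?n i"
        using fs.subspace_diff[OF subspace_F f] top_F[OF f] P_subset_F by blast
      show "top_part ?n (f - top_part ?n f) = 0" using top_P[OF top_F[OF f]] by (simp add: top_lin)
    qed
    moreover have "f = (f - top_part ?n f) + top_part ?n f" by simp
    ultimately show "f \<in> {a + y |a y. a \<in> F j n i \<and> y \<in> P j ?n i}" using top_F[OF f] by blast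
  next
    fix f assume "f \<in> {a + y |a y. a \<in> F j n i \<and> y \<in> P j ?n i}"
    then show "f \<in> F j ?n i"
      using F_Suc_Suc P_subset_F fs.subspace_add[OF subspace_F] by blast
  qed
  \<comment> \<open>Both sums consist of the elements whose top part lies in \<open>J\<close>: an
    element of \<open>I\<close> differs from its top part by a multiple of z.\<close>
  have IJ: "{a + y |a y. a \<in> F j n i \<and> y \<in> I j ?n i} = {a + y |a y. a \<in> F j n i \<and> y \<in> J j ?n i}"
  proof -
    have diff: "y - top_part ?n y \<in> F j n i" if "y \<in> I j ?n i" for y
    proof (rule top_eq_0_F)
      have y: "y \<in> F j ?n i" using that I_subset_F by blast
      show "y - top_part ?n y \<in> F j ?n i"
        using fs.subspace_diff[OF subspace_F y] top_F[OF y] P_subset_F by blast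
      show "top_part ?n (y - top_part ?n y) = 0" using top_P[OF top_F[OF y]] by (simp add: top_lin)
    qed
    show ?thesis
    proof (intro subset_antisym subsetI)
      fix f assume "f \<in> {a + y |a y. a \<in> F j n i \<and> y \<in> I j ?n i}"
      then obtain a y where ay: "f = a + y" "a \<in> F j n i" "y \<in> I j ?n i" by blast
      have "f = (a + (y - top_part ?n y)) + top_part ?n y" using ay by simp
      then show "f \<in> {a + y |a y. a \<in> F j n i \<and> y \<in> J j ?n i}"
        using fs.subspace_add[OF subspace_F ay(2) diff[OF ay(3)]] top_I[OF ay(3)] by blast
    next
      fix f assume "f \<in> {a + y |a y. a \<in> F j n i \<and> y \<in> J j ?n i}"
      then obtain a g where ag: "f = a + g" "a \<in> F j n i" "g \<in> J j ?n i" by blast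
      then obtain y where y: "y \<in> I j ?n i" "top_part ?n y = g" using J_subset_top_I by blast
      have "f = (a - (y - top_part ?n y)) + y" using ag y by simp
      then show "f \<in> {a + y |a y. a \<in> F j n i \<and> y \<in> I j ?n i}"
        using fs.subspace_diff[OF subspace_F ag(2) diff[OF y(1)]] y(1) by blast
    qed
  qed
  have K1: "{y \<in> P j ?n i. y \<in> F j n i} = {0}" using zero zero_P zero_F by auto
  have K2: "{y \<in> J j ?n i. y \<in> F j n i} = {0}"
    using zero subsetD[OF J_subset_P] zero_J zero_F by auto
  have K3: "{y \<in> I j ?n i. y \<in> F j n i} = I j n i"
    using torsion_free[OF assms] I_Suc_Suc_mono I_subset_F by blast
  have "fs.dim (F j ?n i) = fs.dim (F j n i) + fs.dim (P j ?n i)"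
    using d[OF subspace_P fin_dim_P, of j n i j ?n i] unfolding F K1 dim_zero by simp
  moreover have "fs.dim {a + y |a y. a \<in> F j n i \<and> y \<in> J j ?n i} = fs.dim (F j n i) + fs.dim (J j ?n i)"
    using d[OF subspace_J fin_dim_J, of j n i j ?n i] unfolding K2 dim_zero by simp
  moreover have "fs.dim {a + y |a y. a \<in> F j n i \<and> y \<in> J j ?n i} + fs.dim (I j n i)
      = fs.dim (F j n i) + fs.dim (I j ?n i)"
    using d[OF subspace_I fin_dim_I, of j n i j ?n i] unfolding K3 IJ .
  ultimately show ?thesis by (simp add: bdim_def lam_def)
qed

end

section \<open>Components of the central extension\<close>

definition arrow_sign :: "'a + 'a \<Rightarrow> 'k::field" where
  "arrow_sign = case_sum (\<lambda>_. 1) (\<lambda>_. - 1)"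

definition coeff_mult :: "'r::comm_ring_1 \<Rightarrow> ('x \<Rightarrow>\<^sub>0 'r) \<Rightarrow> ('x \<Rightarrow>\<^sub>0 'r)" where
  "coeff_mult b f = Poly_Mapping.map ((*) b) f"

lemma lookup_coeff_mult [simp]: "Poly_Mapping.lookup (coeff_mult b f) x = b * Poly_Mapping.lookup f x"
  by (simp add: coeff_mult_def Poly_Mapping.map.rep_eq when_def)

lemma coeff_mult_add: "coeff_mult b (f + g) = coeff_mult b f + coeff_mult b g"
  by (rule poly_mapping_eqI) (simp add: lookup_add distrib_left)

lemma coeff_mult_0 [simp]: "coeff_mult b 0 = 0"
  by (rule poly_mapping_eqI) simp

lemma coeff_mult_single: "coeff_mult b (Poly_Mapping.single x a) = Poly_Mapping.single x (b * a)"
  by (rule poly_mapping_eqI) (simp add: lookup_single when_def)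

lemma path_mult_coeff_mult:
  "path_mult G (coeff_mult b f) g = coeff_mult b (path_mult G f g)"
  "path_mult G f (coeff_mult b g) = coeff_mult b (path_mult G f g)"
proof -
  show "path_mult G (coeff_mult b f) g = coeff_mult b (path_mult G f g)"
  proof (induction f rule: poly_mapping_single_induct)
    case (2 x a)
    show ?case
      by (induction g rule: poly_mapping_single_induct)
        (auto simp: path_mult_single coeff_mult_single path_mult_add_right coeff_mult_add mult.assoc)
  qed (auto simp: path_mult_add_left coeff_mult_add)
  show "path_mult G f (coeff_mult b g) = coeff_mult b (path_mult G f g)"
  proof (induction f rule: poly_mapping_single_induct)
    case (2 x a)
    show ?case
      by (induction g rule: poly_mapping_single_induct)
        (auto simp: path_mult_single coeff_mult_single path_mult_add_right coeff_mult_add mult_ac)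
  qed (auto simp: path_mult_add_left coeff_mult_add)
qed

lemma path_mult_minus:
  "path_mult G (- f) g = - path_mult G f g" "path_mult G f (- g) = - path_mult G f g"
proof -
  have "path_mult G (- f) g + path_mult G f g = 0" "path_mult G f (- g) + path_mult G f g = 0"
    by (simp_all flip: path_mult_add_left path_mult_add_right)
  then show "path_mult G (- f) g = - path_mult G f g" "path_mult G f (- g) = - path_mult G f g"
    by (simp_all add: eq_neg_iff_add_eq_0)
qed

lemma path_mult_diff_right: "path_mult G f (g - h) = path_mult G f g - path_mult G f h"
  by (simp add: path_mult_add_right path_mult_minus diff_conv_add_uminus del: add_uminus_conv_diff)

lemma path_end_snoc [simp]: "path_end G (j, q @ [b]) = pre_digraph.head G b"
  unfolding path_end_append[of G j q "[b]"]
  by (simp add: path_end_def pre_digraph.awalk_verts.simps)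

lemma path_end_Cons: "path_end G (j, b # q) = path_end G (head G b, q)"
  using path_end_append[of G j "[b]" q] path_end_snoc[of G j "[]" b] by simp

lemma lookup_mult_arrow_right:
  "Poly_Mapping.lookup (path_mult G f (Poly_Mapping.single (u, [a]) 1)) (j, q) =
     (if q \<noteq> [] \<and> last q = a \<and> path_end G (j, butlast q) = u then Poly_Mapping.lookup f (j, butlast q) else 0)"
proof (induction f rule: poly_mapping_single_induct)
  case (2 x b)
  then show ?case
    by (cases x; cases q rule: rev_cases)
      (auto simp: path_mult_single lookup_single when_def)
qed (auto simp: path_mult_add_left lookup_add)

lemma lookup_mult_arrow_left:
  "Poly_Mapping.lookup (path_mult G (Poly_Mapping.single (u, [a]) 1) f) (j, q) =
     (if q \<noteq> [] \<and> hd q = a \<and> j = u then Poly_Mapping.lookup f (head G a, tl q) else 0)"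
proof (induction f rule: poly_mapping_single_induct)
  case (2 x b)
  then show ?case
    by (cases x; cases q) (auto simp: path_mult_single path_end_Cons lookup_single when_def)
qed (auto simp: path_mult_add_right lookup_add)

lemma lookup_mult_vertex_right:
  "Poly_Mapping.lookup (path_mult G f (Poly_Mapping.single (u, []) 1)) (j, q) =
     (if path_end G (j, q) = u then Poly_Mapping.lookup f (j, q) else 0)"
proof (induction f rule: poly_mapping_single_induct)
  case (2 x b)
  then show ?case
    by (cases x) (auto simp: path_mult_single lookup_single when_def)
qed (auto simp: path_mult_add_left lookup_add)

lemma lookup_mult_vertex_left:
  "Poly_Mapping.lookup (path_mult G (Poly_Mapping.single (u, []) 1) f) (j, q) =
     (if j = u then Poly_Mapping.lookup f (j, q) else 0)"
proof (induction f rule: poly_mapping_single_induct)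
  case (2 x b)
  then show ?case
    by (cases x) (auto simp: path_mult_single lookup_single when_def)
qed (auto simp: path_mult_add_right lookup_add)

text \<open>Left multiplication by an arrow: walks are stored in reverse, so a new initial arrow
  goes to the end of the list. \<open>I\<close> is built with right multiplications, whereas the
  central ideal is two-sided.\<close>

definition cons_arrow :: "'e \<Rightarrow> ('e list \<Rightarrow> 'k::field) \<Rightarrow> 'e list \<Rightarrow> 'k" where
  "cons_arrow e f = (\<lambda>p. if p \<noteq> [] \<and> last p = e then f (butlast p) else 0)"

lemma flinear_cons_arrow: "flinear (cons_arrow e)"
  by (rule flinearI) (auto simp: cons_arrow_def fun_eq_iff)

lemmas cons_arrow_lin = flinearD[OF flinear_cons_arrow]

lemma cons_snoc_arrow: "cons_arrow e (snoc_arrow a f) = snoc_arrow a (cons_arrow e f)"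
proof
  fix p show "cons_arrow e (snoc_arrow a f) p = snoc_arrow a (cons_arrow e f) p"
  proof (cases p)
    case (Cons b q)
    then show ?thesis by (cases q) (auto simp: cons_arrow_def)
  qed (simp add: cons_arrow_def)
qed

lemma div_cons_arrow: "f [] = 0 \<Longrightarrow> div_arrow a (cons_arrow e f) = cons_arrow e (div_arrow a f)"
proof
  fix p assume "f [] = 0" then show "div_arrow a (cons_arrow e f) p = cons_arrow e (div_arrow a f) p"
    by (cases p) (auto simp: cons_arrow_def)
qed

context mesh_quiver
begin

lemma walk_snoc: "walk j (p @ [e]) i \<longleftrightarrow> e \<in> E \<and> src e = j \<and> walk (tgt e) p i"
  by (induction p arbitrary: i) auto

lemma cons_arrow_mesh: "cons_arrow e (mesh i y) = mesh i (cons_arrow e y)"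
  by (simp add: mesh_def cons_arrow_lin cons_snoc_arrow)

lemma cons_arrow_F:
  assumes "e \<in> E" "f \<in> F (tgt e) n i"
  shows "cons_arrow e f \<in> F (src e) (Suc n) i"
  unfolding F_def
proof (intro CollectI allI impI)
  fix p assume p: "cons_arrow e f p \<noteq> 0"
  then obtain q where q: "p = q @ [e]"
    by (cases p rule: rev_cases) (auto simp: cons_arrow_def split: if_splits)
  then have "f q \<noteq> 0" using p by (simp add: cons_arrow_def)
  then have "walk (tgt e) q i \<and> length q \<le> n \<and> even (n + length q)"
    using assms(2) unfolding F_def by blast
  then show "walk (src e) p i \<and> length p \<le> Suc n \<and> even (Suc n + length p)"
    using assms(1) q walk_snoc by simp
qed

lemma cons_arrow_Ext:
  assumes "f \<in> Ext A i" "\<And>k g. g \<in> A k \<Longrightarrow> cons_arrow e g \<in> B k"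
  shows "cons_arrow e f \<in> Ext B i"
  using assms by (auto simp: Ext_iff div_cons_arrow cons_arrow_lin) (simp add: cons_arrow_def)

text \<open>Left multiplication commutes with \<open>mesh\<close> and with
  \<open>snoc_arrow\<close>, so it passes through the recursion and only changes the start
  vertex.\<close>

lemma cons_arrow_I:
  assumes "e \<in> E" "f \<in> I (tgt e) n i"
  shows "cons_arrow e f \<in> I (src e) (Suc n) i"
  using assms(2)
proof (induction n arbitrary: i f rule: induct_nat_012)
  case (ge2 n)
  from ge2(3) obtain y where y: "y \<in> F (tgt e) n i"
    "f - (mesh i y - fscale (c i) y) \<in> Ext (I (tgt e) (Suc n)) i"
    by (auto simp: I_Suc_Suc)
  have "cons_arrow e (f - (mesh i y - fscale (c i) y)) \<in> Ext (I (src e) (Suc (Suc n))) i"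
    using cons_arrow_Ext[OF y(2)] ge2(2) by blast
  then have "cons_arrow e f - (mesh i (cons_arrow e y) - fscale (c i) (cons_arrow e y))
      \<in> Ext (I (src e) (Suc (Suc n))) i"
    by (simp only: cons_arrow_lin cons_arrow_mesh)
  then show ?case
    using cons_arrow_F[OF assms(1) y(1)] unfolding I_Suc_Suc[of "src e" "Suc n"] by blast
qed (simp_all add: cons_arrow_lin zero_I)

end

lemma mesh_quiver_double:
  fixes Q :: "('v::finite, 'a) pre_digraph"
  assumes "fin_digraph Q"
  shows "mesh_quiver (arcs (double_quiver Q)) (tail (double_quiver Q)) (head (double_quiver Q))
    opposite_arrow (arrow_sign :: _ \<Rightarrow> 'k::field)"
  by (intro mesh_quiver.intro symmetric_quiver_double[OF assms] mesh_quiver_axioms.intro)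
    (simp add: arrow_sign_def split: sum.split)

lemma paths_snoc_iff:
  assumes "verts G = UNIV"
  shows "(j, p @ [a]) \<in> paths G \<longleftrightarrow> (j, p) \<in> paths G \<and> a \<in> arcs G \<and> path_end G (j, p) = tail G a"
proof -
  have "pre_digraph.cas G j (p @ [a]) (head G a) \<longleftrightarrow>
      pre_digraph.cas G j p (path_end G (j, p)) \<and> path_end G (j, p) = tail G a"
    by (induction p arbitrary: j) (auto simp: pre_digraph.cas.simps path_end_Cons)
  then show ?thesis
    using assms by (auto simp: paths_def pre_digraph.awalk_def)
qed

section \<open>Graded components of elements of the path algebra\<close>

locale quiver_extension =
  fixes Q :: "('v::finite, 'a) pre_digraph" and v :: "'v \<Rightarrow> 'k::field"
  assumes fin_Q: "fin_digraph Q" and verts_Q: "verts Q = UNIV"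
begin

abbreviation "G \<equiv> double_quiver Q"

sublocale mesh_quiver "arcs G" "tail G" "head G" opposite_arrow "arrow_sign :: _ \<Rightarrow> 'k" v
  by (rule mesh_quiver_double[OF fin_Q])

lemma verts_G: "verts G = UNIV"
  by (simp add: double_quiver_def verts_Q)

lemma walk_iff: "walk j p i \<longleftrightarrow> (j, rev p) \<in> paths G \<and> path_end G (j, rev p) = i"
proof (induction p arbitrary: i)
  case Nil
  then show ?case using trivial_path_in_paths[of j G] verts_G by auto
next
  case (Cons a p)
  then show ?case using paths_snoc_iff[OF verts_G] by auto
qed

lemma walk_path_end: "walk j p i \<Longrightarrow> path_end G (j, rev p) = i"
  by (simp add: walk_iff)

text \<open>The part of degree n between \<open>j\<close> and \<open>i\<close> with z set to 1: in
  this degree a walk p carries z to the power \<open>(n - length p) div 2\<close>, and the guard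
  discards lengths for which there is no such power.\<close>

definition component :: "nat \<Rightarrow> 'v \<Rightarrow> 'v \<Rightarrow> (('v, 'a + 'a) path \<Rightarrow>\<^sub>0 'k poly) \<Rightarrow> ('a + 'a) list \<Rightarrow> 'k" where
  "component n j i f = (\<lambda>p. if walk j p i \<and> length p \<le> n \<and> even (n + length p)
     then poly.coeff (Poly_Mapping.lookup f (j, rev p)) ((n - length p) div 2) else 0)"

lemma component_F: "component n j i f \<in> F j n i"
  by (auto simp: component_def F_def)

lemma component_lin:
  "component n j i 0 = 0" "component n j i (f + g) = component n j i f + component n j i g"
  "component n j i (f - g) = component n j i f - component n j i g"
  by (auto simp: component_def fun_eq_iff lookup_add lookup_minus)

lemma component_sum: "component n j i (sum h A) = (\<Sum>a\<in>A. component n j i (h a))"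
  by (induction A rule: infinite_finite_induct) (simp_all add: component_lin)

lemma component_scale: "component n j i (coeff_mult [:b:] f) = fscale b (component n j i f)"
  by (auto simp: component_def fun_eq_iff)

lemma component_z:
  "component (Suc (Suc n)) j i (coeff_mult [:0, 1:] f) = component n j i f"
  "n < 2 \<Longrightarrow> component n j i (coeff_mult [:0, 1:] f) = 0"
proof -
  show "component (Suc (Suc n)) j i (coeff_mult [:0, 1:] f) = component n j i f"
  proof
    fix p :: "('a + 'a) list"
    consider "length p \<le> n" | "length p = Suc n" | "length p = Suc (Suc n)" | "length p > Suc (Suc n)"
      by linarith
    then show "component (Suc (Suc n)) j i (coeff_mult [:0, 1:] f) p = component n j i f p"
    proof cases
      case 1
      then have "(Suc (Suc n) - length p) div 2 = Suc ((n - length p) div 2)" by simp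
      then show ?thesis using 1 by (simp add: component_def)
    qed (auto simp: component_def)
  qed
  show "component n j i (coeff_mult [:0, 1:] f) = 0" if "n < 2"
  proof -
    have "(n - length p) div 2 = 0" for p :: "('a + 'a) list" using that by simp
    then show ?thesis by (simp add: component_def fun_eq_iff)
  qed
qed

lemma component_arrow_right:
  "component (Suc n) j i (path_mult G f (Poly_Mapping.single (tail G a, [a]) 1)) =
     (if a \<in> arcs G \<and> head G a = i then snoc_arrow a (component n j (tail G a) f) else 0)"
  (is "?l = ?r")
proof
  fix p show "?l p = ?r p"
    by (cases p) (auto simp: component_def lookup_mult_arrow_right dest: walk_path_end)
qed

lemma component_arrow_right_0:
  "component 0 j i (path_mult G f (Poly_Mapping.single (u, [a]) 1)) = 0"
  by (auto simp: component_def fun_eq_iff lookup_mult_arrow_right)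

lemma component_arrow_left:
  "component (Suc n) j i (path_mult G (Poly_Mapping.single (tail G e, [e]) 1) f) =
     (if e \<in> arcs G \<and> tail G e = j then cons_arrow e (component n (head G e) i f) else 0)"
  (is "?l = ?r")
proof
  fix p show "?l p = ?r p"
    by (cases p rule: rev_cases) (auto simp: component_def lookup_mult_arrow_left cons_arrow_def walk_snoc)
qed

lemma component_arrow_left_0:
  "component 0 j i (path_mult G (Poly_Mapping.single (u, [a]) 1) f) = 0"
  by (auto simp: component_def fun_eq_iff lookup_mult_arrow_left)

lemma component_vertex_right:
  "component n j i (path_mult G f (Poly_Mapping.single (u, []) 1)) = (if i = u then component n j i f else 0)"
  by (auto simp: component_def fun_eq_iff lookup_mult_vertex_right dest: walk_path_end)

lemma component_vertex_left:
  "component n j i (path_mult G (Poly_Mapping.single (u, []) 1) f) = (if j = u then component n j i f else 0)"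
  by (auto simp: component_def fun_eq_iff lookup_mult_vertex_left)

end

lemma poly_mapping_sum_single:
  "f = (\<Sum>x\<in>Poly_Mapping.keys f. Poly_Mapping.single x (Poly_Mapping.lookup f x))"
  by (rule poly_mapping_eqI)
    (auto simp: lookup_sum lookup_single when_def in_keys_iff if_distrib sum.delta' cong: if_cong)

section \<open>The central ideal in terms of components\<close>

context quiver_extension
begin

text \<open>An upper bound for the central ideal. Components see only the coefficients of actual
  walks, so \<open>K\<close> is intersected with the carrier when it is used as an ideal.\<close>

definition K :: "(('v, 'a + 'a) path \<Rightarrow>\<^sub>0 'k poly) set" where
  "K = {f. \<forall>n j i. component n j i f \<in> I j n i}"

lemma K_add: "f \<in> K \<Longrightarrow> g \<in> K \<Longrightarrow> f + g \<in> K"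
  by (simp add: K_def component_lin fs.subspace_add[OF subspace_I])

lemma K_0: "0 \<in> K"
  by (simp add: K_def component_lin zero_I)

lemma K_sum: "(\<And>x. x \<in> A \<Longrightarrow> h x \<in> K) \<Longrightarrow> sum h A \<in> K"
  by (induction A rule: infinite_finite_induct) (auto simp: K_0 K_add)

lemma K_coeff_mult: "f \<in> K \<Longrightarrow> coeff_mult b f \<in> K"
proof (induction b)
  case 0
  have "coeff_mult 0 f = 0" by (rule poly_mapping_eqI) simp
  then show ?case by (simp add: K_0)
next
  case (pCons a b)
  have eq: "coeff_mult (pCons a b) f = coeff_mult [:a:] f + coeff_mult [:0, 1:] (coeff_mult b f)"
    by (rule poly_mapping_eqI) (simp add: lookup_add)
  have "coeff_mult [:a:] f \<in> K"
    using pCons.prems by (simp add: K_def component_scale fs.subspace_scale[OF subspace_I])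
  moreover have "coeff_mult [:0, 1:] g \<in> K" if "g \<in> K" for g
    unfolding K_def
  proof (intro CollectI allI)
    fix n j i
    show "component n j i (coeff_mult [:0, 1:] g) \<in> I j n i"
    proof (cases "n < 2")
      case True
      then show ?thesis by (simp add: component_z(2) zero_I)
    next
      case False
      then obtain m where n: "n = Suc (Suc m)" by (cases n; cases "n - 1") auto
      have "component m j i g \<in> I j m i" using that unfolding K_def by blast
      then show ?thesis using I_Suc_Suc_mono unfolding n component_z(1) by blast
    qed
  qed
  ultimately show ?case unfolding eq using pCons K_add by blast
qed

lemma K_arrow_right:
  assumes "f \<in> K"
  shows "path_mult G f (Poly_Mapping.single (tail G a, [a]) 1) \<in> K"
  unfolding K_def
proof (intro CollectI allI)
  fix n j i
  show "component n j i (path_mult G f (Poly_Mapping.single (tail G a, [a]) 1)) \<in> I j n i"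
  proof (cases n)
    case 0
    then show ?thesis by (simp add: component_arrow_right_0)
  next
    case (Suc m)
    have "component m j (tail G a) f \<in> I j m (tail G a)" using assms unfolding K_def by blast
    then show ?thesis using snoc_I[of a] zero_I by (auto simp: component_arrow_right Suc)
  qed
qed

lemma K_arrow_left:
  assumes "f \<in> K"
  shows "path_mult G (Poly_Mapping.single (tail G a, [a]) 1) f \<in> K"
  unfolding K_def
proof (intro CollectI allI)
  fix n j i
  show "component n j i (path_mult G (Poly_Mapping.single (tail G a, [a]) 1) f) \<in> I j n i"
  proof (cases n)
    case 0
    then show ?thesis by (simp add: component_arrow_left_0)
  next
    case (Suc m)
    have "component m (head G a) i f \<in> I (head G a) m i" using assms unfolding K_def by blast
    then show ?thesis using cons_arrow_I[of a] zero_I by (auto simp: component_arrow_left Suc)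
  qed
qed

lemma single_snoc:
  assumes "(u, p @ [a]) \<in> paths G"
  shows "Poly_Mapping.single (u, p @ [a]) 1 =
    path_mult G (Poly_Mapping.single (u, p) 1) (Poly_Mapping.single (tail G a, [a]) (1 :: 'k poly))"
  using assms paths_snoc_iff[OF verts_G] by (simp add: path_mult_single)

lemma K_path_right:
  assumes "f \<in> K" "(u, p) \<in> paths G"
  shows "path_mult G f (Poly_Mapping.single (u, p) 1) \<in> K"
  using assms(2)
proof (induction p rule: rev_induct)
  case Nil
  show ?case using assms(1) zero_I by (simp add: K_def component_vertex_right)
next
  case (snoc a p)
  then have "(u, p) \<in> paths G" using paths_snoc_iff[OF verts_G] by blast
  from K_arrow_right[OF snoc.IH[OF this]] show ?case
    by (simp only: single_snoc[OF snoc.prems] path_mult_assoc)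
qed

lemma K_path_left:
  assumes "f \<in> K" "(u, p) \<in> paths G"
  shows "path_mult G (Poly_Mapping.single (u, p) 1) f \<in> K"
  using assms
proof (induction p arbitrary: f rule: rev_induct)
  case Nil
  show ?case using Nil(1) zero_I by (simp add: K_def component_vertex_left)
next
  case (snoc a p)
  then have "(u, p) \<in> paths G" using paths_snoc_iff[OF verts_G] by blast
  from snoc.IH[OF K_arrow_left[OF snoc.prems(1)] this] show ?case
    by (simp only: single_snoc[OF snoc.prems(2)] path_mult_assoc)
qed

lemma K_mult:
  assumes "f \<in> K" "Poly_Mapping.keys g \<subseteq> paths G"
  shows "path_mult G f g \<in> K" "path_mult G g f \<in> K"
proof -
  have s: "Poly_Mapping.single x b = coeff_mult b (Poly_Mapping.single x 1)"
    for x :: "('v, 'a + 'a) path" and b :: "'k poly"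
    by (simp add: coeff_mult_single)
  have r: "path_mult G f (Poly_Mapping.single x b) \<in> K" "path_mult G (Poly_Mapping.single x b) f \<in> K"
    if "x \<in> paths G" for x b
    unfolding s[of x b] path_mult_coeff_mult
    using K_coeff_mult K_path_right[OF assms(1), of "fst x" "snd x"]
      K_path_left[OF assms(1), of "fst x" "snd x"] that by simp_all
  show "path_mult G f g \<in> K"
    by (subst poly_mapping_sum_single[of g], subst path_mult_sum_right, rule K_sum, rule r(1))
      (use assms(2) in blast)
  show "path_mult G g f \<in> K"
    by (subst poly_mapping_sum_single[of g], subst path_mult_sum_left, rule K_sum, rule r(2))
      (use assms(2) in blast)
qed

definition relation :: "'v \<Rightarrow> ('v, 'a + 'a) path \<Rightarrow>\<^sub>0 'k poly" where
  "relation k = mesh_relation Q k - Poly_Mapping.single (k, []) (smult (v k) [:0, 1:])"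

lemma central_relations_eq: "central_relations Q v = range relation"
  by (auto simp: central_relations_def relation_def verts_Q)

lemma mesh_relation_eq:
  "mesh_relation Q k = (\<Sum>e | e \<in> arcs G \<and> tail G e = k.
     coeff_mult [:arrow_sign e:] (Poly_Mapping.single (k, [e, opposite_arrow e]) (1 :: 'k poly)))"
proof -
  let ?h = "\<lambda>e. coeff_mult [:arrow_sign e:] (Poly_Mapping.single (k, [e, opposite_arrow e]) (1 :: 'k poly))"
  have fin: "finite {\<alpha>. \<alpha> \<in> arcs Q \<and> X \<alpha>}" for X
    using fin_digraph.finite_arcs[OF fin_Q] by simp
  have set_eq: "{e. e \<in> arcs G \<and> tail G e = k} =
      Inl ` {\<alpha>. \<alpha> \<in> arcs Q \<and> tail Q \<alpha> = k} \<union> Inr ` {\<alpha>. \<alpha> \<in> arcs Q \<and> head Q \<alpha> = k}"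
    by (auto simp: double_quiver_def)
  have "sum ?h {e. e \<in> arcs G \<and> tail G e = k} =
      (\<Sum>\<alpha> | \<alpha> \<in> arcs Q \<and> tail Q \<alpha> = k. ?h (Inl \<alpha>)) + (\<Sum>\<alpha> | \<alpha> \<in> arcs Q \<and> head Q \<alpha> = k. ?h (Inr \<alpha>))"
    unfolding set_eq
    by (subst sum.union_disjoint) (auto simp: fin sum.reindex)
  also have "\<dots> = mesh_relation Q k"
  proof -
    have "Poly_Mapping.single x [:- 1:] = - Poly_Mapping.single x [:1 :: 'k:]"
      for x :: "('v, 'a + 'a) path"
      by (rule poly_mapping_eqI) (simp add: lookup_single when_def)
    then show ?thesis
      by (simp add: mesh_relation_def opposite_arrow_def arrow_sign_def coeff_mult_single one_pCons
          sum_negf)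
  qed
  finally show ?thesis by simp
qed

text \<open>Rewrites the product through right multiplication by vertices and arrows and through
  multiplication by scalars and z, whose effects on components are known.\<close>

lemma mult_relation:
  "path_mult G y (relation k) =
     (\<Sum>e | e \<in> arcs G \<and> tail G e = k. coeff_mult [:arrow_sign e:]
        (path_mult G (path_mult G (path_mult G y (Poly_Mapping.single (k, []) 1))
          (Poly_Mapping.single (tail G e, [e]) 1))
          (Poly_Mapping.single (tail G (opposite_arrow e), [opposite_arrow e]) 1)))
     - coeff_mult [:v k:] (coeff_mult [:0, 1:] (path_mult G y (Poly_Mapping.single (k, []) 1)))"
proof -
  have 1: "Poly_Mapping.single (k, [e, opposite_arrow e]) (1 :: 'k poly) =
      path_mult G (path_mult G (Poly_Mapping.single (k, []) 1) (Poly_Mapping.single (tail G e, [e]) 1))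
        (Poly_Mapping.single (tail G (opposite_arrow e), [opposite_arrow e]) 1)"
    if "tail G e = k" for e
    using that path_end_snoc[of G k "[]" e] by (simp add: path_mult_single)
  have 2: "Poly_Mapping.single (k, []) (smult (v k) [:0, 1:]) =
      coeff_mult [:v k:] (coeff_mult [:0, 1:] (Poly_Mapping.single (k, []) 1))"
    by (simp add: coeff_mult_single)
  show ?thesis
    unfolding relation_def mesh_relation_eq path_mult_diff_right path_mult_sum_right 2
      path_mult_coeff_mult
    by (intro arg_cong2[of _ _ _ _ minus] sum.cong refl)
      (auto simp: 1 path_mult_assoc path_mult_coeff_mult)
qed

text \<open>The link to \<open>I\<close>: right multiplication by a central relation becomes the
  generator in \<open>I_Suc_Suc\<close>.\<close>

lemma component_mult_relation:
  "component (Suc (Suc n)) j i (path_mult G y (relation k)) =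
     (if i = k then mesh i (component n j i y) - fscale (v i) (component n j i y) else 0)"
proof -
  have t: "component (Suc (Suc n)) j i (path_mult G (path_mult G (path_mult G y
        (Poly_Mapping.single (k, []) 1)) (Poly_Mapping.single (tail G e, [e]) 1))
        (Poly_Mapping.single (tail G (opposite_arrow e), [opposite_arrow e]) 1))
      = (if i = k then snoc_arrow (opposite_arrow e) (snoc_arrow e (component n j i y)) else 0)"
    if "e \<in> arcs G" "tail G e = k" for e
    unfolding component_arrow_right component_vertex_right using that
    by (auto simp: snoc_arrow_lin)
  show ?thesis
    unfolding mult_relation component_lin component_sum component_scale component_z(1)
      component_vertex_right
    using t by (simp add: mesh_def)
qed

lemma component_mult_relation_less_2:
  assumes "n < 2"
  shows "component n j i (path_mult G y (relation k)) = 0"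
proof -
  have t: "component n j i (path_mult G (path_mult G x (Poly_Mapping.single (tail G e, [e]) 1))
        (Poly_Mapping.single (tail G b, [b]) 1)) = 0" for x e b
    using assms by (cases n) (simp_all add: component_arrow_right component_arrow_right_0 snoc_arrow_lin)
  show ?thesis
    unfolding mult_relation component_lin component_sum component_scale component_z(2)[OF assms] t
    by simp
qed

lemma mult_relation_in_K: "path_mult G y (relation k) \<in> K"
  unfolding K_def
proof (intro CollectI allI)
  fix n j i
  show "component n j i (path_mult G y (relation k)) \<in> I j n i"
  proof (cases "n < 2")
    case True
    then show ?thesis by (simp add: component_mult_relation_less_2 zero_I)
  next
    case False
    then obtain m where n: "n = Suc (Suc m)" by (cases n; cases "n - 1") auto
    show ?thesis
    proof (cases "i = k")
      case True
      have "0 \<in> Ext (I j (Suc m)) i" by (simp add: Ext_iff div_arrow_lin zero_I)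
      then show ?thesis using True component_F[of m j i y]
        by (auto simp: n component_mult_relation I_Suc_Suc intro!: bexI[of _ "component m j i y"])
    qed (simp add: n component_mult_relation zero_I)
  qed
qed

abbreviation "R \<equiv> path_algebra G :: (('v, 'a + 'a) path \<Rightarrow>\<^sub>0 'k poly) ring"
abbreviation "CI \<equiv> central_ideal Q v"

lemma ring_R: "ring R"
  using fin_digraph.ring_path_algebra[OF fin_digraph_double_quiver[OF fin_Q]] .

lemma ideal_CI: "ideal CI R"
  using ideal_central_ideal[OF fin_Q] .

lemma R_simps: "carrier R = {f. Poly_Mapping.keys f \<subseteq> paths G}" "f \<oplus>\<^bsub>R\<^esub> g = f + g"
  "f \<otimes>\<^bsub>R\<^esub> g = path_mult G f g" "\<zero>\<^bsub>R\<^esub> = 0" "\<one>\<^bsub>R\<^esub> = scalar G 1"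
  by (simp_all add: path_algebra_def)

lemma relation_carrier: "relation k \<in> carrier R"
  using central_relations_carrier[OF fin_Q, of v] unfolding central_relations_eq by blast

lemma scalar_mult: "f \<in> carrier R \<Longrightarrow> path_mult G (scalar G b) f = coeff_mult b f"
proof -
  assume f: "f \<in> carrier R"
  have "scalar G b = coeff_mult b (scalar G 1)"
    by (rule poly_mapping_eqI) (simp add: scalar_def lookup_sum lookup_single sum_distrib_left when_def if_distrib cong: if_cong)
  then have "path_mult G (scalar G b) f = coeff_mult b (path_mult G (scalar G 1) f)"
    by (simp add: path_mult_coeff_mult)
  also have "path_mult G (scalar G 1) f = f"
    using fin_digraph.scalar_one_mult(1)[OF fin_digraph_double_quiver[OF fin_Q]] f
    by (simp add: R_simps)
  finally show ?thesis .
qed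

lemma relation_in_K: "relation k \<in> K"
proof -
  have "coeff_mult 1 (relation k) = relation k" by (rule poly_mapping_eqI) simp
  then show ?thesis
    using mult_relation_in_K[of "scalar G 1" k] scalar_mult[OF relation_carrier, of 1] by simp
qed

text \<open>Inside the carrier \<open>K\<close> is a two-sided ideal containing the relations, so
  minimality of the generated ideal applies.\<close>

lemma CI_subset_K: "CI \<subseteq> K"
proof -
  have minus: "- f \<in> K" if "f \<in> K" for f
  proof -
    have "- f = coeff_mult (- 1) f" by (rule poly_mapping_eqI) simp
    then show ?thesis using K_coeff_mult[OF that] by metis
  qed
  interpret ring R by (rule ring_R)
  have "ideal (K \<inter> carrier R) R"
  proof (rule idealI[OF ring_R])
    show "subgroup (K \<inter> carrier R) (add_monoid R)"
    proof (rule add.subgroupI)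
      show "K \<inter> carrier R \<noteq> {}" using K_0 by (auto simp: R_simps)
    next
      fix f assume f: "f \<in> K \<inter> carrier R"
      then have "\<ominus>\<^bsub>R\<^esub> f = - f"
        by (intro minus_equality) (auto simp: R_simps)
      then show "\<ominus>\<^bsub>R\<^esub> f \<in> K \<inter> carrier R" using f minus a_inv_closed[of f] by auto
    next
      fix f g assume "f \<in> K \<inter> carrier R" "g \<in> K \<inter> carrier R"
      then show "f \<oplus>\<^bsub>R\<^esub> g \<in> K \<inter> carrier R"
        using K_add[of f g] add.m_closed[of f g] by (auto simp: R_simps(2))
    qed auto
  next
    fix f g assume "f \<in> K \<inter> carrier R" "g \<in> carrier R"
    then show "g \<otimes>\<^bsub>R\<^esub> f \<in> K \<inter> carrier R" "f \<otimes>\<^bsub>R\<^esub> g \<in> K \<inter> carrier R"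
      using K_mult[of f g] m_closed by (auto simp: R_simps(1,3))
  qed
  moreover have "central_relations Q v \<subseteq> K \<inter> carrier R"
    unfolding central_relations_eq using relation_in_K relation_carrier by blast
  ultimately show ?thesis
    unfolding central_ideal_def using genideal_minimal by blast
qed

lemma CI_mult:
  assumes "f \<in> CI" "g \<in> carrier R"
  shows "path_mult G f g \<in> CI" "path_mult G g f \<in> CI"
  using ideal.I_l_closed[OF ideal_CI assms] ideal.I_r_closed[OF ideal_CI assms]
  by (simp_all add: R_simps)

lemma CI_add: "f \<in> CI \<Longrightarrow> g \<in> CI \<Longrightarrow> f + g \<in> CI"
  using additive_subgroup.a_closed[OF ideal.axioms(1)[OF ideal_CI], of f g] by (simp add: R_simps)

lemma CI_0: "0 \<in> CI"
  using additive_subgroup.zero_closed[OF ideal.axioms(1)[OF ideal_CI]] by (simp add: R_simps)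

lemma CI_sum: "(\<And>x. x \<in> A \<Longrightarrow> h x \<in> CI) \<Longrightarrow> sum h A \<in> CI"
  by (induction A rule: infinite_finite_induct) (auto simp: CI_0 CI_add)

lemma relation_in_CI: "relation k \<in> CI"
  unfolding central_ideal_def
  using ring.genideal_self[OF ring_R central_relations_carrier[OF fin_Q, of v]]
  unfolding central_relations_eq by blast

text \<open>The homogeneous elements of degree n in e_j R e_i. On them
  \<open>component n j i\<close> is a bijection onto \<open>F j n i\<close>, so that questions about
  the quotient become linear algebra.\<close>

definition W :: "nat \<Rightarrow> 'v \<Rightarrow> 'v \<Rightarrow> (('v, 'a + 'a) path \<Rightarrow>\<^sub>0 'k poly) set" where
  "W n j i = {w. \<forall>u p m. poly.coeff (Poly_Mapping.lookup w (u, p)) m \<noteq> 0 \<longrightarrow>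
     u = j \<and> walk j (rev p) i \<and> length p + 2 * m = n}"

lemma W_I:
  assumes "\<And>u p m. poly.coeff (Poly_Mapping.lookup w (u, p)) m \<noteq> 0 \<Longrightarrow>
     u = j \<and> walk j (rev p) i \<and> length p + 2 * m = n"
  shows "w \<in> W n j i"
  using assms unfolding W_def by blast

lemma W_D:
  assumes "w \<in> W n j i" "poly.coeff (Poly_Mapping.lookup w (u, p)) m \<noteq> 0"
  shows "u = j" "walk j (rev p) i" "length p + 2 * m = n"
  using assms unfolding W_def by blast+

lemma W_lookup_nonzero:
  assumes "w \<in> W n j i" "Poly_Mapping.lookup w (u, p) \<noteq> 0"
  shows "u = j" "walk j (rev p) i"
proof -
  obtain m where "poly.coeff (Poly_Mapping.lookup w (u, p)) m \<noteq> 0"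
    using assms(2) by (auto simp: poly_eq_iff)
  from W_D[OF assms(1) this] show "u = j" "walk j (rev p) i" by auto
qed

lemma W_0: "0 \<in> W n j i"
  by (simp add: W_def)

lemma W_add:
  assumes "f \<in> W n j i" "g \<in> W n j i" shows "f + g \<in> W n j i"
proof (rule W_I)
  fix u p m assume "poly.coeff (Poly_Mapping.lookup (f + g) (u, p)) m \<noteq> 0"
  then have "poly.coeff (Poly_Mapping.lookup f (u, p)) m \<noteq> 0
      \<or> poly.coeff (Poly_Mapping.lookup g (u, p)) m \<noteq> 0"
    by (auto simp: lookup_add)
  then show "u = j \<and> walk j (rev p) i \<and> length p + 2 * m = n"
    using W_D[OF assms(1)] W_D[OF assms(2)] by blast
qed

lemma W_scale:
  assumes "f \<in> W n j i" shows "coeff_mult [:b:] f \<in> W n j i"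
proof (rule W_I)
  fix u p m assume "poly.coeff (Poly_Mapping.lookup (coeff_mult [:b:] f) (u, p)) m \<noteq> 0"
  then have "poly.coeff (Poly_Mapping.lookup f (u, p)) m \<noteq> 0" by auto
  then show "u = j \<and> walk j (rev p) i \<and> length p + 2 * m = n"
    using W_D[OF assms] by blast
qed

lemma W_diff:
  assumes "f \<in> W n j i" "g \<in> W n j i" shows "f - g \<in> W n j i"
proof -
  have "f - g = f + coeff_mult [:- 1:] g"
    by (rule poly_mapping_eqI) (simp add: lookup_add lookup_minus)
  then show ?thesis using W_add[OF assms(1) W_scale[OF assms(2)]] by metis
qed

lemma W_sum: "(\<And>x. x \<in> A \<Longrightarrow> h x \<in> W n j i) \<Longrightarrow> sum h A \<in> W n j i"
  by (induction A rule: infinite_finite_induct) (auto simp: W_0 W_add)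

lemma W_z:
  assumes "f \<in> W n j i" shows "coeff_mult [:0, 1:] f \<in> W (Suc (Suc n)) j i"
proof (rule W_I)
  fix u p m assume *: "poly.coeff (Poly_Mapping.lookup (coeff_mult [:0, 1:] f) (u, p)) m \<noteq> 0"
  then obtain l where m: "m = Suc l" by (cases m) auto
  with * have "poly.coeff (Poly_Mapping.lookup f (u, p)) l \<noteq> 0" by simp
  from W_D[OF assms this] m
  show "u = j \<and> walk j (rev p) i \<and> length p + 2 * m = Suc (Suc n)" by simp
qed

lemma W_arrow:
  assumes "f \<in> W n j (tail G a)" "a \<in> arcs G"
  shows "path_mult G f (Poly_Mapping.single (tail G a, [a]) 1) \<in> W (Suc n) j (head G a)"
proof (rule W_I)
  fix u p m
  assume *: "poly.coeff (Poly_Mapping.lookup (path_mult G f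
    (Poly_Mapping.single (tail G a, [a]) 1)) (u, p)) m \<noteq> 0"
  then have p: "p \<noteq> []" "last p = a" "poly.coeff (Poly_Mapping.lookup f (u, butlast p)) m \<noteq> 0"
    by (auto simp: lookup_mult_arrow_right split: if_splits)
  obtain q where q: "p = q @ [a]" using p(1,2) by (metis append_butlast_last_id)
  with p(3) have "poly.coeff (Poly_Mapping.lookup f (u, q)) m \<noteq> 0" by simp
  from W_D[OF assms(1) this] assms(2)
  show "u = j \<and> walk j (rev p) (head G a) \<and> length p + 2 * m = Suc n" by (simp add: q)
qed

lemma W_vertex:
  assumes "f \<in> W n j i"
  shows "path_mult G f (Poly_Mapping.single (i, []) 1) = f"
    "path_mult G (Poly_Mapping.single (j, []) 1) f = f"
proof -
  show "path_mult G f (Poly_Mapping.single (i, []) 1) = f"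
  proof (rule poly_mapping_eqI)
    fix x :: "('v, 'a + 'a) path"
    show "Poly_Mapping.lookup (path_mult G f (Poly_Mapping.single (i, []) 1)) x = Poly_Mapping.lookup f x"
      using W_lookup_nonzero(2)[OF assms, of "fst x" "snd x"] W_lookup_nonzero(1)[OF assms, of "fst x" "snd x"]
        walk_path_end[of j "rev (snd x)" i]
      by (cases x) (auto simp: lookup_mult_vertex_right)
  qed
  show "path_mult G (Poly_Mapping.single (j, []) 1) f = f"
  proof (rule poly_mapping_eqI)
    fix x :: "('v, 'a + 'a) path"
    show "Poly_Mapping.lookup (path_mult G (Poly_Mapping.single (j, []) 1) f) x = Poly_Mapping.lookup f x"
      using W_lookup_nonzero(1)[OF assms, of "fst x" "snd x"]
      by (cases x) (auto simp: lookup_mult_vertex_left)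
  qed
qed

lemma W_carrier:
  assumes "f \<in> W n j i" shows "f \<in> carrier R"
proof -
  have "x \<in> paths G" if "x \<in> Poly_Mapping.keys f" for x
    using W_lookup_nonzero[OF assms, of "fst x" "snd x"] that walk_iff[of j "rev (snd x)" i]
    by (cases x) (auto simp: in_keys_iff)
  then show ?thesis by (auto simp: R_simps)
qed

lemma W_relation:
  assumes "f \<in> W n j i"
  shows "path_mult G f (relation i) \<in> W (Suc (Suc n)) j i"
proof -
  have t: "coeff_mult [:arrow_sign e:] (path_mult G (path_mult G f (Poly_Mapping.single (tail G e, [e]) 1))
      (Poly_Mapping.single (tail G (opposite_arrow e), [opposite_arrow e]) 1)) \<in> W (Suc (Suc n)) j i"
    if "e \<in> arcs G" "tail G e = i" for e
  proof -
    have "path_mult G f (Poly_Mapping.single (tail G e, [e]) 1) \<in> W (Suc n) j (tail G (opposite_arrow e))"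
      using W_arrow[of f n j e] assms that by simp
    from W_scale[OF W_arrow[OF this]] that show ?thesis by simp
  qed
  show ?thesis
    unfolding mult_relation W_vertex[OF assms]
    by (rule W_diff[OF W_sum W_scale[OF W_z[OF assms]]]) (rule t, auto)
qed

lemma component_W_eq_0:
  assumes "w \<in> W n j i" "component n j i w = 0"
  shows "w = 0"
proof (rule poly_mapping_eqI, rule poly_eqI)
  fix x :: "('v, 'a + 'a) path" and m
  obtain u p where x: "x = (u, p)" by (cases x)
  show "poly.coeff (Poly_Mapping.lookup w x) m = poly.coeff (Poly_Mapping.lookup 0 x) m"
  proof (rule ccontr)
    assume "poly.coeff (Poly_Mapping.lookup w x) m \<noteq> poly.coeff (Poly_Mapping.lookup 0 x) m"
    then have nz: "poly.coeff (Poly_Mapping.lookup w (u, p)) m \<noteq> 0" by (simp add: x)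
    note d = W_D[OF assms(1) nz]
    have "(n - length p) div 2 = m" using d(3) by auto
    moreover have "length p \<le> n" "even (n + length p)" using d(3) by auto
    ultimately have "component n j i w (rev p) = poly.coeff (Poly_Mapping.lookup w (u, p)) m"
      using d(1,2) by (simp add: component_def)
    then show False using nz assms(2) by simp
  qed
qed

lemma component_W_surj:
  assumes "f \<in> F j n i"
  shows "\<exists>w\<in>W n j i. component n j i w = f"
proof
  let ?S = "\<Union>m\<le>n. walks j m i"
  let ?w = "\<Sum>p\<in>?S. Poly_Mapping.single (j, rev p) (monom (f p) ((n - length p) div 2))"
  have fin: "finite ?S" using finite_walks by simp
  have l: "Poly_Mapping.lookup ?w (u, q) =
      (if u = j \<and> rev q \<in> ?S then monom (f (rev q)) ((n - length q) div 2) else 0)" for u q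
  proof -
    have "Poly_Mapping.lookup ?w (u, q) = (\<Sum>p\<in>?S. if p = rev q then
        (if u = j then monom (f p) ((n - length p) div 2) else 0) else 0)"
      unfolding lookup_sum by (intro sum.cong refl) (auto simp: lookup_single when_def)
    then show ?thesis
      by (cases "u = j"; cases "rev q \<in> ?S")
        (simp_all only: sum.delta[OF fin] length_rev if_True if_False simp_thms)
  qed
  have S: "p \<in> ?S" "length p \<le> n" "even (n + length p)" "walk j p i" if "f p \<noteq> 0" for p
    using assms that unfolding F_def walks_def by blast+
  show "?w \<in> W n j i"
  proof (rule W_I)
    fix u p m assume "poly.coeff (Poly_Mapping.lookup ?w (u, p)) m \<noteq> 0"
    then have "u = j" "f (rev p) \<noteq> 0" "m = (n - length p) div 2"
      unfolding l by (auto split: if_splits)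
    then show "u = j \<and> walk j (rev p) i \<and> length p + 2 * m = n"
      using S[of "rev p"] by auto
  qed
  show "component n j i ?w = f"
  proof
    fix p show "component n j i ?w p = f p"
    proof (cases "walk j p i \<and> length p \<le> n \<and> even (n + length p)")
      case True
      then have "p \<in> ?S" by (auto simp: walks_def)
      then show ?thesis
        using True by (simp only: component_def l rev_rev_ident length_rev simp_thms if_True coeff_monom)
    next
      case False
      moreover from False have "f p = 0" using S[of p] by blast
      ultimately show ?thesis by (simp only: component_def if_False)
    qed
  qed
qed

text \<open>The lift retraces the recursion of \<open>I\<close>: a lift of the coefficient
  \<open>y\<close> times the relation, plus lifts of the parts ending in each arrow times that
  arrow.\<close>

lemma I_lift: "f \<in> I j n i \<Longrightarrow> \<exists>w\<in>CI \<inter> W n j i. component n j i w = f"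
proof (induction n arbitrary: i f rule: induct_nat_012)
  case (ge2 n)
  let ?A = "{a. a \<in> arcs G \<and> head G a = i}"
  from ge2(3) obtain y where y: "y \<in> F j n i"
    "f - (mesh i y - fscale (v i) y) \<in> Ext (I j (Suc n)) i" (is "?g \<in> _") by (auto simp: I_Suc_Suc)
  obtain w where w: "w \<in> W n j i" "component n j i w = y" using component_W_surj[OF y(1)] by blast
  have "\<forall>a\<in>?A. \<exists>x. x \<in> CI \<inter> W (Suc n) j (tail G a) \<and> component (Suc n) j (tail G a) x = div_arrow a ?g"
    using ge2(2) ExtD[OF y(2)] by blast
  from bchoice[OF this] obtain h where h: "\<forall>a\<in>?A. h a \<in> CI \<inter> W (Suc n) j (tail G a)
      \<and> component (Suc n) j (tail G a) (h a) = div_arrow a ?g" by (elim exE)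
  let ?s = "\<Sum>a\<in>?A. path_mult G (h a) (Poly_Mapping.single (tail G a, [a]) 1)"
  have arrow: "Poly_Mapping.single (tail G a, [a]) 1 \<in> carrier R" if "a \<in> arcs G" for a
    using that walk_iff[of "tail G a" "[a]" "head G a"] by (simp add: R_simps)
  have "path_mult G w (relation i) \<in> CI"
    by (rule CI_mult(2)[OF relation_in_CI W_carrier[OF w(1)]])
  moreover have "?s \<in> CI" using h arrow by (intro CI_sum CI_mult(1)) auto
  moreover have "?s \<in> W (Suc (Suc n)) j i"
    using h W_arrow[of _ "Suc n" j] by (intro W_sum) auto
  ultimately have "path_mult G w (relation i) + ?s \<in> CI \<inter> W (Suc (Suc n)) j i"
    using CI_add W_add W_relation[OF w(1)] by blast
  moreover have "component (Suc (Suc n)) j i ?s = (\<Sum>a\<in>?A. snoc_arrow a (div_arrow a ?g))"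
    unfolding component_sum component_arrow_right using h by (intro sum.cong refl) auto
  then have "component (Suc (Suc n)) j i ?s = ?g" using Ext_sum[OF y(2)] by simp
  then have "component (Suc (Suc n)) j i (path_mult G w (relation i) + ?s) = f"
    by (simp add: component_lin component_mult_relation w(2))
  ultimately show ?case by blast
qed (use CI_0 W_0 component_lin in \<open>auto intro!: bexI[of _ 0]\<close>)

text \<open>Combines \<open>CI_subset_K\<close> with \<open>I_lift\<close>: a homogeneous element is
  determined by its component, so it equals the lift.\<close>

lemma CI_iff:
  assumes "w \<in> W n j i"
  shows "w \<in> CI \<longleftrightarrow> component n j i w \<in> I j n i"
proof
  assume "w \<in> CI"
  then show "component n j i w \<in> I j n i" using CI_subset_K unfolding K_def by blast
next
  assume "component n j i w \<in> I j n i"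
  then obtain x where x: "x \<in> CI" "x \<in> W n j i" "component n j i x = component n j i w"
    using I_lift by blast
  have "w - x = 0"
    by (rule component_W_eq_0[OF W_diff[OF assms x(2)]]) (simp add: component_lin x(3))
  then show "w \<in> CI" using x(1) by simp
qed

section \<open>The quotient ring, its base field and its graded pieces\<close>

abbreviation "B \<equiv> central_extension Q v"
abbreviation "res \<equiv> residue_class Q v"

lemma ring_B: "ring B"
  by (rule ring_central_extension[OF fin_Q])

lemma res_hom: "ring_hom_ring R B res"
proof (rule ring_hom_ringI2[OF ring_R ring_B])
  show "res \<in> ring_hom R B"
    unfolding central_extension_def by (rule ideal.rcos_ring_hom[OF ideal_CI])
qed

lemma res_simps:
  assumes "f \<in> carrier R" "g \<in> carrier R"
  shows "res f \<in> carrier B" "res f \<otimes>\<^bsub>B\<^esub> res g = res (path_mult G f g)" "res f \<oplus>\<^bsub>B\<^esub> res g = res (f + g)"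
proof -
  interpret ring_hom_ring R B res by (rule res_hom)
  show "res f \<in> carrier B" using assms by simp
  show "res f \<otimes>\<^bsub>B\<^esub> res g = res (path_mult G f g)" using hom_mult[OF assms] by (simp add: R_simps)
  show "res f \<oplus>\<^bsub>B\<^esub> res g = res (f + g)" using hom_add[OF assms] by (simp add: R_simps)
qed

lemma R_uminus: "f \<in> carrier R \<Longrightarrow> \<ominus>\<^bsub>R\<^esub> f = - f"
proof -
  assume f: "f \<in> carrier R"
  interpret ring R by (rule ring_R)
  show ?thesis
    using f by (intro minus_equality) (auto simp: R_simps)
qed

lemma R_minus: "f \<in> carrier R \<Longrightarrow> g \<in> carrier R \<Longrightarrow> f \<ominus>\<^bsub>R\<^esub> g = f - g"
  by (simp add: a_minus_def R_uminus R_simps(2))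

lemma res_eq_iff:
  assumes "f \<in> carrier R" "g \<in> carrier R"
  shows "res f = res g \<longleftrightarrow> f - g \<in> CI"
  using ring.quotient_eq_iff_same_a_r_cos[OF ring_R ideal_CI assms] R_minus[OF assms] by simp

lemma res_0: "res 0 = \<zero>\<^bsub>B\<^esub>"
proof -
  interpret ring_hom_ring R B res by (rule res_hom)
  show ?thesis using hom_zero by (simp add: R_simps)
qed

lemma vertex_carrier: "Poly_Mapping.single (j, []) b \<in> carrier R"
  using trivial_path_in_paths[of j G] verts_G by (simp add: R_simps)

lemma W_of_homogeneous:
  assumes "f \<in> carrier R" "homogeneous n f"
  shows "path_mult G (path_mult G (Poly_Mapping.single (j, []) 1) f) (Poly_Mapping.single (i, []) 1) \<in> W n j i"
proof (rule W_I)
  fix u p m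
  assume "poly.coeff (Poly_Mapping.lookup (path_mult G (path_mult G (Poly_Mapping.single (j, []) 1) f)
    (Poly_Mapping.single (i, []) 1)) (u, p)) m \<noteq> 0"
  then have *: "path_end G (u, p) = i" "u = j" "poly.coeff (Poly_Mapping.lookup f (u, p)) m \<noteq> 0"
    by (auto simp: lookup_mult_vertex_right lookup_mult_vertex_left split: if_splits)
  then have "(u, p) \<in> Poly_Mapping.keys f" by (auto simp: in_keys_iff)
  then have "(u, p) \<in> paths G" using assms(1) by (auto simp: R_simps)
  moreover have "length p + 2 * m = n" using assms(2) *(3) by (auto simp: homogeneous_def)
  ultimately show "u = j \<and> walk j (rev p) i \<and> length p + 2 * m = n"
    using * by (simp add: walk_iff)
qed

lemma W_homogeneous: "w \<in> W n j i \<Longrightarrow> homogeneous n w"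
  unfolding homogeneous_def using W_D(3)[of w n j i] by (metis prod.collapse)

lemma peirce_piece_eq: "peirce_piece Q v (graded_piece Q v n) j i = res ` W n j i"
proof -
  let ?e = "\<lambda>k. Poly_Mapping.single (k, []) 1"
  have mult: "res (?e j) \<otimes>\<^bsub>B\<^esub> res f \<otimes>\<^bsub>B\<^esub> res (?e i) = res (path_mult G (path_mult G (?e j) f) (?e i))"
    if "f \<in> carrier R" for f
  proof -
    have "path_mult G (?e j) f \<in> carrier R"
      using ring.ring_simprules(5)[OF ring_R vertex_carrier that] by (simp add: R_simps(3))
    then show ?thesis using that vertex_carrier by (simp add: res_simps)
  qed
  show ?thesis
  proof (intro subset_antisym subsetI)
    fix x assume "x \<in> peirce_piece Q v (graded_piece Q v n) j i"
    then obtain f where f: "f \<in> carrier R" "homogeneous n f"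
      "x = res (?e j) \<otimes>\<^bsub>B\<^esub> res f \<otimes>\<^bsub>B\<^esub> res (?e i)"
      unfolding peirce_piece_def graded_piece_def by blast
    show "x \<in> res ` W n j i"
      unfolding f(3) mult[OF f(1)] by (rule imageI[OF W_of_homogeneous[OF f(1,2)]])
  next
    fix x assume "x \<in> res ` W n j i"
    then obtain w where w: "w \<in> W n j i" "x = res w" by blast
    have c: "w \<in> carrier R" by (rule W_carrier[OF w(1)])
    have "x = res (?e j) \<otimes>\<^bsub>B\<^esub> res w \<otimes>\<^bsub>B\<^esub> res (?e i)"
      unfolding mult[OF c] W_vertex[OF w(1)] by (rule w(2))
    then show "x \<in> peirce_piece Q v (graded_piece Q v n) j i"
      unfolding peirce_piece_def graded_piece_def using c W_homogeneous[OF w(1)] by blast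
  qed
qed

lemma lookup_scalar: "Poly_Mapping.lookup (scalar G b) (u, p) = (if p = [] then b else 0)"
  by (auto simp: scalar_def lookup_sum lookup_single when_def verts_G sum.delta' cong: if_cong)

lemma scalar_carrier: "scalar G b \<in> carrier R"
proof -
  have "x \<in> paths G" if "x \<in> Poly_Mapping.keys (scalar G b)" for x
    using that trivial_path_in_paths[of "fst x" G] verts_G
    by (cases x) (auto simp: in_keys_iff lookup_scalar split: if_splits)
  then show ?thesis by (auto simp: R_simps)
qed

lemma scalar_simps:
  "scalar G a + scalar G b = scalar G (a + b)" "- scalar G a = scalar G (- a)"
  "path_mult G (scalar G a) (scalar G b) = scalar G (a * b)"
  "scalar G a = scalar G b \<longleftrightarrow> a = b" "scalar G (0 :: 'k poly) = 0"
  for a b :: "'k poly"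
proof -
  show "scalar G a + scalar G b = scalar G (a + b)" "- scalar G a = scalar G (- a)" "scalar G 0 = (0 :: _ \<Rightarrow>\<^sub>0 'k poly)"
    by (rule poly_mapping_eqI, case_tac k, simp add: lookup_scalar lookup_add)+
  show "path_mult G (scalar G a) (scalar G b) = scalar G (a * b)"
    unfolding scalar_mult[OF scalar_carrier]
    by (rule poly_mapping_eqI, case_tac k, simp add: lookup_scalar)
  show "scalar G a = scalar G b \<longleftrightarrow> a = b"
  proof
    assume "scalar G a = scalar G b"
    from arg_cong[OF this, of "\<lambda>f. Poly_Mapping.lookup f (undefined, [])"] show "a = b"
      by (simp add: lookup_scalar)
  qed simp
qed

lemma subfield_scalars: "subfield (range (\<lambda>b. scalar G [:b:])) R"
proof (rule ring.subfieldI[OF ring_R])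
  let ?S = "range (\<lambda>b. scalar G [:b:]) :: (('v, 'a + 'a) path \<Rightarrow>\<^sub>0 'k poly) set"
  have one: "\<one>\<^bsub>R\<^esub> = scalar G [:1:]" by (simp add: R_simps one_pCons)
  show "subcring ?S R"
  proof (rule ring.subcringI[OF ring_R ring.subringI[OF ring_R]])
    show "?S \<subseteq> carrier R" using scalar_carrier by blast
    show "\<one>\<^bsub>R\<^esub> \<in> ?S" unfolding one by blast
    fix x assume "x \<in> ?S"
    then obtain a where x: "x = scalar G [:a:]" by blast
    have "\<ominus>\<^bsub>R\<^esub> x = scalar G [:- a:]" unfolding x R_uminus[OF scalar_carrier] scalar_simps by simp
    then show "\<ominus>\<^bsub>R\<^esub> x \<in> ?S" by blast
    fix y assume "y \<in> ?S"
    then obtain b where y: "y = scalar G [:b:]" by blast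
    have "x \<otimes>\<^bsub>R\<^esub> y = scalar G [:a * b:]" "x \<oplus>\<^bsub>R\<^esub> y = scalar G [:a + b:]"
      unfolding x y R_simps scalar_simps by simp_all
    then show "x \<otimes>\<^bsub>R\<^esub> y \<in> ?S" "x \<oplus>\<^bsub>R\<^esub> y \<in> ?S" by blast+
    show "x \<otimes>\<^bsub>R\<^esub> y = y \<otimes>\<^bsub>R\<^esub> x"
      unfolding x y R_simps scalar_simps by (simp add: mult.commute)
  qed
  show "Units (R \<lparr>carrier := ?S\<rparr>) = ?S - {\<zero>\<^bsub>R\<^esub>}"
  proof (intro subset_antisym subsetI)
    fix y assume "y \<in> Units (R \<lparr>carrier := ?S\<rparr>)"
    then obtain x where xy: "y \<in> ?S" "x \<otimes>\<^bsub>R\<^esub> y = \<one>\<^bsub>R\<^esub>" unfolding Units_def by auto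
    have "y \<noteq> 0"
    proof
      assume "y = 0"
      then have "scalar G 0 = scalar G (1 :: 'k poly)" using xy(2) by (simp add: R_simps scalar_simps)
      then show False unfolding scalar_simps(4) by simp
    qed
    then show "y \<in> ?S - {\<zero>\<^bsub>R\<^esub>}" using xy(1) by (simp add: R_simps)
  next
    fix y assume y: "y \<in> ?S - {\<zero>\<^bsub>R\<^esub>}"
    then obtain a where a: "y = scalar G [:a:]" by blast
    have "a \<noteq> 0" using y a by (auto simp: R_simps scalar_simps)
    then have "y \<otimes>\<^bsub>R\<^esub> scalar G [:inverse a:] = \<one>\<^bsub>R\<^esub>" "scalar G [:inverse a:] \<otimes>\<^bsub>R\<^esub> y = \<one>\<^bsub>R\<^esub>"
      unfolding a R_simps scalar_simps by (simp_all add: one_pCons)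
    then show "y \<in> Units (R \<lparr>carrier := ?S\<rparr>)"
      using y unfolding Units_def by auto
  qed
qed

lemma base_field_eq: "base_field Q v = res ` range (\<lambda>b. scalar G [:b:])"
  unfolding base_field_def by blast

lemma subfield_base_field: "subfield (base_field Q v) B"
  unfolding base_field_eq
proof (rule ring_hom_ring.img_is_subfield(2)[OF res_hom subfield_scalars])
  \<comment> \<open>The ideal vanishes in degree 0, so the unit survives; \<open>undefined\<close>
    stands for an arbitrary vertex.\<close>
  have "res (scalar G 1) \<noteq> res 0"
  proof
    assume "res (scalar G 1) = res 0"
    then have "scalar G 1 - 0 \<in> CI"
      using res_eq_iff[OF scalar_carrier, of 0 1] by (simp add: R_simps)
    then have "scalar G 1 \<in> K" using CI_subset_K by auto
    then have "component 0 undefined undefined (scalar G 1) \<in> I undefined 0 undefined"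
      unfolding K_def by blast
    then have "component 0 undefined undefined (scalar G 1) [] = 0" by simp
    then show False by (simp add: component_def lookup_scalar)
  qed
  moreover have "res (scalar G 1) = \<one>\<^bsub>B\<^esub>"
  proof -
    interpret ring_hom_ring R B res by (rule res_hom)
    show ?thesis using hom_one by (simp add: R_simps)
  qed
  ultimately show "\<one>\<^bsub>B\<^esub> \<noteq> \<zero>\<^bsub>B\<^esub>" by (simp add: res_0)
qed

text \<open>As \<open>U\<close> grows from \<open>I j n i\<close> to \<open>F j n i\<close>, this
  grows from zero to the whole Peirce piece, which allows counting dimensions in the function
  space.\<close>

definition piece :: "'v \<Rightarrow> nat \<Rightarrow> 'v \<Rightarrow> (('a + 'a) list \<Rightarrow> 'k) set
    \<Rightarrow> (('v, 'a + 'a) path \<Rightarrow>\<^sub>0 'k poly) set set" where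
  "piece j n i U = res ` {w \<in> W n j i. component n j i w \<in> U}"

lemma res_in_piece_iff:
  assumes "I j n i \<subseteq> U" "fs.subspace U" "w \<in> W n j i"
  shows "res w \<in> piece j n i U \<longleftrightarrow> component n j i w \<in> U"
proof
  assume "res w \<in> piece j n i U"
  then obtain x where x: "x \<in> W n j i" "component n j i x \<in> U" "res w = res x"
    unfolding piece_def by blast
  then have "w - x \<in> CI" using res_eq_iff W_carrier assms(3) by blast
  then have "component n j i (w - x) \<in> U"
    using CI_iff[OF W_diff[OF assms(3) x(1)]] assms(1) by blast
  from fs.subspace_add[OF assms(2) this x(2)] show "component n j i w \<in> U"
    by (simp add: component_lin)
qed (use assms(3) in \<open>auto simp: piece_def\<close>)

text \<open>\<open>ring.dimension\<close> is defined inductively by line extensions; adjoining one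
  vector to \<open>U\<close> corresponds to one such extension.\<close>

lemma piece_line_extension:
  assumes "fs.subspace U" "x \<in> W n j i"
  shows "piece j n i (fs.span (insert (component n j i x) U)) =
    ring.line_extension B (base_field Q v) (res x) (piece j n i U)"
proof (intro subset_antisym subsetI)
  have xc: "x \<in> carrier R" by (rule W_carrier[OF assms(2)])
  have scale: "res (scalar G [:b:]) \<otimes>\<^bsub>B\<^esub> res x \<oplus>\<^bsub>B\<^esub> res w = res (coeff_mult [:b:] x + w)"
    if "w \<in> W n j i" for b w
  proof -
    have "coeff_mult [:b:] x \<in> carrier R" by (rule W_carrier[OF W_scale[OF assms(2)]])
    then show ?thesis
      using res_simps(2)[OF scalar_carrier xc] res_simps(3)[OF _ W_carrier[OF that]]
      by (simp add: scalar_mult[OF xc])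
  qed
  {
    fix y assume "y \<in> piece j n i (fs.span (insert (component n j i x) U))"
    then obtain w where w: "w \<in> W n j i" "y = res w"
      "component n j i w \<in> fs.span (insert (component n j i x) U)" unfolding piece_def by blast
    then obtain b where b: "component n j i w - fscale b (component n j i x) \<in> U"
      using assms(1) unfolding fs.span_breakdown_eq by (metis fs.span_eq_iff)
    define u where "u = w - coeff_mult [:b:] x"
    have u: "u \<in> W n j i" unfolding u_def by (rule W_diff[OF w(1) W_scale[OF assms(2)]])
    have "component n j i u \<in> U" using b by (simp add: u_def component_lin component_scale)
    then have "res u \<in> piece j n i U" using u unfolding piece_def by blast
    moreover have "y = res (scalar G [:b:]) \<otimes>\<^bsub>B\<^esub> res x \<oplus>\<^bsub>B\<^esub> res u"
      unfolding scale[OF u] by (simp add: u_def w(2))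
    moreover have "res (scalar G [:b:]) \<in> base_field Q v" unfolding base_field_def by blast
    ultimately show "y \<in> ring.line_extension B (base_field Q v) (res x) (piece j n i U)"
      unfolding ring.line_extension_mem_iff[OF ring_B] by blast
  }
  {
    fix y assume "y \<in> ring.line_extension B (base_field Q v) (res x) (piece j n i U)"
    then obtain k z where kz: "k \<in> base_field Q v" "z \<in> piece j n i U" "y = k \<otimes>\<^bsub>B\<^esub> res x \<oplus>\<^bsub>B\<^esub> z"
      unfolding ring.line_extension_mem_iff[OF ring_B] by blast
    obtain b where b: "k = res (scalar G [:b:])" using kz(1) unfolding base_field_def by blast
    obtain w where w: "w \<in> W n j i" "component n j i w \<in> U" "z = res w"
      using kz(2) unfolding piece_def by blast
    have "component n j i (coeff_mult [:b:] x + w) - fscale b (component n j i x) \<in> fs.span U"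
      using fs.span_base[OF w(2)] by (simp add: component_lin component_scale)
    then have "component n j i (coeff_mult [:b:] x + w) \<in> fs.span (insert (component n j i x) U)"
      unfolding fs.span_breakdown_eq by blast
    then show "y \<in> piece j n i (fs.span (insert (component n j i x) U))"
      unfolding kz(3) b w(3) scale[OF w(1)] piece_def
      using W_add[OF W_scale[OF assms(2)] w(1)] by blast
  }
qed

text \<open>Induction on the codimension \<open>e\<close> of \<open>U\<close>. A vector outside
  \<open>U\<close> lifts to a class outside the piece because \<open>U\<close> contains the ideal
  part \<open>I j n i\<close>.\<close>

lemma dimension_piece:
  assumes "I j n i \<subseteq> U" "U \<subseteq> F j n i" "fs.subspace U"
    and "ring.dimension B d (base_field Q v) (piece j n i U)"
    and "fs.dim (F j n i) = fs.dim U + e"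
  shows "ring.dimension B (d + e) (base_field Q v) (piece j n i (F j n i))"
  using assms
proof (induction e arbitrary: U d)
  case 0
  have "U = F j n i"
    by (rule fs.subspace_eq_if_dim_le[OF fin_dim_F 0(2,3) subspace_F]) (simp add: 0(5))
  with 0(4) show ?case by (simp only: add_0_right)
next
  case (Suc e)
  have "U \<noteq> F j n i"
  proof
    assume "U = F j n i"
    with Suc.prems(5) show False by simp
  qed
  then obtain f where f: "f \<in> F j n i" "f \<notin> U" using Suc.prems(2) by blast
  obtain x where x: "x \<in> W n j i" "component n j i x = f" using component_W_surj[OF f(1)] by blast
  let ?V = "fs.span (insert f U)"
  have "ring.dimension B (Suc d) (base_field Q v) (piece j n i ?V)"
  proof -
    have "res x \<notin> piece j n i U"
      using res_in_piece_iff[OF Suc.prems(1,3) x(1)] x(2) f(2) by simp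
    moreover have "res x \<in> carrier B" using res_simps(1) W_carrier[OF x(1)] by blast
    ultimately show ?thesis
      using ring.Suc_dim[OF ring_B _ _ Suc.prems(4)] piece_line_extension[OF Suc.prems(3) x(1)] x(2) by simp
  qed
  moreover have "I j n i \<subseteq> ?V" using Suc.prems(1) fs.span_superset[of "insert f U"] by blast
  moreover have "?V \<subseteq> F j n i" using f(1) Suc.prems(2) by (intro fs.span_minimal subspace_F) blast
  moreover have "fs.dim (F j n i) = fs.dim ?V + e"
    using fs.dim_span_insert[OF fs.fin_dim_subset[OF fin_dim_F Suc.prems(2)] Suc.prems(3) f(2)]
      Suc.prems(5) by simp
  ultimately show ?case using Suc.IH[of ?V "Suc d"] fs.subspace_span by simp
qed

lemma dimension_peirce_piece:
  "(THE d. ring.dimension B d (base_field Q v) (peirce_piece Q v (graded_piece Q v n) j i)) =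
     nat (bdim j n i)"
proof -
  let ?e = "fs.dim (F j n i) - fs.dim (I j n i)"
  have "piece j n i (I j n i) = {\<zero>\<^bsub>B\<^esub>}"
  proof (intro subset_antisym subsetI)
    fix y assume "y \<in> piece j n i (I j n i)"
    then obtain w where w: "w \<in> W n j i" "component n j i w \<in> I j n i" "y = res w"
      unfolding piece_def by blast
    then have "w - 0 \<in> CI" using CI_iff by simp
    then have "res w = res 0" using res_eq_iff[OF W_carrier[OF w(1)] W_carrier[OF W_0]] by blast
    then show "y \<in> {\<zero>\<^bsub>B\<^esub>}" using w(3) res_0 by simp
  next
    fix y assume "y \<in> {\<zero>\<^bsub>B\<^esub>}"
    then have "y = res 0" using res_0 by simp
    then show "y \<in> piece j n i (I j n i)"
      unfolding piece_def using W_0 zero_I by (auto simp: component_lin)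
  qed
  then have "ring.dimension B 0 (base_field Q v) (piece j n i (I j n i))"
    using ring.zero_dim[OF ring_B] by simp
  moreover have le: "fs.dim (I j n i) \<le> fs.dim (F j n i)"
    by (rule fs.dim_mono_finite[OF fin_dim_F I_subset_F subspace_I subspace_F])
  ultimately have "ring.dimension B (0 + ?e) (base_field Q v) (piece j n i (F j n i))"
    by (intro dimension_piece[OF order_refl I_subset_F subspace_I]) simp_all
  moreover have "piece j n i (F j n i) = peirce_piece Q v (graded_piece Q v n) j i"
    unfolding peirce_piece_eq piece_def using component_F by blast
  ultimately have d: "ring.dimension B ?e (base_field Q v) (peirce_piece Q v (graded_piece Q v n) j i)"
    by simp
  \<comment> \<open>The dimension over a subfield is unique, so the definite description denotes
    it.\<close>
  have "(THE d. ring.dimension B d (base_field Q v) (peirce_piece Q v (graded_piece Q v n) j i)) = ?e"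
    using d ring.dimension_is_inj[OF ring_B subfield_base_field] by blast
  also have "\<dots> = nat (bdim j n i)" using le by (simp add: bdim_def)
  finally show ?thesis .
qed

end

section \<open>The Hilbert series\<close>

lemma of_sqmat_inject_nth: "A = B" if "\<And>i j. of_sqmat A $ i $ j = of_sqmat B $ i $ j"
  using that by (simp add: of_sqmat_inject[symmetric] vec_eq_iff)

lemma of_to_sqmat [simp]: "of_sqmat (to_sqmat A) = A"
  by (simp add: to_sqmat_inverse)

lemma of_sqmat_nth:
  "of_sqmat (A + B) $ i $ j = of_sqmat A $ i $ j + of_sqmat B $ i $ j"
  "of_sqmat (A - B) $ i $ j = of_sqmat A $ i $ j - of_sqmat B $ i $ j"
  "of_sqmat (A * B) $ i $ j = (\<Sum>k\<in>UNIV. of_sqmat A $ i $ k * of_sqmat B $ k $ j)"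
  "of_sqmat (1 :: ('a::ring_1, 'n::finite) sqmat) $ i $ j = (if i = j then 1 else 0)"
  "of_sqmat (0 :: ('a::ring_1, 'n::finite) sqmat) $ i $ j = 0"
  by (simp_all add: plus_sqmat.rep_eq minus_sqmat.rep_eq times_sqmat.rep_eq one_sqmat.rep_eq
      zero_sqmat.rep_eq matrix_matrix_mult_def mat_def)

text \<open>Matrix coefficients do not commute, so the second identity needs an argument:
  \<open>D\<close> has constant term 1, hence some right inverse, and this one must be
  \<open>h\<close>.\<close>

lemma fps_right_inverse_imp_left:
  fixes h D :: "'r::ring_1 fps"
  assumes "h * D = 1" "fps_nth D 0 = 1"
  shows "D * h = 1"
proof -
  have r: "D * fps_right_inverse D 1 = 1"
    using fps_right_inverse[of D 1] assms(2) by simp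
  have "h = h * (D * fps_right_inverse D 1)" by (simp add: r)
  also have "\<dots> = fps_right_inverse D 1" by (simp add: assms(1) flip: mult.assoc)
  finally show ?thesis using r by simp
qed

context quiver_extension
begin

definition lam_series :: "(int, 'v) sqmat fps" where
  "lam_series = Abs_fps (\<lambda>n. to_sqmat (\<chi> j i. lam j n i))"

text \<open>Rows are indexed by the start vertex, so extending walks by a last arrow is
  multiplication by C on the right.\<close>

lemma lam_series_adjacency:
  "of_sqmat (fps_nth lam_series n * adjacency_matrix G) $ j $ i =
     (\<Sum>a | a \<in> arcs G \<and> head G a = i. lam j n (tail G a))"
proof -
  have "(\<Sum>a | a \<in> arcs G \<and> head G a = i. lam j n (tail G a)) =
      (\<Sum>k\<in>UNIV. \<Sum>a | a \<in> {a. a \<in> arcs G \<and> head G a = i} \<and> tail G a = k. lam j n (tail G a))"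
    by (rule sum.group[symmetric]) auto
  also have "\<dots> = (\<Sum>k\<in>UNIV. \<Sum>a | a \<in> arcs G \<and> tail G a = k \<and> head G a = i. lam j n k)"
    by (intro sum.cong refl) auto
  also have "\<dots> = (\<Sum>k\<in>UNIV. lam j n k * int (card {a. a \<in> arcs G \<and> tail G a = k \<and> head G a = i}))"
    by (simp add: mult.commute)
  finally show ?thesis by (simp add: of_sqmat_nth lam_series_def adjacency_matrix_def)
qed

lemma hilbert_series_nth: "of_sqmat (fps_nth (hilbert_series Q v) n) $ j $ i = bdim j n i"
proof -
  have "bdim j n i \<ge> 0"
    using fs.dim_mono_finite[OF fin_dim_F I_subset_F subspace_I subspace_F] by (simp add: bdim_def)
  then show ?thesis
    by (simp add: hilbert_series_def dimension_matrix_def dimension_peirce_piece)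
qed

text \<open>Multiplication by \<open>1 - fps_X\<^sup>2\<close> undoes the powers of z and leaves the
  series of the preprojective algebra; the recursion \<open>lam_Suc_Suc\<close> says that this
  series times the quadratic factor is 1.\<close>

lemma hilbert_series_inverse:
  assumes socle_free: "\<And>j n. socle_free j n"
  defines "C \<equiv> fps_const (adjacency_matrix G)"
  defines "D \<equiv> (1 - C * fps_X + fps_X\<^sup>2) * (1 - fps_X\<^sup>2)"
  shows "hilbert_series Q v * D = 1" "D * hilbert_series Q v = 1"
proof -
  let ?h = "hilbert_series Q v"
  have cases: "n = 0 \<or> n = Suc 0 \<or> (\<exists>m. n = Suc (Suc m))" for n :: nat
    by (cases n; cases "n - 1") auto
  have h: "?h * (1 - fps_X\<^sup>2) = lam_series"
  proof (rule fps_ext)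
    fix n
    have nth: "fps_nth (?h * (1 - fps_X\<^sup>2)) n = fps_nth ?h n - (if n < 2 then 0 else fps_nth ?h (n - 2))"
      by (simp add: right_diff_distrib fps_X_power_mult_right_nth)
    show "fps_nth (?h * (1 - fps_X\<^sup>2)) n = fps_nth lam_series n"
    proof (rule of_sqmat_inject_nth)
      fix j i
      show "of_sqmat (fps_nth (?h * (1 - fps_X\<^sup>2)) n) $ j $ i = of_sqmat (fps_nth lam_series n) $ j $ i"
        using cases[of n] bdim_Suc_Suc[OF socle_free] bdim_lt_2[of n j i]
        by (auto simp: nth of_sqmat_nth hilbert_series_nth lam_series_def)
    qed
  qed
  have l: "lam_series * (1 - C * fps_X + fps_X\<^sup>2) = 1"
  proof (rule fps_ext)
    fix n
    have nth: "fps_nth (lam_series * (1 - C * fps_X + fps_X\<^sup>2)) n = fps_nth lam_series n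
        - (if n = 0 then 0 else fps_nth lam_series (n - 1) * adjacency_matrix G)
        + (if n < 2 then 0 else fps_nth lam_series (n - 2))"
      by (simp add: distrib_left right_diff_distrib fps_X_power_mult_right_nth C_def flip: mult.assoc)
    show "fps_nth (lam_series * (1 - C * fps_X + fps_X\<^sup>2)) n = fps_nth 1 n"
    proof (rule of_sqmat_inject_nth)
      fix j i
      have e: "of_sqmat (fps_nth lam_series m) $ j $ i = lam j m i" for m j i
        by (simp add: lam_series_def)
      show "of_sqmat (fps_nth (lam_series * (1 - C * fps_X + fps_X\<^sup>2)) n) $ j $ i = of_sqmat (fps_nth 1 n) $ j $ i"
        unfolding nth using cases[of n] lam_Suc_Suc[OF socle_free]
        by (auto simp: of_sqmat_nth(1,2,4,5) lam_series_adjacency e lam_0 lam_Suc_0)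
    qed
  qed
  \<comment> \<open>The factor in t alone is central, so the factors of \<open>D\<close> may be put
    into the order in which they act on the Hilbert series from the right.\<close>
  have "P * (1 - fps_X\<^sup>2) = (1 - fps_X\<^sup>2) * P" for P :: "(int, 'v) sqmat fps"
    by (simp add: right_diff_distrib left_diff_distrib fps_mult_fps_X_power_commute)
  then have "D = (1 - fps_X\<^sup>2) * (1 - C * fps_X + fps_X\<^sup>2)"
    unfolding D_def .
  then have "?h * D = (?h * (1 - fps_X\<^sup>2)) * (1 - C * fps_X + fps_X\<^sup>2)"
    by (simp only: mult.assoc)
  then show 1: "?h * D = 1" unfolding h l .
  have "fps_nth D 0 = 1" by (simp add: D_def)
  from fps_right_inverse_imp_left[OF 1 this] show "D * ?h = 1" .
qed

end

theorem theorem4p2: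
  fixes Q :: "('v::finite, 'a) pre_digraph"
    and v :: "'v \<Rightarrow> 'k::field"
  assumes "fin_digraph Q"
    and "verts Q = UNIV"
    and "Digraph_Component.connected Q"
    and "acyclic_quiver Q"
    and "\<not> dynkin Q"
  shows "let h = hilbert_series Q v;
             C = fps_const (adjacency_matrix (double_quiver Q));
             t = fps_X;
             D = (1 - C * t + t\<^sup>2) * (1 - t\<^sup>2)
         in h * D = 1 \<and> D * h = 1"
proof -
  interpret quiver_extension Q v
    using assms(1,2) by (rule quiver_extension.intro)
  obtain d :: "'v \<Rightarrow> real" where d: "\<And>k. d k > 0"
    "\<And>k. 2 * d k \<le> (\<Sum>e | e \<in> arcs G \<and> tail G e = k. d (head G e))"
    using non_dynkin_weights[OF assms(1,2,3,5)] by blast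
  have "socle_free j n" for j n
    by (rule socle_free_if_weights[where V = UNIV and d = d]) (simp_all add: d)
  from hilbert_series_inverse[OF this] show ?thesis
    by (simp only: Let_def simp_thms)
qed

end
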